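(* Let $T=(T_1,\ldots,T_d)$ be a nilpotent commuting row contraction on some Hilbert space $\mathfrak{H}$. The following statements hold. (1) Assume that $T^*=(T_1^*,\ldots,T_d^* )$ is cyclic. Let $\mathfrak{M},\mathfrak{N}\subset\mathfrak{H}$ be invariant subspaces for $T$ such that $\mathrm{Ann}_{\mathrm{c}}(T|_{\mathfrak{M}})=\mathrm{Ann}_{\mathrm{c}}(T|_{\mathfrak{N}})$. Then $\mathfrak{M}=\mathfrak{N}$. (2) Assume that $T$ is cyclic. Let $\mathfrak{M}\subset\mathfrak{H}$ be an invariant subspace for $T$ such that $\mathrm{Ann}_{\mathrm{c}}(T|_{\mathfrak{M}})=\mathrm{Ann}_{\mathrm{c}}(T)$. Then $\mathfrak{M}=\mathfrak{H}$.
   Context: Fix a positive integer $d$. The Drury--Arveson space $H^2_d$ is the Hilbert space of analytic functions $f=\sum_{\alpha\in\mathbb{N}^d}c_\alpha x^\alpha$ on the open unit ball $\mathbb{B}_d\subset\mathbb{C}^d$ with $\|f\|^2=\sum_{\alpha}\frac{\alpha!}{|\alpha|!}|c_\alpha|^2<\infty$; $x_1,\dots,x_d$ are the coordinate functions. $\mathcal{M}_d$ is its multiplier algebra, viewed as a weak-$*$ closed unital subalgebra of $B(H^2_d)$ via $\phi\mapsto M_\phi$, $M_\phi f=\phi f$. A $d$-tuple $T=(T_1,\dots,T_d)$ of bounded operators on $\mathfrak{H}$ is a row contraction if $\sum_{k=1}^d T_kT_k^*\le I$; it is commuting if the $T_k$ commute with each other; it is pure if $\lim_{n\to\infty}\sum_{|w|=n}\|T_w^*\xi\|^2=0$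 for all $\xi\in\mathfrak{H}$, where $w=i_1\cdots i_n$ ranges over words of length $n$ in $\{1,\dots,d\}$ and $T_w=T_{i_1}\cdots T_{i_n}$. A commuting $d$-tuple is nilpotent if for each $k$ there is $m_k\in\mathbb{N}$ with $T_k^{m_k}=0$; a nilpotent commuting row contraction is pure. A $d$-tuple $S$ on $\mathfrak{H}$ is cyclic if there is a vector $\xi$ such that $\mathfrak{H}$ is the closed linear span of $\{S_w\xi\}$ over all words $w$ (including the empty word). For a pure commuting row contraction $T$ there is a unique unital completely contractive weak-$*$ continuous homomorphism $\mathcal{M}_d\to B(\mathfrak{H})$ sending $M_{x_k}$ to $T_k$ for each $k$; the image of $\phi$ is written $\phi(T)$. $\mathrm{Ann}_{\mathrm{c}}(T)=\{\phi\in\mathcal{M}_d:\phi(T)=0\}$. A subspace $\mathfrak{M}$ is invariant for $T$ if $T_k\mathfrak{M}\subset\mathfrak{M}$ for all $k$, and $T|_{\mathfrak{M}}=(T_1|_{\mathfrak{M}},\ldots,T_d|_{\mathfrak{M}})$. *)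

theory Defs
  imports "HOL-Analysis.Analysis" "HOL-Library.Nonpos_Ints"
begin

section \<open>Complex Hilbert spaces and their operators\<close>

text \<open>\<open>cinner\<close> is linear in its first argument and conjugate-linear in the second.
  The last axiom ties it to the norm, since \<open>norm x = sqrt (inner x x)\<close> in \<^class>\<open>real_inner\<close>.\<close>

class chilbert_space = real_inner + complete_space +
  fixes scaleC :: "complex \<Rightarrow> 'a \<Rightarrow> 'a" (infixr "*\<^sub>C" 75)
    and cinner :: "'a \<Rightarrow> 'a \<Rightarrow> complex"
  assumes scaleC_add_right: "a *\<^sub>C (x + y) = a *\<^sub>C x + a *\<^sub>C y"
    and scaleC_add_left: "(a + b) *\<^sub>C x = a *\<^sub>C x + b *\<^sub>C x"
    and scaleC_scaleC: "a *\<^sub>C b *\<^sub>C x = (a * b) *\<^sub>C x"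
    and scaleC_of_real: "complex_of_real r *\<^sub>C x = r *\<^sub>R x"
    and cinner_add_left: "cinner (x + y) z = cinner x z + cinner y z"
    and cinner_scaleC_left: "cinner (a *\<^sub>C x) y = a * cinner x y"
    and cinner_commute: "cinner x y = cnj (cinner y x)"
    and Re_cinner: "Re (cinner x y) = inner x y"

lemma vector_space_scaleC:
  "vector_space (scaleC :: complex \<Rightarrow> 'a \<Rightarrow> 'a::chilbert_space)"
proof
  show "1 *\<^sub>C x = x" for x :: 'a
    using scaleC_of_real[of 1 x] by simp
qed (simp_all add: scaleC_add_right scaleC_add_left scaleC_scaleC)

abbreviation cspan :: "'h::chilbert_space set \<Rightarrow> 'h set" where
  "cspan \<equiv> module.span scaleC"

abbreviation csubspace :: "'h::chilbert_space set \<Rightarrow> bool" where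
  "csubspace \<equiv> module.subspace scaleC"

text \<open>\<open>bounded_ops M\<close> is \<open>B(M)\<close>.  In order that operators on a subspace \<open>M\<close> can be compared
  by plain equality, they are represented as functions that are \<^const>\<open>undefined\<close> off \<open>M\<close>;
  for \<open>M = UNIV\<close> this is no constraint.\<close>

definition bounded_ops :: "'h::chilbert_space set \<Rightarrow> ('h \<Rightarrow> 'h) set" where
  "bounded_ops M = {A \<in> M \<rightarrow>\<^sub>E M.
     (\<forall>x\<in>M. \<forall>y\<in>M. A (x + y) = A x + A y) \<and>
     (\<forall>a. \<forall>x\<in>M. A (a *\<^sub>C x) = a *\<^sub>C A x) \<and>
     (\<exists>K. \<forall>x\<in>M. norm (A x) \<le> K * norm x)}"

definition cadjoint :: "('h::chilbert_space \<Rightarrow> 'h) \<Rightarrow> 'h \<Rightarrow> 'h" where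
  "cadjoint A = (THE B. \<forall>x y. cinner (A x) y = cinner x (B y))"

text \<open>The norm of the \<open>n \<times> n\<close> operator matrix \<open>A\<close> acting on the direct sum of \<open>n\<close> copies
  of \<open>M\<close>.\<close>

definition matrix_opnorm ::
  "'h::chilbert_space set \<Rightarrow> nat \<Rightarrow> (nat \<Rightarrow> nat \<Rightarrow> 'h \<Rightarrow> 'h) \<Rightarrow> real" where
  "matrix_opnorm M n A =
     Sup {sqrt (\<Sum>i<n. (norm (\<Sum>j<n. A i j (v j)))\<^sup>2) | v :: nat \<Rightarrow> 'h.
          (\<forall>j<n. v j \<in> M) \<and> (\<Sum>j<n. (norm (v j))\<^sup>2) \<le> 1}"

text \<open>The trace class functionals on \<open>B(M)\<close> are exactly the maps
  \<open>A \<mapsto> \<Sum>n. \<langle>A \<xi>\<^sub>n, \<eta>\<^sub>n\<rangle>\<close> with \<open>(\<xi>\<^sub>n)\<close> and \<open>(\<eta>\<^sub>n)\<close> square-summable in \<open>M\<close>.\<close>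

definition predual :: "'h::chilbert_space set \<Rightarrow> (('h \<Rightarrow> 'h) \<Rightarrow> complex) set" where
  "predual M = {\<lambda>A. \<Sum>n. cinner (A (\<xi> n)) (\<eta> n) | \<xi> \<eta> :: nat \<Rightarrow> 'h.
     range \<xi> \<subseteq> M \<and> range \<eta> \<subseteq> M \<and>
     summable (\<lambda>n. (norm (\<xi> n))\<^sup>2) \<and> summable (\<lambda>n. (norm (\<eta> n))\<^sup>2)}"

definition weak_star :: "'h::chilbert_space set \<Rightarrow> ('h \<Rightarrow> 'h) topology" where
  "weak_star M = topology_generated_by
     {{A \<in> bounded_ops M. \<omega> A \<in> U} | \<omega> U. \<omega> \<in> predual M \<and> open U}"


section \<open>The Drury--Arveson space\<close>

text \<open>\<open>da_weight \<alpha>\<close> is the squared norm \<open>\<alpha>!/|\<alpha>|!\<close> of the monomial \<open>x\<^sup>\<alpha>\<close>.\<close>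

definition da_weight :: "('d::finite \<Rightarrow> nat) \<Rightarrow> real" where
  "da_weight \<alpha> = (\<Prod>i\<in>UNIV. fact (\<alpha> i)) / fact (\<Sum>i\<in>UNIV. \<alpha> i)"

text \<open>An element of the Drury--Arveson space is given by the family of its Taylor coefficients at
  the origin; the analytic function on the unit ball that it stands for is \<open>da_eval\<close> below
  (the series converges absolutely on the ball, by the Cauchy--Schwarz inequality).\<close>

typedef ('d::finite) drury_arveson =
  "{c :: ('d \<Rightarrow> nat) \<Rightarrow> complex. (\<lambda>\<alpha>. da_weight \<alpha> * (cmod (c \<alpha>))\<^sup>2) summable_on UNIV}"
  morphisms da_coeff Abs_drury_arveson
  by (rule exI[of _ "\<lambda>_. 0"]) simp

lemma da_weight_pos: "da_weight \<alpha> > 0"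
  by (simp add: da_weight_def prod_pos)

lemma da_coeff_summable:
  "(\<lambda>\<alpha>. da_weight \<alpha> * (cmod (da_coeff f \<alpha>))\<^sup>2) summable_on UNIV"
  using da_coeff[of f] by simp

lemma da_eqI: "(\<And>\<alpha>. da_coeff f \<alpha> = da_coeff g \<alpha>) \<Longrightarrow> f = g"
  by (meson da_coeff_inject ext)

lemma da_coeff_Abs:
  "(\<lambda>\<alpha>. da_weight \<alpha> * (cmod (c \<alpha>))\<^sup>2) summable_on UNIV \<Longrightarrow> da_coeff (Abs_drury_arveson c) = c"
  by (simp add: Abs_drury_arveson_inverse)

lemma da_summable_add:
  assumes "(\<lambda>\<alpha>. da_weight \<alpha> * (cmod (c \<alpha>))\<^sup>2) summable_on UNIV"
    and "(\<lambda>\<alpha>. da_weight \<alpha> * (cmod (e \<alpha>))\<^sup>2) summable_on UNIV"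
  shows "(\<lambda>\<alpha>. da_weight \<alpha> * (cmod (c \<alpha> + e \<alpha>))\<^sup>2) summable_on UNIV"
proof (rule summable_on_comparison_test)
  show "(\<lambda>\<alpha>. 2 * (da_weight \<alpha> * (cmod (c \<alpha>))\<^sup>2) + 2 * (da_weight \<alpha> * (cmod (e \<alpha>))\<^sup>2)) summable_on UNIV"
    by (intro summable_on_add summable_on_cmult_right assms)
  fix \<alpha>
  have "(cmod (c \<alpha> + e \<alpha>))\<^sup>2 \<le> (cmod (c \<alpha>) + cmod (e \<alpha>))\<^sup>2"
    by (simp add: norm_triangle_ineq power_mono)
  also have "\<dots> \<le> 2 * (cmod (c \<alpha>))\<^sup>2 + 2 * (cmod (e \<alpha>))\<^sup>2"
    using sum_squares_bound[of "cmod (c \<alpha>)" "cmod (e \<alpha>)"] by (simp add: power2_sum)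
  finally have "da_weight \<alpha> * (cmod (c \<alpha> + e \<alpha>))\<^sup>2 \<le>
      da_weight \<alpha> * (2 * (cmod (c \<alpha>))\<^sup>2 + 2 * (cmod (e \<alpha>))\<^sup>2)"
    using da_weight_pos[of \<alpha>] by (intro mult_left_mono) auto
  then show "da_weight \<alpha> * (cmod (c \<alpha> + e \<alpha>))\<^sup>2 \<le>
      2 * (da_weight \<alpha> * (cmod (c \<alpha>))\<^sup>2) + 2 * (da_weight \<alpha> * (cmod (e \<alpha>))\<^sup>2)"
    by (simp add: algebra_simps)
  show "0 \<le> da_weight \<alpha> * (cmod (c \<alpha> + e \<alpha>))\<^sup>2"
    using da_weight_pos[of \<alpha>] by simp
qed

lemma da_summable_scale:
  assumes "(\<lambda>\<alpha>. da_weight \<alpha> * (cmod (c \<alpha>))\<^sup>2) summable_on UNIV"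
  shows "(\<lambda>\<alpha>. da_weight \<alpha> * (cmod (a * c \<alpha>))\<^sup>2) summable_on UNIV"
  using summable_on_cmult_right[OF assms, of "(cmod a)\<^sup>2"]
  by (simp add: norm_mult power_mult_distrib mult_ac)

lemma da_inner_summable:
  "(\<lambda>\<alpha>. of_real (da_weight \<alpha>) * (da_coeff f \<alpha> * cnj (da_coeff g \<alpha>))) summable_on UNIV"
proof (rule abs_summable_summable, rule summable_on_comparison_test)
  show "(\<lambda>\<alpha>. da_weight \<alpha> * (cmod (da_coeff f \<alpha>))\<^sup>2 + da_weight \<alpha> * (cmod (da_coeff g \<alpha>))\<^sup>2)
      summable_on UNIV"
    by (intro summable_on_add da_coeff_summable)
  fix \<alpha>
  have "cmod (da_coeff f \<alpha>) * cmod (da_coeff g \<alpha>) \<le> (cmod (da_coeff f \<alpha>))\<^sup>2 + (cmod (da_coeff g \<alpha>))\<^sup>2"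
  proof -
    have "2 * (cmod (da_coeff f \<alpha>) * cmod (da_coeff g \<alpha>)) \<le>
        (cmod (da_coeff f \<alpha>))\<^sup>2 + (cmod (da_coeff g \<alpha>))\<^sup>2"
      using sum_squares_bound[of "cmod (da_coeff f \<alpha>)" "cmod (da_coeff g \<alpha>)"] by simp
    moreover have "0 \<le> cmod (da_coeff f \<alpha>) * cmod (da_coeff g \<alpha>)" by simp
    ultimately show ?thesis by linarith
  qed
  then have "da_weight \<alpha> * (cmod (da_coeff f \<alpha>) * cmod (da_coeff g \<alpha>)) \<le>
      da_weight \<alpha> * ((cmod (da_coeff f \<alpha>))\<^sup>2 + (cmod (da_coeff g \<alpha>))\<^sup>2)"
    using da_weight_pos[of \<alpha>] by (intro mult_left_mono) auto
  then show "norm (of_real (da_weight \<alpha>) * (da_coeff f \<alpha> * cnj (da_coeff g \<alpha>))) \<le>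
      da_weight \<alpha> * (cmod (da_coeff f \<alpha>))\<^sup>2 + da_weight \<alpha> * (cmod (da_coeff g \<alpha>))\<^sup>2"
    using da_weight_pos[of \<alpha>] by (simp add: norm_mult algebra_simps)
qed simp

instantiation drury_arveson :: (finite) real_inner
begin

definition zero_drury_arveson :: "'a drury_arveson" where
  "0 = Abs_drury_arveson (\<lambda>_. 0)"

definition plus_drury_arveson :: "'a drury_arveson \<Rightarrow> 'a drury_arveson \<Rightarrow> 'a drury_arveson" where
  "f + g = Abs_drury_arveson (\<lambda>\<alpha>. da_coeff f \<alpha> + da_coeff g \<alpha>)"

definition uminus_drury_arveson :: "'a drury_arveson \<Rightarrow> 'a drury_arveson" where
  "- f = Abs_drury_arveson (\<lambda>\<alpha>. - da_coeff f \<alpha>)"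

definition minus_drury_arveson :: "'a drury_arveson \<Rightarrow> 'a drury_arveson \<Rightarrow> 'a drury_arveson" where
  "f - g = f + (- g :: 'a drury_arveson)"

definition scaleR_drury_arveson :: "real \<Rightarrow> 'a drury_arveson \<Rightarrow> 'a drury_arveson" where
  "r *\<^sub>R f = Abs_drury_arveson (\<lambda>\<alpha>. of_real r * da_coeff f \<alpha>)"

definition inner_drury_arveson :: "'a drury_arveson \<Rightarrow> 'a drury_arveson \<Rightarrow> real" where
  "inner f g = Re (\<Sum>\<^sub>\<infinity>\<alpha>. of_real (da_weight \<alpha>) * (da_coeff f \<alpha> * cnj (da_coeff g \<alpha>)))"

definition norm_drury_arveson :: "'a drury_arveson \<Rightarrow> real" where
  "norm f = sqrt (inner f f)" for f :: "'a drury_arveson"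

definition dist_drury_arveson :: "'a drury_arveson \<Rightarrow> 'a drury_arveson \<Rightarrow> real" where
  "dist f g = norm (f - g)" for f g :: "'a drury_arveson"

definition sgn_drury_arveson :: "'a drury_arveson \<Rightarrow> 'a drury_arveson" where
  "sgn f = inverse (norm f) *\<^sub>R f" for f :: "'a drury_arveson"

definition uniformity_drury_arveson :: "('a drury_arveson \<times> 'a drury_arveson) filter" where
  "uniformity_drury_arveson = (INF e\<in>{0 <..}. principal {(f, g). dist f g < e})"

definition open_drury_arveson :: "'a drury_arveson set \<Rightarrow> bool" where
  "open_drury_arveson U \<longleftrightarrow> (\<forall>f\<in>U. eventually (\<lambda>(f', g). f' = f \<longrightarrow> g \<in> U) uniformity)"

lemma da_coeff_zero [simp]: "da_coeff (0 :: 'a drury_arveson) \<alpha> = 0"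
  by (simp add: zero_drury_arveson_def da_coeff_Abs)

lemma da_coeff_add [simp]:
  "da_coeff (f + g :: 'a drury_arveson) \<alpha> = da_coeff f \<alpha> + da_coeff g \<alpha>"
  by (simp add: plus_drury_arveson_def da_coeff_Abs da_summable_add da_coeff_summable)

lemma da_coeff_uminus [simp]: "da_coeff (- f :: 'a drury_arveson) \<alpha> = - da_coeff f \<alpha>"
  by (simp add: uminus_drury_arveson_def da_coeff_Abs da_coeff_summable)

lemma da_coeff_diff [simp]:
  "da_coeff (f - g :: 'a drury_arveson) \<alpha> = da_coeff f \<alpha> - da_coeff g \<alpha>"
  by (simp add: minus_drury_arveson_def)

lemma da_coeff_scaleR [simp]:
  "da_coeff (r *\<^sub>R f :: 'a drury_arveson) \<alpha> = of_real r * da_coeff f \<alpha>"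
  by (simp only: scaleR_drury_arveson_def da_coeff_Abs[OF da_summable_scale[OF da_coeff_summable]])

lemma da_inner_self:
  "inner f f = (\<Sum>\<^sub>\<infinity>\<alpha>. da_weight \<alpha> * (cmod (da_coeff f \<alpha>))\<^sup>2)" for f :: "'a drury_arveson"
proof -
  have "inner f f =
      (\<Sum>\<^sub>\<infinity>\<alpha>. Re (of_real (da_weight \<alpha>) * (da_coeff f \<alpha> * cnj (da_coeff f \<alpha>))))"
    unfolding inner_drury_arveson_def by (rule infsum_Re[symmetric], rule da_inner_summable)
  also have "\<dots> = (\<Sum>\<^sub>\<infinity>\<alpha>. da_weight \<alpha> * (cmod (da_coeff f \<alpha>))\<^sup>2)"
    by (rule infsum_cong) (simp only: complex_norm_square[symmetric] of_real_mult[symmetric] Re_complex_of_real)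
  finally show ?thesis .
qed

instance
proof
  fix f g h :: "'a drury_arveson" and r s :: real
  show "f + g + h = f + (g + h)" "f + g = g + f" "0 + f = f" "- f + f = 0" "f - g = f + - g"
    by (rule da_eqI; simp)+
  show "r *\<^sub>R (f + g) = r *\<^sub>R f + r *\<^sub>R g" "(r + s) *\<^sub>R f = r *\<^sub>R f + s *\<^sub>R f"
    "r *\<^sub>R s *\<^sub>R f = (r * s) *\<^sub>R f" "1 *\<^sub>R f = f"
    by (rule da_eqI; simp add: algebra_simps)+
  show "sgn f = inverse (norm f) *\<^sub>R f" by (simp add: sgn_drury_arveson_def)
  show "dist f g = norm (f - g)" by (simp add: dist_drury_arveson_def)
  show "norm f = sqrt (inner f f)" by (simp add: norm_drury_arveson_def)
  show "(uniformity :: ('a drury_arveson \<times> 'a drury_arveson) filter) =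
      (INF e\<in>{0 <..}. principal {(f, g). dist f g < e})"
    by (simp add: uniformity_drury_arveson_def)
  show "open U \<longleftrightarrow> (\<forall>f\<in>U. eventually (\<lambda>(f', g). f' = f \<longrightarrow> g \<in> U) uniformity)"
    for U :: "'a drury_arveson set"
    by (simp add: open_drury_arveson_def)
  have "(\<Sum>\<^sub>\<infinity>\<alpha>. of_real (da_weight \<alpha>) * (da_coeff f \<alpha> * cnj (da_coeff g \<alpha>))) =
      cnj (\<Sum>\<^sub>\<infinity>\<alpha>. of_real (da_weight \<alpha>) * (da_coeff g \<alpha> * cnj (da_coeff f \<alpha>)))"
    by (simp only: infsum_cnj[symmetric]) (simp add: mult_ac)
  then show "inner f g = inner g f" by (simp add: inner_drury_arveson_def)
  show "inner (f + g) h = inner f h + inner g h"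
    using infsum_add[OF da_inner_summable[of f h] da_inner_summable[of g h]]
    by (simp add: inner_drury_arveson_def algebra_simps)
  show "inner (r *\<^sub>R f) g = r * inner f g"
    using infsum_cmult_right[OF da_inner_summable[of f g], of "of_real r"]
    by (simp add: inner_drury_arveson_def mult_ac)
  show "0 \<le> inner f f"
    unfolding da_inner_self by (intro infsum_nonneg mult_nonneg_nonneg less_imp_le[OF da_weight_pos]) simp
  show "inner f f = 0 \<longleftrightarrow> f = 0"
  proof
    assume "inner f f = 0"
    then have "da_weight \<alpha> * (cmod (da_coeff f \<alpha>))\<^sup>2 = 0" for \<alpha>
      unfolding da_inner_self
      by (intro nonneg_infsum_le_0D[OF _ da_coeff_summable[of f]])
         (auto intro!: mult_nonneg_nonneg less_imp_le[OF da_weight_pos])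
    then show "f = 0"
      by (intro da_eqI) (simp add: da_weight_pos[THEN less_imp_neq, symmetric])
  qed (simp add: da_inner_self)
qed

end

instantiation drury_arveson :: (finite) chilbert_space
begin

definition scaleC_drury_arveson :: "complex \<Rightarrow> 'a drury_arveson \<Rightarrow> 'a drury_arveson" where
  "a *\<^sub>C f = Abs_drury_arveson (\<lambda>\<alpha>. a * da_coeff f \<alpha>)"

definition cinner_drury_arveson :: "'a drury_arveson \<Rightarrow> 'a drury_arveson \<Rightarrow> complex" where
  "cinner f g = (\<Sum>\<^sub>\<infinity>\<alpha>. of_real (da_weight \<alpha>) * (da_coeff f \<alpha> * cnj (da_coeff g \<alpha>)))"

lemma da_coeff_scaleC [simp]: "da_coeff (a *\<^sub>C f :: 'a drury_arveson) \<alpha> = a * da_coeff f \<alpha>"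
  by (simp only: scaleC_drury_arveson_def da_coeff_Abs[OF da_summable_scale[OF da_coeff_summable]])

lemma da_norm_sq:
  "(norm f)\<^sup>2 = (\<Sum>\<^sub>\<infinity>\<alpha>. da_weight \<alpha> * (cmod (da_coeff f \<alpha>))\<^sup>2)" for f :: "'a drury_arveson"
  by (simp add: power2_norm_eq_inner da_inner_self)

lemma da_finite_sum_le:
  fixes f :: "'a drury_arveson"
  assumes "finite F"
  shows "(\<Sum>\<alpha>\<in>F. da_weight \<alpha> * (cmod (da_coeff f \<alpha>))\<^sup>2) \<le> (norm f)\<^sup>2"
  unfolding da_norm_sq
  by (rule finite_sum_le_infsum[OF da_coeff_summable assms])
     (auto intro!: mult_nonneg_nonneg less_imp_le[OF da_weight_pos])

lemma da_coeff_le: "cmod (da_coeff f \<alpha>) \<le> norm f / sqrt (da_weight \<alpha>)" for f :: "'a drury_arveson"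
proof -
  have "da_weight \<alpha> * (cmod (da_coeff f \<alpha>))\<^sup>2 \<le> (norm f)\<^sup>2"
    using da_finite_sum_le[of "{\<alpha>}" f] by simp
  then have "(sqrt (da_weight \<alpha>) * cmod (da_coeff f \<alpha>))\<^sup>2 \<le> (norm f)\<^sup>2"
    using da_weight_pos[of \<alpha>] by (simp add: power_mult_distrib)
  then have "sqrt (da_weight \<alpha>) * cmod (da_coeff f \<alpha>) \<le> norm f"
    using power2_le_imp_le norm_ge_zero by blast
  then show ?thesis
    using da_weight_pos[of \<alpha>] by (simp add: field_simps)
qed

lemma da_Cauchy_convergent:
  fixes X :: "nat \<Rightarrow> 'a drury_arveson"
  assumes X: "Cauchy X"
  shows "convergent X"
proof -
  have "Cauchy (\<lambda>n. da_coeff (X n) \<alpha>)" for \<alpha>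
  proof (rule CauchyI)
    fix e :: real assume "0 < e"
    then have "0 < e * sqrt (da_weight \<alpha>)" using da_weight_pos[of \<alpha>] by simp
    then obtain M where M: "\<forall>m\<ge>M. \<forall>n\<ge>M. norm (X m - X n) < e * sqrt (da_weight \<alpha>)"
      using CauchyD[OF X] by blast
    show "\<exists>M. \<forall>m\<ge>M. \<forall>n\<ge>M. norm (da_coeff (X m) \<alpha> - da_coeff (X n) \<alpha>) < e"
    proof (intro exI allI impI)
      fix m n assume "M \<le> m" "M \<le> n"
      then have "norm (X m - X n) / sqrt (da_weight \<alpha>) < e"
        using M da_weight_pos[of \<alpha>] by (simp add: field_simps)
      then show "norm (da_coeff (X m) \<alpha> - da_coeff (X n) \<alpha>) < e"
        using da_coeff_le[of "X m - X n" \<alpha>] by simp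
    qed
  qed
  then have "\<forall>\<alpha>. \<exists>l. (\<lambda>n. da_coeff (X n) \<alpha>) \<longlonglongrightarrow> l"
    by (meson Cauchy_convergent convergent_def)
  then obtain c where c: "\<And>\<alpha>. (\<lambda>n. da_coeff (X n) \<alpha>) \<longlonglongrightarrow> c \<alpha>" by metis
  have bound: "(\<Sum>\<alpha>\<in>F. da_weight \<alpha> * (cmod (da_coeff (X m) \<alpha> - c \<alpha>))\<^sup>2) \<le> e\<^sup>2"
    if "finite F" "\<forall>n\<ge>M. norm (X m - X n) < e" for F e m M
  proof (rule LIMSEQ_le_const2)
    show "(\<lambda>n. \<Sum>\<alpha>\<in>F. da_weight \<alpha> * (cmod (da_coeff (X m) \<alpha> - da_coeff (X n) \<alpha>))\<^sup>2)
        \<longlonglongrightarrow> (\<Sum>\<alpha>\<in>F. da_weight \<alpha> * (cmod (da_coeff (X m) \<alpha> - c \<alpha>))\<^sup>2)"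
      by (intro tendsto_intros c)
    have "(\<Sum>\<alpha>\<in>F. da_weight \<alpha> * (cmod (da_coeff (X m) \<alpha> - da_coeff (X n) \<alpha>))\<^sup>2) \<le> e\<^sup>2"
      if "n \<ge> M" for n
    proof -
      have "(norm (X m - X n))\<^sup>2 \<le> e\<^sup>2"
        using \<open>\<forall>n\<ge>M. norm (X m - X n) < e\<close> that by (intro power_mono) (auto simp: less_imp_le)
      then show ?thesis
        using da_finite_sum_le[OF \<open>finite F\<close>, of "X m - X n"] by simp
    qed
    then show "\<exists>N. \<forall>n\<ge>N. (\<Sum>\<alpha>\<in>F. da_weight \<alpha> * (cmod (da_coeff (X m) \<alpha> - da_coeff (X n) \<alpha>))\<^sup>2) \<le> e\<^sup>2"
      by blast
  qed
  have summ: "(\<lambda>\<alpha>. da_weight \<alpha> * (cmod (da_coeff (X m) \<alpha> - c \<alpha>))\<^sup>2) summable_on UNIV"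
    if "\<forall>n\<ge>M. norm (X m - X n) < e" for e m M
  proof (rule nonneg_bdd_above_summable_on)
    show "bdd_above (sum (\<lambda>\<alpha>. da_weight \<alpha> * (cmod (da_coeff (X m) \<alpha> - c \<alpha>))\<^sup>2) ` {F. F \<subseteq> UNIV \<and> finite F})"
      using bound[OF _ that] by (auto intro!: bdd_aboveI[of _ "e\<^sup>2"])
  qed (simp add: less_imp_le[OF da_weight_pos])
  obtain M1 where M1: "\<forall>m\<ge>M1. \<forall>n\<ge>M1. norm (X m - X n) < 1"
    using CauchyD[OF X, of 1] by auto
  have "(\<lambda>\<alpha>. da_weight \<alpha> * (cmod (da_coeff (X M1) \<alpha> + (- 1) * (da_coeff (X M1) \<alpha> - c \<alpha>)))\<^sup>2) summable_on UNIV"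
    using M1 by (intro da_summable_add da_coeff_summable da_summable_scale summ[of M1 _ 1]) auto
  then have c_summ: "(\<lambda>\<alpha>. da_weight \<alpha> * (cmod (c \<alpha>))\<^sup>2) summable_on UNIV" by simp
  define L where "L = (Abs_drury_arveson c :: 'a drury_arveson)"
  have L: "da_coeff L = c" unfolding L_def by (rule da_coeff_Abs[OF c_summ])
  have "X \<longlonglongrightarrow> L"
  proof (rule LIMSEQ_I)
    fix r :: real assume "0 < r"
    then obtain M where M: "\<forall>m\<ge>M. \<forall>n\<ge>M. norm (X m - X n) < r / 2"
      using CauchyD[OF X, of "r / 2"] by auto
    show "\<exists>no. \<forall>n\<ge>no. norm (X n - L) < r"
    proof (intro exI allI impI)
      fix m assume "M \<le> m"
      then have m: "\<forall>n\<ge>M. norm (X m - X n) < r / 2" using M by blast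
      have "(norm (X m - L))\<^sup>2 \<le> (r / 2)\<^sup>2"
        unfolding da_norm_sq
        by (rule infsum_le_finite_sums[OF da_coeff_summable])
           (use bound[OF _ m] in \<open>simp add: L\<close>)
      then have "norm (X m - L) \<le> r / 2" using \<open>0 < r\<close> power2_le_imp_le[of "norm (X m - L)" "r / 2"] by linarith
      then show "norm (X m - L) < r" using \<open>0 < r\<close> by simp
    qed
  qed
  then show ?thesis by (auto simp: convergent_def)
qed

instance
proof
  fix f g h :: "'a drury_arveson" and a b :: complex and r :: real
  show "a *\<^sub>C (f + g) = a *\<^sub>C f + a *\<^sub>C g" "(a + b) *\<^sub>C f = a *\<^sub>C f + b *\<^sub>C f"
    "a *\<^sub>C b *\<^sub>C f = (a * b) *\<^sub>C f" "complex_of_real r *\<^sub>C f = r *\<^sub>R f"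
    by (rule da_eqI; simp add: algebra_simps)+
  show "cinner (f + g) h = cinner f h + cinner g h"
    using infsum_add[OF da_inner_summable[of f h] da_inner_summable[of g h]]
    by (simp add: cinner_drury_arveson_def algebra_simps)
  show "cinner (a *\<^sub>C f) g = a * cinner f g"
    using infsum_cmult_right[OF da_inner_summable[of f g], of a]
    by (simp add: cinner_drury_arveson_def mult_ac)
  show "cinner f g = cnj (cinner g f)"
    unfolding cinner_drury_arveson_def by (simp only: infsum_cnj[symmetric]) (simp add: mult_ac)
  show "Re (cinner f g) = inner f g"
    by (simp add: cinner_drury_arveson_def inner_drury_arveson_def)
qed (rule da_Cauchy_convergent)

end

definition da_eval :: "'d::finite drury_arveson \<Rightarrow> complex ^ 'd \<Rightarrow> complex" where
  "da_eval f z = (\<Sum>\<^sub>\<infinity>\<alpha>. da_coeff f \<alpha> * (\<Prod>i\<in>UNIV. (z $ i) ^ \<alpha> i))"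


section \<open>The multiplier algebra\<close>

definition mult_op :: "(complex ^ 'd \<Rightarrow> complex) \<Rightarrow> 'd::finite drury_arveson \<Rightarrow> 'd drury_arveson" where
  "mult_op \<phi> f = (THE g. \<forall>z\<in>ball 0 1. da_eval g z = \<phi> z * da_eval f z)"

text \<open>A multiplier is a function on the ball; its values are normalised to be \<open>0\<close> elsewhere.
  (By the closed graph theorem \<open>mult_op \<phi>\<close> is automatically bounded if \<open>\<phi>\<close> multiplies the
  Drury--Arveson space into itself.)\<close>

definition multipliers :: "(complex ^ 'd::finite \<Rightarrow> complex) set" where
  "multipliers = {\<phi>. (\<forall>z. z \<notin> ball 0 1 \<longrightarrow> \<phi> z = 0) \<and>
     (\<forall>f. \<exists>g. \<forall>z\<in>ball 0 1. da_eval g z = \<phi> z * da_eval f z) \<and>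
     mult_op \<phi> \<in> bounded_ops UNIV}"

definition coord :: "'d::finite \<Rightarrow> complex ^ 'd \<Rightarrow> complex" where
  "coord k z = (if z \<in> ball 0 1 then z $ k else 0)"

abbreviation mult_algebra :: "('d::finite drury_arveson \<Rightarrow> 'd drury_arveson) set" where
  "mult_algebra \<equiv> mult_op ` multipliers"


section \<open>Commuting row contractions and their functional calculus\<close>

definition commuting :: "('d \<Rightarrow> 'h \<Rightarrow> 'h) \<Rightarrow> bool" where
  "commuting T \<longleftrightarrow> (\<forall>j k. T j \<circ> T k = T k \<circ> T j)"

definition row_contraction :: "('d::finite \<Rightarrow> 'h::chilbert_space \<Rightarrow> 'h) \<Rightarrow> bool" where
  "row_contraction T \<longleftrightarrow>
     (\<forall>x. cinner (x - (\<Sum>k\<in>UNIV. T k (cadjoint (T k) x))) x \<in> \<real>\<^sub>\<ge>\<^sub>0)"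

definition nilpotent_tuple :: "('d \<Rightarrow> 'h::chilbert_space \<Rightarrow> 'h) \<Rightarrow> bool" where
  "nilpotent_tuple T \<longleftrightarrow> (\<forall>k. \<exists>m. T k ^^ m = (\<lambda>_. 0))"

definition word_op :: "('d \<Rightarrow> 'h \<Rightarrow> 'h) \<Rightarrow> 'd list \<Rightarrow> 'h \<Rightarrow> 'h" where
  "word_op T w = foldr (\<lambda>i A. T i \<circ> A) w id"

definition cyclic_tuple :: "('d \<Rightarrow> 'h::chilbert_space \<Rightarrow> 'h) \<Rightarrow> bool" where
  "cyclic_tuple T \<longleftrightarrow> (\<exists>\<xi>. closure (cspan (range (\<lambda>w. word_op T w \<xi>))) = UNIV)"

text \<open>No closedness is demanded: a Hilbert space carrying a nilpotent commuting tuple that is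
  cyclic, or whose adjoint tuple is cyclic, is finite-dimensional, so there every subspace is
  closed and hence itself a Hilbert space.\<close>

definition invariant_subspace :: "('d \<Rightarrow> 'h::chilbert_space \<Rightarrow> 'h) \<Rightarrow> 'h set \<Rightarrow> bool" where
  "invariant_subspace T M \<longleftrightarrow> csubspace M \<and> (\<forall>k. T k ` M \<subseteq> M)"

text \<open>\<open>is_calculus M T \<Phi>\<close>: the map \<open>\<Phi>\<close> is a unital completely contractive weak-* continuous
  homomorphism from the multiplier algebra to \<open>B(M)\<close> that sends \<open>M\<^bsub>x\<^sub>k\<^esub>\<close> to \<open>T\<^sub>k\<close>.  Here \<open>T\<close> is a
  tuple in \<open>bounded_ops M\<close>.\<close>

definition is_calculus :: "'h::chilbert_space set \<Rightarrow> ('d::finite \<Rightarrow> 'h \<Rightarrow> 'h) \<Rightarrow>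
    (('d drury_arveson \<Rightarrow> 'd drury_arveson) \<Rightarrow> 'h \<Rightarrow> 'h) \<Rightarrow> bool" where
  "is_calculus M T \<Phi> \<longleftrightarrow>
     \<Phi> \<in> mult_algebra \<rightarrow>\<^sub>E bounded_ops M \<and>
     (\<forall>x\<in>M. \<Phi> id x = x) \<and>
     (\<forall>A\<in>mult_algebra. \<forall>B\<in>mult_algebra. \<forall>x\<in>M. \<Phi> (\<lambda>f. A f + B f) x = \<Phi> A x + \<Phi> B x) \<and>
     (\<forall>a. \<forall>A\<in>mult_algebra. \<forall>x\<in>M. \<Phi> (\<lambda>f. a *\<^sub>C A f) x = a *\<^sub>C \<Phi> A x) \<and>
     (\<forall>A\<in>mult_algebra. \<forall>B\<in>mult_algebra. \<forall>x\<in>M. \<Phi> (A \<circ> B) x = \<Phi> A (\<Phi> B x)) \<and>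
     (\<forall>n A. (\<forall>i<n. \<forall>j<n. A i j \<in> mult_algebra) \<longrightarrow>
        matrix_opnorm M n (\<lambda>i j. \<Phi> (A i j)) \<le> matrix_opnorm UNIV n A) \<and>
     continuous_map (subtopology (weak_star UNIV) mult_algebra) (weak_star M) \<Phi> \<and>
     (\<forall>k. \<Phi> (mult_op (coord k)) = T k)"

text \<open>\<open>fun_calc M T \<phi>\<close> is \<open>\<phi>(T)\<close> for a pure commuting row contraction \<open>T\<close> on \<open>M\<close>;
  for such \<open>T\<close> there is exactly one \<open>\<Phi>\<close>.\<close>

definition fun_calc :: "'h::chilbert_space set \<Rightarrow> ('d::finite \<Rightarrow> 'h \<Rightarrow> 'h) \<Rightarrow>
    (complex ^ 'd \<Rightarrow> complex) \<Rightarrow> 'h \<Rightarrow> 'h" where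
  "fun_calc M T \<phi> = (THE \<Phi>. is_calculus M T \<Phi>) (mult_op \<phi>)"

definition Ann_c :: "'h::chilbert_space set \<Rightarrow> ('d::finite \<Rightarrow> 'h \<Rightarrow> 'h) \<Rightarrow>
    (complex ^ 'd \<Rightarrow> complex) set" where
  "Ann_c M T = {\<phi> \<in> multipliers. \<forall>x\<in>M. fun_calc M T \<phi> x = 0}"

definition restrict_tuple :: "('d \<Rightarrow> 'h \<Rightarrow> 'h) \<Rightarrow> 'h set \<Rightarrow> 'd \<Rightarrow> 'h \<Rightarrow> 'h" where
  "restrict_tuple T M k = restrict (T k) M"

end

theory Submission
  imports Defs
begin

text \<open>A multiplier is determined by its Taylor coefficients at the origin: \<open>mult_algebra\<close> is the
  commutant of the coordinate shifts, and \<open>A\<close> in it is recovered from \<open>A 1\<close>. If \<open>T\<close> is nilpotent,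
  \<open>\<phi>(T)\<close> is therefore the finite sum \<open>\<Sum>\<^sub>\<alpha> c\<^sub>\<alpha> T\<^sup>\<alpha>\<close>. That this is a completely contractive calculus follows
  from the finite-dimensional Drury dilation: on an invariant subspace the defect
  \<open>I - \<Sum>\<^sub>k T\<^sub>k T\<^sub>k\<^sup>*\<close> is a sum of rank one forms \<open>\<langle>\<cdot>, d\<^sub>r\<rangle> d\<^sub>r\<close>, and the maps \<open>f \<mapsto> f(T) d\<^sub>r\<close> form a coisometric row.
  It is the only calculus because the Fejer means of a multiplier are polynomials that converge to it
  in the weak-* topology.

  For (1), cyclicity of \<open>T\<^sup>*\<close> gives \<open>M\<^sup>\<bottom> = {p(T)\<^sup>* \<xi> | p(T) M = 0}\<close>, so \<open>M\<close> is determined by its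
  annihilator. For (2), an invariant subspace that does not contain the cyclic vector consists of
  vectors \<open>p(T) \<xi>\<close> with \<open>p(0) = 0\<close>, and is annihilated by a monomial \<open>T\<^sup>\<alpha> \<noteq> 0\<close> of top degree.\<close>

section \<open>Complex Hilbert spaces\<close>

text \<open>\<open>fun_calc\<close> is a definite description, so an annihilator carries no
  information until existence and uniqueness of the calculus are known for the restriction of T to
  each invariant subspace. Most of the development serves this. Either cyclicity assumption makes
  the whole space finite-dimensional, so an invariant subspace is carried along with a finite
  spanning set. Projections, closedness and the splitting of the defect are then elementary, and a
  dilation space with values in a defect space is replaced by finitely many maps into the
  Drury--Arveson space. Fejer means are used because the Taylor truncations of a multiplier need not
  be uniformly bounded in operator norm. A weak-* limit needs such a bound, since the functionals in
  \<open>predual\<close> are infinite series and the limit has to be taken under the sum.\<close>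

global_interpretation cvs: vector_space "scaleC :: complex \<Rightarrow> 'a \<Rightarrow> 'a::chilbert_space"
  by (rule vector_space_scaleC)

abbreviation clinear :: "('a::chilbert_space \<Rightarrow> 'b::chilbert_space) \<Rightarrow> bool" where
  "clinear \<equiv> module_hom scaleC scaleC"

lemma clinearI:
  assumes "\<And>x y. f (x + y) = f x + f y" "\<And>a x. f (a *\<^sub>C x) = a *\<^sub>C f x"
  shows "clinear f"
  by (intro module_hom.intro module_hom_axioms.intro cvs.module_axioms assms)

lemma clinear_compose: "clinear f \<Longrightarrow> clinear g \<Longrightarrow> clinear (\<lambda>x. f (g x))"
  by (rule clinearI) (simp_all add: module_hom.add module_hom.scale)

lemma clinear_scaleR: "clinear f \<Longrightarrow> f (r *\<^sub>R x) = r *\<^sub>R f x"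
  using module_hom.scale[of scaleC scaleC f "of_real r" x] by (simp add: scaleC_of_real)

lemma cinner_add_right: "cinner x (y + z) = cinner x y + cinner x z"
  by (metis cinner_add_left cinner_commute complex_cnj_add)

lemma cinner_scaleC_right: "cinner x (a *\<^sub>C y) = cnj a * cinner x y"
  by (metis cinner_scaleC_left cinner_commute complex_cnj_mult)

lemma cinner_zero_left [simp]: "cinner 0 y = 0"
  by (metis add_cancel_right_left cinner_add_left add.left_neutral)

lemma cinner_zero_right [simp]: "cinner x 0 = 0"
  by (metis cinner_commute cinner_zero_left complex_cnj_zero)

lemma cinner_minus_left: "cinner (- x) y = - cinner x y"
  by (metis add.right_inverse add_eq_0_iff cinner_add_left cinner_zero_left)

lemma cinner_minus_right: "cinner x (- y) = - cinner x y"
  by (metis add.right_inverse add_eq_0_iff cinner_add_right cinner_zero_right)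

lemma cinner_diff_left: "cinner (x - y) z = cinner x z - cinner y z"
  by (metis cinner_add_left cinner_minus_left diff_conv_add_uminus)

lemma cinner_diff_right: "cinner x (y - z) = cinner x y - cinner x z"
  by (metis cinner_add_right cinner_minus_right diff_conv_add_uminus)

lemma cinner_sum_left: "cinner (\<Sum>i\<in>I. f i) y = (\<Sum>i\<in>I. cinner (f i) y)"
  by (induction I rule: infinite_finite_induct) (simp_all add: cinner_add_left)

lemma cinner_sum_right: "cinner x (\<Sum>i\<in>I. f i) = (\<Sum>i\<in>I. cinner x (f i))"
  by (induction I rule: infinite_finite_induct) (simp_all add: cinner_add_right)

lemma cinner_self: "cinner x x = of_real ((norm x)\<^sup>2)"
proof -
  have "Im (cinner x x) = 0"
    using cinner_commute[of x x] by (metis Im_complex_of_real Reals_cnj_iff complex_is_Real_iff)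
  then show ?thesis
    by (simp add: complex_eq_iff Re_cinner power2_norm_eq_inner)
qed

lemma norm_scaleC: "norm (a *\<^sub>C x) = cmod a * norm x"
proof -
  have "of_real ((norm (a *\<^sub>C x))\<^sup>2) = (a * cnj a) * cinner x x"
    unfolding cinner_self[symmetric] by (simp add: cinner_scaleC_left cinner_scaleC_right)
  also have "\<dots> = of_real ((cmod a * norm x)\<^sup>2)"
    by (simp only: cinner_self complex_norm_square[symmetric] power_mult_distrib of_real_mult)
  finally show ?thesis
    by (simp only: of_real_eq_iff) (simp add: power2_eq_iff_nonneg)
qed

text \<open>Multiplying \<open>x\<close> by a unimodular \<open>a\<close> makes the product real and
  nonnegative; there it equals the real \<open>inner\<close>, and the real inequality
  applies.\<close>

lemma cinner_Cauchy_Schwarz: "cmod (cinner x y) \<le> norm x * norm y"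
proof (cases "cinner x y = 0")
  case False
  define a where "a = cnj (cinner x y) / of_real (cmod (cinner x y))"
  have "a * cinner x y = of_real (cmod (cinner x y))"
    using False unfolding a_def
    by (simp add: field_simps complex_norm_square[symmetric] power2_eq_square[symmetric])
  then have "cmod (cinner x y) = Re (cinner (a *\<^sub>C x) y)"
    by (simp add: cinner_scaleC_left)
  also have "\<dots> \<le> norm (a *\<^sub>C x) * norm y"
    by (simp add: Re_cinner norm_cauchy_schwarz)
  also have "cmod a = 1"
    using False by (simp add: a_def norm_divide)
  then have "norm (a *\<^sub>C x) = norm x" by (simp add: norm_scaleC)
  finally show ?thesis .
qed simp

lemma cinner_eqI: "(\<And>z. cinner x z = cinner y z) \<Longrightarrow> x = y"
proof -
  assume "\<And>z. cinner x z = cinner y z"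
  then have "cinner (x - y) (x - y) = 0" by (simp add: cinner_diff_left)
  then show "x = y" by (simp add: cinner_self)
qed

lemma bounded_linear_cinner_left: "bounded_linear (\<lambda>x. cinner x y)"
proof (rule bounded_linear_intro)
  show "cinner (r *\<^sub>R x) y = r *\<^sub>R cinner x y" for r x
    by (simp add: scaleC_of_real[symmetric] cinner_scaleC_left scaleR_conv_of_real)
  show "norm (cinner x y) \<le> norm x * norm y" for x
    by (rule cinner_Cauchy_Schwarz)
qed (rule cinner_add_left)

section \<open>Bounded operators, the Riesz representation and adjoints\<close>

lemma bounded_ops_UNIV_iff:
  "A \<in> bounded_ops UNIV \<longleftrightarrow> clinear A \<and> (\<exists>K. \<forall>x. norm (A x) \<le> K * norm x)"
  by (auto simp: bounded_ops_def module_hom.add module_hom.scale intro!: clinearI)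

lemma bounded_ops_bounded_linear:
  assumes "A \<in> bounded_ops UNIV" shows "bounded_linear A"
proof -
  have A: "clinear A" and "\<exists>K. \<forall>x. norm (A x) \<le> K * norm x"
    using assms by (auto simp: bounded_ops_UNIV_iff)
  then obtain K where "\<forall>x. norm (A x) \<le> K * norm x" by blast
  then show ?thesis
    by (intro bounded_linear_intro[of _ K]) (auto simp: mult.commute clinear_scaleR A module_hom.add[OF A])
qed

text \<open>A first variation argument: at \<open>t = - a / (b + 1)\<close> the value is
  \<open>- a\<^sup>2 * (b + 2) / (b + 1)\<^sup>2\<close>. The shift by 1 covers
  \<open>b = 0\<close>.\<close>

lemma nonneg_quadratic_linear_coeff_zero:
  fixes a b :: real
  assumes "\<And>t. 0 \<le> 2 * t * a + t\<^sup>2 * b" "0 \<le> b"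
  shows "a = 0"
proof (rule ccontr)
  assume "a \<noteq> 0"
  define c where "c = b + 1"
  have c: "c > 0" "b = c - 1" using assms(2) by (simp_all add: c_def)
  have "0 \<le> 2 * (- a / c) * a + (- a / c)\<^sup>2 * b" by (rule assms)
  also have "\<dots> = - (a\<^sup>2 * (c + 1)) / c\<^sup>2"
    unfolding c(2) using c(1) by (simp add: divide_simps) (simp add: algebra_simps power2_eq_square)
  also have "\<dots> < 0"
    using c(1) \<open>a \<noteq> 0\<close> by (intro divide_neg_pos) auto
  finally show False by simp
qed

text \<open>The representing vector is the minimiser of \<open>x \<mapsto> \<parallel>x\<parallel>\<^sup>2 - 2 f x\<close>; by the
  parallelogram law every minimising sequence is Cauchy.\<close>

lemma Riesz_representation_real:
  fixes f :: "'a::{real_inner, complete_space} \<Rightarrow> real"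
  assumes "bounded_linear f"
  obtains y where "\<And>x. f x = inner y x"
proof -
  interpret f: bounded_linear f by fact
  obtain K where K: "\<And>x. \<bar>f x\<bar> \<le> norm x * K" using f.bounded by auto
  define g where "g x = (norm x)\<^sup>2 - 2 * f x" for x
  have g_ge: "- K\<^sup>2 \<le> g x" for x
  proof -
    have "0 \<le> (norm x - K)\<^sup>2" by simp
    moreover have "f x \<le> norm x * K" using K[of x] by linarith
    ultimately show ?thesis by (simp add: g_def power2_diff)
  qed
  then have bdd: "bdd_below (range g)" by (auto intro!: bdd_belowI)
  define I where "I = Inf (range g)"
  have I_le: "I \<le> g x" for x unfolding I_def by (rule cInf_lower[OF _ bdd]) simp
  have "\<exists>x. g x < I + 1 / Suc n" for n
    using cInf_lessD[of "range g" "I + 1 / Suc n"] unfolding I_def by fastforce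
  then obtain X where X: "\<And>n. g (X n) < I + 1 / Suc n" by metis
  have par: "(norm (x - y))\<^sup>2 = 2 * g x + 2 * g y - 4 * g ((1/2) *\<^sub>R (x + y))" for x y
  proof -
    have "(norm ((1/2) *\<^sub>R (x + y)))\<^sup>2 = (norm (x + y))\<^sup>2 / 4" by (simp add: power_divide)
    moreover have "(norm (x - y))\<^sup>2 + (norm (x + y))\<^sup>2 = 2 * (norm x)\<^sup>2 + 2 * (norm y)\<^sup>2"
      by (simp add: power2_norm_eq_inner inner_simps inner_commute)
    moreover have "f ((1/2) *\<^sub>R (x + y)) = (f x + f y) / 2" by (simp add: f.add f.scaleR)
    ultimately show ?thesis unfolding g_def by argo
  qed
  \<comment> \<open>The constant is 2 + 2: each of the two values exceeds \<open>I\<close> by at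
    most \<open>1 / Suc N\<close>, while the value at the midpoint is at least
    \<open>I\<close>.\<close>
  have close: "(norm (X m - X n))\<^sup>2 \<le> 4 / Suc N" if "m \<ge> N" "n \<ge> N" for m n N
  proof -
    have "1 / Suc m \<le> 1 / Suc N" "1 / Suc n \<le> 1 / Suc N"
      using that by (simp_all add: field_simps)
    then show ?thesis
      using par[of "X m" "X n"] X[of m] X[of n] I_le[of "(1/2) *\<^sub>R (X m + X n)"] by simp
  qed
  have "Cauchy X"
  proof (rule CauchyI)
    fix e :: real assume "0 < e"
    then obtain N where N: "inverse (Suc N) < (e\<^sup>2) / 4" using reals_Archimedean[of "e\<^sup>2 / 4"] by auto
    show "\<exists>M. \<forall>m\<ge>M. \<forall>n\<ge>M. norm (X m - X n) < e"
    proof (intro exI allI impI)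
      fix m n assume "N \<le> m" "N \<le> n"
      then have "(norm (X m - X n))\<^sup>2 < e\<^sup>2" using close[of N m n] N
        by (simp add: inverse_eq_divide)
      then show "norm (X m - X n) < e" using \<open>0 < e\<close> by (simp add: power_less_imp_less_base)
    qed
  qed
  then obtain L where L: "X \<longlonglongrightarrow> L" using Cauchy_convergent convergent_def by blast
  have "(\<lambda>n. g (X n)) \<longlonglongrightarrow> g L"
    unfolding g_def by (intro tendsto_intros L f.tendsto)
  moreover have "(\<lambda>n. I + 1 / Suc n) \<longlonglongrightarrow> I + 0"
    by (intro tendsto_add tendsto_const lim_inverse_n'[THEN LIMSEQ_Suc])
  ultimately have "g L \<le> I + 0"
    by (rule LIMSEQ_le) (use X less_imp_le in blast)
  then have min: "g L \<le> g x" for x using I_le[of x] by simp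
  \<comment> \<open>The first variation of \<open>g\<close> at its minimiser \<open>L\<close> in the
    direction \<open>x\<close>.\<close>
  have "inner L x - f x = 0" for x
  proof (rule nonneg_quadratic_linear_coeff_zero)
    show "0 \<le> 2 * t * (inner L x - f x) + t\<^sup>2 * (norm x)\<^sup>2" for t
      using min[of "L + t *\<^sub>R x"]
      unfolding g_def f.add f.scaleR power2_norm_eq_inner
      by (simp add: inner_simps inner_commute algebra_simps power2_eq_square)
  qed simp
  then show thesis by (intro that[of L]) simp
qed

lemma ex_cadjoint:
  assumes "A \<in> bounded_ops UNIV"
  shows "\<exists>B. \<forall>x y. cinner (A x) y = cinner x (B y)"
proof -
  have A: "clinear A" using assms by (simp add: bounded_ops_UNIV_iff)
  have "\<exists>z. \<forall>x. cinner (A x) y = cinner x z" for y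
  proof -
    have "bounded_linear (\<lambda>x. inner (A x) y)"
      using bounded_linear_compose[OF bounded_linear_inner_left bounded_ops_bounded_linear[OF assms]] .
    then obtain z where z: "\<And>x. inner (A x) y = inner z x"
      using Riesz_representation_real by blast
    have Re: "Re (cinner (A x) y) = Re (cinner x z)" for x
      by (metis Re_cinner z inner_commute)
    \<comment> \<open>Real parts at \<open>x\<close> and at \<open>\<i> *\<^sub>C x\<close>
      determine both components, so the vector representing the real functional serves the complex
      one.\<close>
    have "cinner (A x) y = cinner x z" for x
      using Re[of x] Re[of "\<i> *\<^sub>C x"]
      by (simp add: module_hom.scale[OF A] cinner_scaleC_left complex_eq_iff)
    then show ?thesis by blast
  qed
  then show ?thesis by metis
qed

text \<open>\<open>cadjoint\<close> is a definite description: existence is the Riesz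
  representation, and uniqueness holds because a vector is determined by its inner products.\<close>

lemma cinner_cadjoint:
  assumes "A \<in> bounded_ops UNIV"
  shows "cinner (A x) y = cinner x (cadjoint A y)"
proof -
  have "\<exists>!B. \<forall>x y. cinner (A x) y = cinner x (B y)"
  proof (rule ex_ex1I[OF ex_cadjoint[OF assms]])
    fix B C assume B: "\<forall>x y. cinner (A x) y = cinner x (B y)" and C: "\<forall>x y. cinner (A x) y = cinner x (C y)"
    show "B = C"
    proof (rule ext, rule cinner_eqI)
      fix y z
      have "cinner z (B y) = cinner z (C y)" using B C by metis
      then show "cinner (B y) z = cinner (C y) z" by (metis cinner_commute)
    qed
  qed
  from theI'[OF this] show ?thesis unfolding cadjoint_def by blast
qed

section \<open>Finite-dimensional subspaces: projection and closedness\<close>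

lemma cinner_zero_on_cspan:
  assumes "\<And>b. b \<in> B \<Longrightarrow> cinner u b = 0" "x \<in> cspan B"
  shows "cinner u x = 0"
  using assms(2)
  by (induction rule: cvs.span_induct_alt) (simp_all add: cinner_add_right cinner_scaleC_right assms(1))

text \<open>Gram--Schmidt on the spanning set: \<open>e\<close> is the part of the new vector
  \<open>b\<close> orthogonal to the earlier ones, and \<open>k\<close> is the coefficient of
  \<open>x\<close> along it.\<close>

lemma ex_projection_cspan:
  assumes "finite B"
  shows "\<exists>p\<in>cspan B. \<forall>y\<in>cspan B. cinner (x - p) y = 0"
  using assms
proof (induction B arbitrary: x)
  case empty
  show ?case by simp
next
  case (insert b B)
  obtain q where q: "q \<in> cspan B" "\<And>y. y \<in> cspan B \<Longrightarrow> cinner (b - q) y = 0"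
    using insert.IH[of b] by blast
  obtain p where p: "p \<in> cspan B" "\<And>y. y \<in> cspan B \<Longrightarrow> cinner (x - p) y = 0"
    using insert.IH[of x] by blast
  have mono: "cspan B \<subseteq> cspan (insert b B)" by (rule cvs.span_mono) auto
  have b: "b \<in> cspan (insert b B)" by (simp add: cvs.span_base)
  define e where "e = b - q"
  define k where "k = cinner x e / cinner e e"
  have qe: "cinner q e = 0" "cinner p e = 0"
    using q p by (metis cinner_commute complex_cnj_zero e_def)+
  have eb: "cinner e b = cinner e e"
    using q by (simp add: e_def cinner_diff_right)
  show ?case
  proof (intro bexI[of _ "p + k *\<^sub>C e"] ballI)
    show "p + k *\<^sub>C e \<in> cspan (insert b B)"
      unfolding e_def using mono p(1) q(1) b
      by (intro cvs.span_add cvs.span_scale cvs.span_diff) auto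
    have "cinner (x - (p + k *\<^sub>C e)) c = 0" if "c \<in> insert b B" for c
    proof (cases "c \<in> cspan B")
      case True
      then show ?thesis using p(2) q(2)
        by (simp add: cinner_diff_left cinner_add_left cinner_scaleC_left e_def)
    next
      case False
      then have c: "c = e + q" using that cvs.span_base e_def by force
      \<comment> \<open>If \<open>b\<close> depends on the earlier vectors, then
        \<open>e = 0\<close>, and division by zero gives \<open>k = 0\<close>.\<close>
      have ke: "k * cinner e e = cinner x e" by (cases "e = 0") (simp_all add: k_def cinner_self)
      have "cinner (x - (p + k *\<^sub>C e)) q = 0" using p(2) q
        by (simp add: cinner_diff_left cinner_add_left cinner_scaleC_left e_def)
      then show ?thesis
        unfolding c cinner_add_right using qe ke
        by (simp add: cinner_diff_left cinner_add_left cinner_scaleC_left)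
    qed
    then show "cinner (x - (p + k *\<^sub>C e)) y = 0" if "y \<in> cspan (insert b B)" for y
      using cinner_zero_on_cspan that by blast
  qed
qed

text \<open>The residual \<open>x - p\<close> is orthogonal to the span, so its squared norm is its
  inner product with \<open>x - s\<close> for every \<open>s\<close> in the span. A point at
  distance 0 therefore equals its projection.\<close>

lemma closed_cspan_finite:
  assumes "finite B" shows "closure (cspan B) = cspan B"
proof
  show "closure (cspan B) \<subseteq> cspan B"
  proof
    fix x assume x: "x \<in> closure (cspan B)"
    obtain p where p: "p \<in> cspan B" "\<And>y. y \<in> cspan B \<Longrightarrow> cinner (x - p) y = 0"
      using ex_projection_cspan[OF assms] by blast
    have "norm (x - p) \<le> e" if "0 < e" for e
    proof -
      obtain s where s: "s \<in> cspan B" "dist s x < e"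
        using x \<open>0 < e\<close> by (meson closure_approachable)
      have "of_real ((norm (x - p))\<^sup>2) = cinner (x - p) (x - s)"
        using p(2)[OF p(1)] p(2)[OF s(1)]
        by (simp only: cinner_self[symmetric]) (simp add: cinner_diff_right)
      then have "(norm (x - p))\<^sup>2 = cmod (cinner (x - p) (x - s))"
        by (metis abs_of_nonneg norm_of_real zero_le_power2)
      also have "\<dots> \<le> norm (x - p) * e"
        using s(2) by (intro order_trans[OF cinner_Cauchy_Schwarz] mult_left_mono)
          (auto simp: dist_norm norm_minus_commute)
      finally show ?thesis using \<open>0 < e\<close>
        by (cases "x = p") (simp_all add: power2_eq_square)
    qed
    then have "norm (x - p) \<le> 0" by (meson dense_ge)
    then show "x \<in> cspan B" using p(1) by simp
  qed
qed (rule closure_subset)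

lemma csubspace_finite_basis:
  assumes "csubspace M" "finite B" "M \<subseteq> cspan B"
  obtains C where "finite C" "C \<subseteq> M" "M = cspan C"
proof -
  obtain C where C: "C \<subseteq> M" "cvs.independent C" "M \<subseteq> cspan C"
    using cvs.maximal_independent_subset by blast
  then have "finite C" using cvs.independent_span_bound[OF assms(2)] assms(3) by blast
  moreover have "cspan C \<subseteq> M" using C(1) assms(1) by (rule cvs.span_minimal)
  ultimately show thesis using that C by blast
qed


section \<open>Multi-indices\<close>

definition mdeg :: "('d::finite \<Rightarrow> nat) \<Rightarrow> nat" where
  "mdeg \<alpha> = (\<Sum>i\<in>UNIV. \<alpha> i)"

definition inc :: "'d \<Rightarrow> ('d \<Rightarrow> nat) \<Rightarrow> 'd \<Rightarrow> nat" where
  "inc k \<alpha> = \<alpha>(k := Suc (\<alpha> k))"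

lemma mdeg_zero [simp]: "mdeg (\<lambda>_. 0) = 0"
  by (simp add: mdeg_def)

lemma mdeg_inc [simp]: "mdeg (inc k \<alpha>) = Suc (mdeg \<alpha>)"
proof -
  have "(\<Sum>i\<in>UNIV - {k}. inc k \<alpha> i) = (\<Sum>i\<in>UNIV - {k}. \<alpha> i)"
    by (intro sum.cong) (auto simp: inc_def)
  then show ?thesis
    unfolding mdeg_def by (simp add: sum.remove[of UNIV k] inc_def)
qed

lemma le_mdeg: "\<alpha> i \<le> mdeg \<alpha>"
  unfolding mdeg_def by (rule member_le_sum) auto

lemma inj_inc: "inj (inc k)"
proof (rule injI, rule ext)
  fix \<alpha> \<beta> i assume "inc k \<alpha> = inc k \<beta>"
  then have "inc k \<alpha> i = inc k \<beta> i" by simp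
  then show "\<alpha> i = \<beta> i" by (simp add: inc_def split: if_splits)
qed

lemma range_inc: "range (inc k) = {\<beta>. 0 < \<beta> k}"
proof
  show "{\<beta>. 0 < \<beta> k} \<subseteq> range (inc k)"
  proof
    fix \<beta> :: "'a \<Rightarrow> nat" assume "\<beta> \<in> {\<beta>. 0 < \<beta> k}"
    then have "\<beta> = inc k (\<beta>(k := \<beta> k - 1))" by (auto simp: inc_def fun_eq_iff)
    then show "\<beta> \<in> range (inc k)" by blast
  qed
qed (auto simp: inc_def)

lemma mindex_induct [case_names zero inc]:
  fixes \<alpha> :: "'d::finite \<Rightarrow> nat"
  assumes "P (\<lambda>_. 0)" "\<And>k \<alpha>. P \<alpha> \<Longrightarrow> P (inc k \<alpha>)"
  shows "P \<alpha>"
proof (induction "mdeg \<alpha>" arbitrary: \<alpha>)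
  case 0
  then have "\<alpha> = (\<lambda>_. 0)" by (simp add: mdeg_def fun_eq_iff)
  then show ?case using assms(1) by simp
next
  case (Suc n)
  have "\<exists>k. \<alpha> k \<noteq> 0"
  proof (rule ccontr)
    assume "\<nexists>k. \<alpha> k \<noteq> 0"
    then show False using Suc.hyps(2) by (simp add: mdeg_def)
  qed
  then obtain k where "\<alpha> k \<noteq> 0" by blast
  then have "\<alpha> \<in> range (inc k)" by (simp add: range_inc)
  then obtain \<beta> where \<beta>: "\<alpha> = inc k \<beta>" by blast
  with Suc have "P \<beta>" by simp
  then show ?case using assms(2) \<beta> by simp
qed

lemma finite_mdeg_less: "finite {\<alpha> :: 'd::finite \<Rightarrow> nat. mdeg \<alpha> < n}"
proof (rule finite_subset)
  show "{\<alpha> :: 'd \<Rightarrow> nat. mdeg \<alpha> < n} \<subseteq> PiE UNIV (\<lambda>_. {..n})"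
  proof clarify
    fix \<alpha> :: "'d \<Rightarrow> nat" assume "mdeg \<alpha> < n"
    then have "\<alpha> i \<le> n" for i using le_mdeg[of \<alpha> i] by linarith
    then show "\<alpha> \<in> PiE UNIV (\<lambda>_. {..n})" by auto
  qed
qed (simp add: finite_PiE)

lemma finite_mdeg_eq: "finite {\<alpha> :: 'd::finite \<Rightarrow> nat. mdeg \<alpha> = n}"
  by (rule finite_subset[OF _ finite_mdeg_less[of "Suc n"]]) auto

lemma sum_mdeg_less:
  fixes f :: "('d::finite \<Rightarrow> nat) \<Rightarrow> 'a::comm_monoid_add"
  shows "(\<Sum>\<alpha> | mdeg \<alpha> < n. f \<alpha>) = (\<Sum>m<n. \<Sum>\<alpha> | mdeg \<alpha> = m. f \<alpha>)"
proof (induction n)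
  case (Suc n)
  have "{\<alpha> :: 'd \<Rightarrow> nat. mdeg \<alpha> < Suc n} = {\<alpha>. mdeg \<alpha> < n} \<union> {\<alpha>. mdeg \<alpha> = n}" by auto
  then have "(\<Sum>\<alpha> | mdeg \<alpha> < Suc n. f \<alpha>) = (\<Sum>\<alpha>\<in>{\<alpha>. mdeg \<alpha> < n} \<union> {\<alpha>. mdeg \<alpha> = n}. f \<alpha>)"
    by (simp only:)
  also have "\<dots> = (\<Sum>\<alpha> | mdeg \<alpha> < n. f \<alpha>) + (\<Sum>\<alpha> | mdeg \<alpha> = n. f \<alpha>)"
    by (rule sum.union_disjoint) (auto simp: finite_mdeg_less finite_mdeg_eq)
  finally show ?case by (simp add: Suc.IH)
qed simp

text \<open>The sets of indices of bounded degree are finite and eventually contain every finite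
  set, so an unordered sum may be evaluated by degree.\<close>

lemma has_sum_imp_mdeg_limit:
  fixes f :: "('d::finite \<Rightarrow> nat) \<Rightarrow> 'a::real_normed_vector"
  assumes "(f has_sum s) UNIV"
  shows "(\<lambda>n. \<Sum>\<alpha> | mdeg \<alpha> < n. f \<alpha>) \<longlonglongrightarrow> s"
proof -
  have "filterlim (\<lambda>n. {\<alpha> :: 'd \<Rightarrow> nat. mdeg \<alpha> < n}) (finite_subsets_at_top UNIV) sequentially"
    unfolding filterlim_finite_subsets_at_top
  proof safe
    fix X :: "('d \<Rightarrow> nat) set" assume "finite X"
    show "\<forall>\<^sub>F n in sequentially. finite {\<alpha> :: 'd \<Rightarrow> nat. mdeg \<alpha> < n} \<and>
        X \<subseteq> {\<alpha>. mdeg \<alpha> < n} \<and> {\<alpha> :: 'd \<Rightarrow> nat. mdeg \<alpha> < n} \<subseteq> UNIV"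
      using eventually_gt_at_top[of "Max (mdeg ` X)"]
    proof eventually_elim
      case (elim n)
      have "mdeg \<alpha> < n" if "\<alpha> \<in> X" for \<alpha>
        using Max_ge[OF finite_imageI[OF \<open>finite X\<close>] imageI[OF that], of mdeg] elim by linarith
      then show ?case by (auto simp: finite_mdeg_less)
    qed
  qed
  from filterlim_compose[OF assms[unfolded has_sum_def] this] show ?thesis by simp
qed

lemma da_weight_inc:
  "da_weight (inc k \<alpha>) * (real (mdeg \<alpha>) + 1) = da_weight \<alpha> * (real (\<alpha> k) + 1)"
proof -
  have "(\<Prod>i\<in>UNIV - {k}. fact (inc k \<alpha> i)) = (\<Prod>i\<in>UNIV - {k}. fact (\<alpha> i) :: real)"
    by (intro prod.cong) (auto simp: inc_def)
  then have "(\<Prod>i\<in>UNIV. fact (inc k \<alpha> i)) = (real (\<alpha> k) + 1) * (\<Prod>i\<in>UNIV. fact (\<alpha> i) :: real)"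
    by (simp add: prod.remove[of UNIV k] inc_def algebra_simps)
  moreover have "fact (\<Sum>i\<in>UNIV. inc k \<alpha> i) = (real (mdeg \<alpha>) + 1) * fact (\<Sum>i\<in>UNIV. \<alpha> i)"
    using mdeg_inc[of k \<alpha>] by (simp add: mdeg_def algebra_simps)
  moreover have "x / ((real (mdeg \<alpha>) + 1) * q) * (real (mdeg \<alpha>) + 1) = x / q" for x q :: real
    using of_nat_0_le_iff[of "mdeg \<alpha>", where ?'a = real] by (simp add: add_nonneg_eq_0_iff)
  ultimately show ?thesis
    unfolding da_weight_def by (simp only:) (simp only: times_divide_eq_left times_divide_eq_right mult.commute)
qed

text \<open>The ratio of the two weights is \<open>(\<alpha> k + 1) / (mdeg \<alpha> + 1)\<close>.
  This is why each coordinate shift is a contraction.\<close>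

lemma da_weight_inc_le: "da_weight (inc k \<alpha>) \<le> da_weight \<alpha>"
proof -
  have "da_weight (inc k \<alpha>) * (real (mdeg \<alpha>) + 1) \<le> da_weight \<alpha> * (real (mdeg \<alpha>) + 1)"
    unfolding da_weight_inc using le_mdeg[of \<alpha> k] da_weight_pos[of \<alpha>] by (intro mult_left_mono) auto
  then show ?thesis by (rule mult_right_le_imp_le) simp
qed

lemma da_weight_zero [simp]: "da_weight (\<lambda>_. 0) = 1"
  by (simp add: da_weight_def)

text \<open>Pascal's rule for the multinomial coefficients \<open>|\<alpha>|!/\<alpha>! = 1 / da_weight \<alpha>\<close>, in summed form.\<close>

lemma sum_mdeg_Suc:
  fixes f :: "('d::finite \<Rightarrow> nat) \<Rightarrow> 'a::real_vector"
  shows "(\<Sum>\<beta> | mdeg \<beta> = Suc n. (1 / da_weight \<beta>) *\<^sub>R f \<beta>) =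
    (\<Sum>\<alpha> | mdeg \<alpha> = n. (1 / da_weight \<alpha>) *\<^sub>R (\<Sum>k\<in>UNIV. f (inc k \<alpha>)))"
proof -
  \<comment> \<open>Reindexing along \<open>inc k\<close> reaches only the indices with
    \<open>\<beta> k > 0\<close>; the factor \<open>\<beta> k / Suc n\<close> vanishes at the
    others, so the sum extends to the full degree. These factors add up to 1 over
    \<open>k\<close>.\<close>
  have "(\<Sum>\<alpha> | mdeg \<alpha> = n. (1 / da_weight \<alpha>) *\<^sub>R f (inc k \<alpha>)) =
      (\<Sum>\<beta> | mdeg \<beta> = Suc n. (real (\<beta> k) / Suc n) *\<^sub>R (1 / da_weight \<beta>) *\<^sub>R f \<beta>)" for k
  proof -
    have eq: "inc k ` {\<alpha>. mdeg \<alpha> = n} = {\<beta>. mdeg \<beta> = Suc n \<and> 0 < \<beta> k}"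
    proof -
      have "\<beta> \<in> inc k ` {\<alpha>. mdeg \<alpha> = n}" if "mdeg \<beta> = Suc n" "0 < \<beta> k" for \<beta>
      proof -
        have "\<beta> \<in> range (inc k)" using that by (simp add: range_inc)
        then show ?thesis using that(1) by auto
      qed
      then show ?thesis using range_inc[of k] by auto
    qed
    have "(\<Sum>\<beta> | mdeg \<beta> = Suc n. (real (\<beta> k) / Suc n) *\<^sub>R (1 / da_weight \<beta>) *\<^sub>R f \<beta>) =
        (\<Sum>\<beta>\<in>inc k ` {\<alpha>. mdeg \<alpha> = n}. (real (\<beta> k) / Suc n) *\<^sub>R (1 / da_weight \<beta>) *\<^sub>R f \<beta>)"
      unfolding eq by (rule sum.mono_neutral_right) (auto simp: finite_mdeg_eq)
    also have "\<dots> = (\<Sum>\<alpha> | mdeg \<alpha> = n. (real (inc k \<alpha> k) / Suc n) *\<^sub>R (1 / da_weight (inc k \<alpha>)) *\<^sub>R f (inc k \<alpha>))"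
      by (subst sum.reindex) (auto intro: inj_on_subset[OF inj_inc])
    also have "\<dots> = (\<Sum>\<alpha> | mdeg \<alpha> = n. (1 / da_weight \<alpha>) *\<^sub>R f (inc k \<alpha>))"
    proof (rule sum.cong[OF refl])
      fix \<alpha> assume "\<alpha> \<in> {\<alpha> :: 'd \<Rightarrow> nat. mdeg \<alpha> = n}"
      then have "(real (inc k \<alpha> k) / Suc n) * (1 / da_weight (inc k \<alpha>)) =
          (real (\<alpha> k) + 1) / (da_weight (inc k \<alpha>) * (real (mdeg \<alpha>) + 1))"
        by (simp add: inc_def[of k \<alpha>] algebra_simps)
      also have "\<dots> = (real (\<alpha> k) + 1) / (da_weight \<alpha> * (real (\<alpha> k) + 1))"
        by (simp only: da_weight_inc)
      also have "\<dots> = 1 / da_weight \<alpha>"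
        using of_nat_0_le_iff[of "\<alpha> k", where ?'a = real] by (simp add: add_nonneg_eq_0_iff)
      finally have "(real (inc k \<alpha> k) / Suc n) * (1 / da_weight (inc k \<alpha>)) = 1 / da_weight \<alpha>" .
      then show "(real (inc k \<alpha> k) / Suc n) *\<^sub>R (1 / da_weight (inc k \<alpha>)) *\<^sub>R f (inc k \<alpha>) =
          (1 / da_weight \<alpha>) *\<^sub>R f (inc k \<alpha>)"
        by simp
    qed
    finally show ?thesis by simp
  qed
  then have "(\<Sum>\<alpha> | mdeg \<alpha> = n. (1 / da_weight \<alpha>) *\<^sub>R (\<Sum>k\<in>UNIV. f (inc k \<alpha>))) =
      (\<Sum>k\<in>UNIV. \<Sum>\<beta> | mdeg \<beta> = Suc n. (real (\<beta> k) / Suc n) *\<^sub>R (1 / da_weight \<beta>) *\<^sub>R f \<beta>)"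
    unfolding scaleR_sum_right by (subst sum.swap) simp
  also have "\<dots> = (\<Sum>\<beta> | mdeg \<beta> = Suc n. (\<Sum>k\<in>UNIV. real (\<beta> k) / Suc n) *\<^sub>R (1 / da_weight \<beta>) *\<^sub>R f \<beta>)"
    by (subst sum.swap) (simp only: scaleR_sum_left)
  also have "\<dots> = (\<Sum>\<beta> | mdeg \<beta> = Suc n. (1 / da_weight \<beta>) *\<^sub>R f \<beta>)"
  proof (rule sum.cong[OF refl])
    fix \<beta> :: "'d \<Rightarrow> nat" assume "\<beta> \<in> {\<beta>. mdeg \<beta> = Suc n}"
    then have "real (\<Sum>k\<in>UNIV. \<beta> k) = Suc n" by (simp add: mdeg_def)
    then have "(\<Sum>k\<in>UNIV. real (\<beta> k) / Suc n) = 1"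
      by (simp only: sum_divide_distrib[symmetric] of_nat_sum[symmetric]) simp
    then show "(\<Sum>k\<in>UNIV. real (\<beta> k) / Suc n) *\<^sub>R (1 / da_weight \<beta>) *\<^sub>R f \<beta> = (1 / da_weight \<beta>) *\<^sub>R f \<beta>"
      by simp
  qed
  finally show ?thesis by simp
qed


section \<open>Point evaluations\<close>

definition mon :: "complex ^ 'd \<Rightarrow> ('d::finite \<Rightarrow> nat) \<Rightarrow> complex" where
  "mon z \<alpha> = (\<Prod>i\<in>UNIV. (z $ i) ^ \<alpha> i)"

lemma mon_zero [simp]: "mon z (\<lambda>_. 0) = 1"
  by (simp add: mon_def)

lemma mon_inc: "mon z (inc k \<alpha>) = z $ k * mon z \<alpha>"
proof -
  have "(\<Prod>i\<in>UNIV - {k}. (z $ i) ^ inc k \<alpha> i) = (\<Prod>i\<in>UNIV - {k}. (z $ i) ^ \<alpha> i)"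
    by (intro prod.cong) (auto simp: inc_def)
  then show ?thesis
    unfolding mon_def by (simp add: prod.remove[of UNIV k] inc_def)
qed

lemma mon_scale: "mon (\<chi> i. a * z $ i) \<alpha> = a ^ mdeg \<alpha> * mon z \<alpha>"
  by (simp add: mon_def mdeg_def power_mult_distrib prod.distrib power_sum)

lemma norm_vec_sq: "(norm z)\<^sup>2 = (\<Sum>i\<in>UNIV. (cmod (z $ i))\<^sup>2)" for z :: "complex ^ 'd::finite"
  by (simp add: norm_vec_def L2_set_def sum_nonneg)

text \<open>The multinomial theorem for the squared moduli of the coordinates: the inner sum over
  \<open>k\<close> in \<open>sum_mdeg_Suc\<close> yields one factor \<open>(norm z)\<^sup>2\<close>
  per degree.\<close>

lemma multinomial_norm:
  "(\<Sum>\<alpha> | mdeg \<alpha> = n. (1 / da_weight \<alpha>) * (cmod (mon z \<alpha>))\<^sup>2) = ((norm z)\<^sup>2) ^ n"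
proof (induction n)
  case 0
  have "{\<alpha> :: 'a \<Rightarrow> nat. mdeg \<alpha> = 0} = {\<lambda>_. 0}" by (auto simp: mdeg_def fun_eq_iff)
  then show ?case by simp
next
  case (Suc n)
  have "(\<Sum>k\<in>UNIV. (cmod (mon z (inc k \<alpha>)))\<^sup>2) = (norm z)\<^sup>2 * (cmod (mon z \<alpha>))\<^sup>2" for \<alpha>
    by (simp add: mon_inc norm_mult power_mult_distrib norm_vec_sq sum_distrib_right)
  then show ?case
    using sum_mdeg_Suc[of "\<lambda>\<alpha>. (cmod (mon z \<alpha>))\<^sup>2" n] Suc.IH
    by (simp add: sum_distrib_left[symmetric] mult.left_commute[of _ "(norm z)\<^sup>2"])
      (simp add: sum_distrib_left[symmetric] sum_divide_distrib[symmetric] times_divide_eq_right[symmetric] del: times_divide_eq_right)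
qed

lemma finite_subset_mdeg_less:
  assumes "finite F" obtains n where "F \<subseteq> {\<alpha> :: 'd::finite \<Rightarrow> nat. mdeg \<alpha> < n}"
proof
  show "F \<subseteq> {\<alpha>. mdeg \<alpha> < Suc (Max (mdeg ` F))}"
    using assms by (auto simp: less_Suc_eq_le)
qed

text \<open>\<open>cnj (mon z \<alpha>) / da_weight \<alpha>\<close> are the coefficients of the
  reproducing kernel at \<open>z\<close>, and the terms are those of its squared norm. Grouped by
  degree they form a geometric series.\<close>

lemma summable_mon_sq:
  assumes "z \<in> ball 0 1"
  shows "(\<lambda>\<alpha>. (1 / da_weight \<alpha>) * (cmod (mon z \<alpha>))\<^sup>2) summable_on UNIV"
proof (rule nonneg_bdd_above_summable_on)
  have z: "(norm z)\<^sup>2 < 1" using assms by (simp add: abs_square_less_1)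
  have "(\<Sum>\<alpha>\<in>F. (1 / da_weight \<alpha>) * (cmod (mon z \<alpha>))\<^sup>2) \<le> 1 / (1 - (norm z)\<^sup>2)" if F: "finite F" for F
  proof -
    obtain n where n: "F \<subseteq> {\<alpha>. mdeg \<alpha> < n}" using finite_subset_mdeg_less[OF F] by blast
    have "(\<Sum>\<alpha>\<in>F. (1 / da_weight \<alpha>) * (cmod (mon z \<alpha>))\<^sup>2) \<le>
        (\<Sum>\<alpha> | mdeg \<alpha> < n. (1 / da_weight \<alpha>) * (cmod (mon z \<alpha>))\<^sup>2)"
      using n by (intro sum_mono2 finite_mdeg_less) (auto simp: less_imp_le[OF da_weight_pos])
    also have "\<dots> = (\<Sum>m<n. ((norm z)\<^sup>2) ^ m)"
      by (simp only: sum_mdeg_less multinomial_norm)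
    also have "\<dots> \<le> (\<Sum>m. ((norm z)\<^sup>2) ^ m)"
      using z by (intro sum_le_suminf summable_geometric) auto
    also have "\<dots> = 1 / (1 - (norm z)\<^sup>2)"
      using z by (intro suminf_geometric) auto
    finally show ?thesis .
  qed
  then show "bdd_above (sum (\<lambda>\<alpha>. (1 / da_weight \<alpha>) * (cmod (mon z \<alpha>))\<^sup>2) ` {F. F \<subseteq> UNIV \<and> finite F})"
    by (intro bdd_aboveI[of _ "1 / (1 - (norm z)\<^sup>2)"]) auto
qed (simp add: less_imp_le[OF da_weight_pos])

lemma norm_coeff_mon_le:
  "cmod (da_coeff f \<alpha> * mon z \<alpha>) \<le>
    da_weight \<alpha> * (cmod (da_coeff f \<alpha>))\<^sup>2 + (1 / da_weight \<alpha>) * (cmod (mon z \<alpha>))\<^sup>2"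
proof -
  define s where "s = sqrt (da_weight \<alpha>)"
  have s: "s > 0" "da_weight \<alpha> = s\<^sup>2" using da_weight_pos[of \<alpha>] by (simp_all add: s_def)
  have "2 * (s * cmod (da_coeff f \<alpha>)) * (cmod (mon z \<alpha>) / s) \<le>
      (s * cmod (da_coeff f \<alpha>))\<^sup>2 + (cmod (mon z \<alpha>) / s)\<^sup>2"
    by (rule sum_squares_bound)
  then have "2 * cmod (da_coeff f \<alpha> * mon z \<alpha>) \<le>
      da_weight \<alpha> * (cmod (da_coeff f \<alpha>))\<^sup>2 + (1 / da_weight \<alpha>) * (cmod (mon z \<alpha>))\<^sup>2"
    using s by (simp add: norm_mult power_mult_distrib power_divide mult.assoc)
  then show ?thesis using norm_ge_zero[of "da_coeff f \<alpha> * mon z \<alpha>"] by linarith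
qed

lemma da_eval_abs_summable:
  assumes "z \<in> ball 0 1"
  shows "(\<lambda>\<alpha>. cmod (da_coeff f \<alpha> * mon z \<alpha>)) summable_on UNIV"
  by (rule summable_on_comparison_test[OF summable_on_add[OF da_coeff_summable[of f] summable_mon_sq[OF assms]]])
    (rule norm_coeff_mon_le norm_ge_zero)+

lemma da_eval_has_sum:
  assumes "z \<in> ball 0 1"
  shows "((\<lambda>\<alpha>. da_coeff f \<alpha> * mon z \<alpha>) has_sum da_eval f z) UNIV"
  unfolding da_eval_def mon_def[symmetric]
  by (rule has_sum_infsum, rule abs_summable_summable, rule da_eval_abs_summable[OF assms])

lemma da_eval_add: "z \<in> ball 0 1 \<Longrightarrow> da_eval (f + g) z = da_eval f z + da_eval g z"
  using has_sum_unique[OF da_eval_has_sum[of z "f + g"]]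
    has_sum_add[OF da_eval_has_sum[of z f] da_eval_has_sum[of z g]]
  by (simp add: algebra_simps)

lemma da_eval_scaleC: "z \<in> ball 0 1 \<Longrightarrow> da_eval (a *\<^sub>C f) z = a * da_eval f z"
  using has_sum_unique[OF da_eval_has_sum[of z "a *\<^sub>C f"]] has_sum_cmult_right[OF da_eval_has_sum[of z f], of a]
  by (simp add: mult.assoc)

lemma bounded_linear_da_eval:
  assumes z: "z \<in> ball 0 1"
  shows "bounded_linear (\<lambda>f. da_eval f z)"
proof -
  define K where "K = (\<Sum>\<^sub>\<infinity>\<alpha>. (1 / da_weight \<alpha>) * (cmod (mon z \<alpha>))\<^sup>2)"
  have scale: "da_eval (r *\<^sub>R f) z = r *\<^sub>R da_eval f z" for r and f :: "'a drury_arveson"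
    using da_eval_scaleC[OF z, of "of_real r" f] by (simp add: scaleC_of_real scaleR_conv_of_real)
  have 1: "cmod (da_eval f z) \<le> (norm f)\<^sup>2 + K" for f :: "'a drury_arveson"
  proof -
    have "cmod (da_eval f z) \<le> (\<Sum>\<^sub>\<infinity>\<alpha>. cmod (da_coeff f \<alpha> * mon z \<alpha>))"
      using norm_infsum_bound[OF da_eval_abs_summable[OF z, of f]]
      by (simp add: da_eval_def mon_def)
    also have "\<dots> \<le> (\<Sum>\<^sub>\<infinity>\<alpha>. da_weight \<alpha> * (cmod (da_coeff f \<alpha>))\<^sup>2 + (1 / da_weight \<alpha>) * (cmod (mon z \<alpha>))\<^sup>2)"
      by (intro infsum_mono da_eval_abs_summable z summable_on_add da_coeff_summable summable_mon_sq
          norm_coeff_mon_le)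
    also have "\<dots> = (norm f)\<^sup>2 + K"
      unfolding K_def da_norm_sq by (intro infsum_add da_coeff_summable summable_mon_sq z)
    finally show ?thesis .
  qed
  \<comment> \<open>The bound just obtained is not homogeneous in \<open>f\<close>; at normalised
    \<open>f\<close> it reads \<open>1 + K\<close>, which is the operator bound.\<close>
  have "cmod (da_eval f z) \<le> norm f * (1 + K)" for f :: "'a drury_arveson"
  proof (cases "f = 0")
    case True
    then show ?thesis using scale[of 0 f] by simp
  next
    case False
    then have "cmod (da_eval f z) = norm f * cmod (da_eval (inverse (norm f) *\<^sub>R f) z)"
      by (simp add: scale)
    also have "\<dots> \<le> norm f * (1 + K)"
      using 1[of "inverse (norm f) *\<^sub>R f"] False by (intro mult_left_mono) auto
    finally show ?thesis .
  qed
  then show ?thesis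
    by (intro bounded_linear_intro[of _ "1 + K"]) (simp_all add: scale da_eval_add[OF z])
qed

text \<open>Once the lower coefficients vanish, the series can be divided by \<open>x ^ n\<close>,
  and its limit at 0 is \<open>a n\<close>.\<close>

lemma powser_zero_imp_coeff_zero:
  fixes a :: "nat \<Rightarrow> complex"
  assumes "\<And>x. norm x < 1 \<Longrightarrow> (\<lambda>n. a n * x ^ n) sums 0"
  shows "a n = 0"
proof (induction n rule: less_induct)
  case (less n)
  have "(\<lambda>k. a (k + n) * x ^ k) sums 0" if "x \<noteq> 0" "norm x < 1" for x
  proof -
    have "(\<lambda>k. a (k + n) * x ^ (k + n)) sums (0 - (\<Sum>i<n. a i * x ^ i))"
      by (rule sums_split_initial_segment[OF assms[OF that(2)]])
    then have "(\<lambda>k. x ^ n * (a (k + n) * x ^ k)) sums (x ^ n * 0)"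
      using less by (simp add: power_add mult_ac)
    then show ?thesis using that(1) by (subst (asm) sums_mult_iff) simp_all
  qed
  then have "((\<lambda>_ :: complex. 0) \<longlongrightarrow> a (0 + n)) (at 0)"
    using powser_limit_0_strong[of 1 "\<lambda>k. a (k + n)" "\<lambda>_. 0"] by simp
  then have "0 = a (0 + n)" by (rule LIM_const_eq)
  then show ?case by simp
qed

text \<open>Variables are separated one at a time: with \<open>z i\<close> replaced by
  \<open>t\<close>, the coefficient of \<open>t ^ \<gamma> i\<close> collects the indices with
  \<open>\<alpha> i = \<gamma> i\<close>. Indices may still differ outside \<open>I\<close>, so the
  result is about sums over fibres; for \<open>I = UNIV\<close> a fibre has at most one
  element.\<close>

lemma sum_monomials_zero_imp:
  fixes c :: "('d \<Rightarrow> nat) \<Rightarrow> complex"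
  assumes "finite I" "finite F" "\<And>z. (\<Sum>\<alpha>\<in>F. c \<alpha> * (\<Prod>i\<in>I. z i ^ \<alpha> i)) = 0"
  shows "(\<Sum>\<alpha> | \<alpha> \<in> F \<and> (\<forall>i\<in>I. \<alpha> i = \<gamma> i). c \<alpha>) = 0"
  using assms
proof (induction I arbitrary: F)
  case empty
  then show ?case by simp
next
  case (insert i I)
  define G where "G m = {\<alpha> \<in> F. \<alpha> i = m}" for m
  define N where "N = Max (insert (\<gamma> i) ((\<lambda>\<alpha>. \<alpha> i) ` F))"
  have N: "\<alpha> i \<le> N" if "\<alpha> \<in> F" for \<alpha>
    unfolding N_def using that insert.prems(1) by (intro Max_ge) auto
  have "\<gamma> i \<le> N" unfolding N_def using insert.prems(1) by (intro Max_ge) auto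
  have "(\<Sum>\<alpha>\<in>G (\<gamma> i). c \<alpha> * (\<Prod>j\<in>I. z j ^ \<alpha> j)) = 0" for z
  proof -
    have "(\<Sum>m\<le>N. (\<Sum>\<alpha>\<in>G m. c \<alpha> * (\<Prod>j\<in>I. z j ^ \<alpha> j)) * t ^ m) = 0" for t
    proof -
      have "(\<Sum>m\<le>N. (\<Sum>\<alpha>\<in>G m. c \<alpha> * (\<Prod>j\<in>I. z j ^ \<alpha> j)) * t ^ m) =
          (\<Sum>m\<le>N. \<Sum>\<alpha>\<in>G m. c \<alpha> * (t ^ \<alpha> i * (\<Prod>j\<in>I. z j ^ \<alpha> j)))"
        unfolding sum_distrib_right by (intro sum.cong refl) (auto simp: G_def)
      also have "\<dots> = (\<Sum>\<alpha>\<in>F. c \<alpha> * (t ^ \<alpha> i * (\<Prod>j\<in>I. z j ^ \<alpha> j)))"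
        unfolding G_def by (rule sum.group) (use insert.prems(1) N in auto)
      also have "\<dots> = (\<Sum>\<alpha>\<in>F. c \<alpha> * (\<Prod>j\<in>insert i I. (z(i := t)) j ^ \<alpha> j))"
      proof (intro sum.cong refl, goal_cases)
        case (1 \<alpha>)
        have "(\<Prod>j\<in>I. (z(i := t)) j ^ \<alpha> j) = (\<Prod>j\<in>I. z j ^ \<alpha> j)"
          using insert.hyps by (intro prod.cong) auto
        then show ?case using insert.hyps by simp
      qed
      finally show ?thesis using insert.prems(2) by simp
    qed
    then show ?thesis using \<open>\<gamma> i \<le> N\<close> polyfun_eq_0[where n = N and c = "\<lambda>m. \<Sum>\<alpha>\<in>G m. c \<alpha> * (\<Prod>j\<in>I. z j ^ \<alpha> j)"] by blast
  qed
  then have "(\<Sum>\<alpha> | \<alpha> \<in> G (\<gamma> i) \<and> (\<forall>j\<in>I. \<alpha> j = \<gamma> j). c \<alpha>) = 0"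
    using insert.prems(1) by (intro insert.IH) (auto simp: G_def)
  then show ?case by (simp add: G_def conj_ac)
qed

text \<open>On the complex line through \<open>z\<close> the difference is a power series whose
  coefficients are its homogeneous components \<open>p n z\<close>. Each of them vanishes on the
  ball, by homogeneity everywhere, and so as a polynomial.\<close>

lemma da_eval_inject:
  fixes f g :: "'d::finite drury_arveson"
  assumes "\<And>z. z \<in> ball 0 1 \<Longrightarrow> da_eval f z = da_eval g z"
  shows "f = g"
proof (rule da_eqI)
  fix \<gamma> :: "'d \<Rightarrow> nat"
  define c where "c \<alpha> = da_coeff f \<alpha> - da_coeff g \<alpha>" for \<alpha>
  define p where "p n z = (\<Sum>\<alpha> | mdeg \<alpha> = n. c \<alpha> * mon z \<alpha>)" for n and z :: "complex ^ 'd"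
  have p_scale: "p n (\<chi> i. a * z $ i) = a ^ n * p n z" for n a z
    unfolding p_def sum_distrib_left by (intro sum.cong refl) (simp add: mon_scale)
  have "p n z = 0" if z: "z \<in> ball 0 1" for n z
  proof (rule powser_zero_imp_coeff_zero[of "\<lambda>n. p n z"])
    fix x :: complex assume x: "norm x < 1"
    define w where "w = (\<chi> i. x * z $ i)"
    have "(norm w)\<^sup>2 = (cmod x * norm z)\<^sup>2"
      by (simp add: w_def norm_vec_sq norm_mult power_mult_distrib sum_distrib_left)
    then have "norm w = cmod x * norm z" by (simp add: power2_eq_iff_nonneg)
    then have w: "w \<in> ball 0 1" using x z mult_strict_mono'[of "cmod x" 1 "norm z" 1] by simp
    have "((\<lambda>\<alpha>. c \<alpha> * mon w \<alpha>) has_sum 0) UNIV"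
      using da_eval_has_sum[OF w, of "f - g"] assms[OF w]
        linear_diff[OF bounded_linear.linear[OF bounded_linear_da_eval[OF w]], of f g]
      by (simp add: c_def)
    from has_sum_imp_mdeg_limit[OF this] show "(\<lambda>n. p n z * x ^ n) sums 0"
      unfolding sums_def sum_mdeg_less p_def[symmetric] w_def p_scale by (simp add: mult.commute)
  qed
  then have p0: "p n z = 0" for n z
  proof -
    define r where "r = 1 / (1 + norm z)"
    have "0 < r" "r * norm z < 1"
      unfolding r_def using norm_ge_zero[of z] by (simp_all add: field_simps add_pos_nonneg)
    have "(norm ((\<chi> i. of_real r * z $ i) :: complex ^ 'd))\<^sup>2 = (r * norm z)\<^sup>2"
      by (simp add: norm_vec_sq norm_mult power_mult_distrib sum_distrib_left)
    then have "norm ((\<chi> i. of_real r * z $ i) :: complex ^ 'd) = r * norm z"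
      using \<open>0 < r\<close> by (simp add: power2_eq_iff_nonneg)
    with \<open>r * norm z < 1\<close> have "p n (\<chi> i. of_real r * z $ i) = 0"
      using \<open>\<And>z n. z \<in> ball 0 1 \<Longrightarrow> p n z = 0\<close> by simp
    then show ?thesis using \<open>0 < r\<close> by (simp add: p_scale)
  qed
  have "(\<Sum>\<alpha> | \<alpha> \<in> {\<alpha>. mdeg \<alpha> = mdeg \<gamma>} \<and> (\<forall>i\<in>UNIV. \<alpha> i = \<gamma> i). c \<alpha>) = 0"
  proof (rule sum_monomials_zero_imp)
    show "(\<Sum>\<alpha>\<in>{\<alpha>. mdeg \<alpha> = mdeg \<gamma>}. c \<alpha> * (\<Prod>i\<in>UNIV. z i ^ \<alpha> i)) = 0" for z
      using p0[of "mdeg \<gamma>" "\<chi> i. z i"] by (simp add: p_def mon_def)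
  qed (simp_all add: finite_mdeg_eq)
  moreover have "{\<alpha> \<in> {\<alpha>. mdeg \<alpha> = mdeg \<gamma>}. \<forall>i\<in>UNIV. \<alpha> i = \<gamma> i} = {\<gamma>}" by (auto simp: fun_eq_iff)
  ultimately show "da_coeff f \<gamma> = da_coeff g \<gamma>" by (simp add: c_def)
qed


section \<open>Bounded operators and powers of commuting tuples\<close>

lemma bounded_ops_UNIV_bound:
  assumes "A \<in> bounded_ops UNIV"
  obtains K where "0 \<le> K" "\<And>x. norm (A x) \<le> K * norm x"
proof -
  obtain K where K: "\<And>x. norm (A x) \<le> K * norm x" using assms by (auto simp: bounded_ops_UNIV_iff)
  have "norm (A x) \<le> max K 0 * norm x" for x
    by (rule order_trans[OF K]) (simp add: mult_right_mono)
  then show thesis by (intro that[of "max K 0"]) auto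
qed

lemma bounded_ops_clinear: "A \<in> bounded_ops UNIV \<Longrightarrow> clinear A"
  by (simp add: bounded_ops_UNIV_iff)

lemma bounded_ops_id: "id \<in> bounded_ops UNIV"
  unfolding bounded_ops_UNIV_iff by (auto intro!: clinearI exI[of _ 1])

lemma bounded_ops_zero: "(\<lambda>_. 0) \<in> bounded_ops UNIV"
  unfolding bounded_ops_UNIV_iff by (auto intro!: clinearI exI[of _ 0])

lemma bounded_ops_add:
  assumes "A \<in> bounded_ops UNIV" "B \<in> bounded_ops UNIV"
  shows "(\<lambda>x. A x + B x) \<in> bounded_ops UNIV"
proof -
  obtain K L where "\<And>x. norm (A x) \<le> K * norm x" "\<And>x. norm (B x) \<le> L * norm x"
    using assms by (meson bounded_ops_UNIV_iff)
  then have "norm (A x + B x) \<le> (K + L) * norm x" for x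
    using norm_triangle_mono by (fastforce simp: distrib_right)
  then show ?thesis
    using assms[THEN bounded_ops_clinear] unfolding bounded_ops_UNIV_iff
    by (auto intro!: clinearI simp: module_hom.add module_hom.scale scaleC_add_right)
qed

lemma bounded_ops_scaleC:
  assumes "A \<in> bounded_ops UNIV"
  shows "(\<lambda>x. a *\<^sub>C A x) \<in> bounded_ops UNIV"
proof -
  obtain K where "0 \<le> K" "\<And>x. norm (A x) \<le> K * norm x"
    using bounded_ops_UNIV_bound[OF assms] by blast
  then have "norm (a *\<^sub>C A x) \<le> (cmod a * K) * norm x" for x
    by (simp add: norm_scaleC mult.assoc mult_left_mono)
  then show ?thesis
    using assms[THEN bounded_ops_clinear] unfolding bounded_ops_UNIV_iff
    by (intro conjI clinearI exI[of _ "cmod a * K"])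
      (simp_all add: module_hom.add module_hom.scale scaleC_add_right scaleC_scaleC mult.commute)
qed

lemma bounded_ops_sum:
  assumes "\<And>i. i \<in> I \<Longrightarrow> A i \<in> bounded_ops UNIV"
  shows "(\<lambda>x. \<Sum>i\<in>I. A i x) \<in> bounded_ops UNIV"
  using assms
  by (induction I rule: infinite_finite_induct) (simp_all add: bounded_ops_zero bounded_ops_add)

lemma bounded_ops_compose:
  assumes "A \<in> bounded_ops UNIV" "B \<in> bounded_ops UNIV"
  shows "A \<circ> B \<in> bounded_ops UNIV"
proof -
  obtain K where K: "0 \<le> K" "\<And>x. norm (A x) \<le> K * norm x"
    using bounded_ops_UNIV_bound[OF assms(1)] by blast
  obtain L where L: "\<And>x. norm (B x) \<le> L * norm x"
    using assms(2) by (auto simp: bounded_ops_UNIV_iff)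
  have "norm (A (B x)) \<le> (K * L) * norm x" for x
    using order_trans[OF K(2)[of "B x"] mult_left_mono[OF L K(1)]] by (simp add: mult.assoc)
  then show ?thesis
    using assms[THEN bounded_ops_clinear] unfolding bounded_ops_UNIV_iff
    by (auto intro!: clinearI simp: module_hom.add module_hom.scale)
qed

text \<open>The product over the index type is a fold along an arbitrary enumeration of it. For a
  commuting tuple the choice does not matter, and \<open>mpow_zero\<close> and
  \<open>mpow_inc\<close> stand in for the body from then on.\<close>

definition mpow :: "('d::finite \<Rightarrow> 'a \<Rightarrow> 'a) \<Rightarrow> ('d \<Rightarrow> nat) \<Rightarrow> 'a \<Rightarrow> 'a" where
  "mpow T \<alpha> = foldr (\<lambda>i. T i ^^ \<alpha> i) (SOME xs. set xs = UNIV \<and> distinct xs)"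

lemma mpow_zero [simp]: "mpow T (\<lambda>_. 0) x = x"
proof -
  have "foldr (\<lambda>i. T i ^^ 0) xs x = x" for xs by (induction xs) auto
  then show ?thesis by (simp add: mpow_def)
qed

lemma commutingD: "commuting T \<Longrightarrow> T j (T k x) = T k (T j x)"
  unfolding commuting_def by (metis comp_apply)

lemma commuting_funpow: "commuting T \<Longrightarrow> T k ((T i ^^ n) x) = (T i ^^ n) (T k x)"
  by (induction n) (simp_all add: commutingD[of T k i])

text \<open>\<open>k\<close> occurs exactly once in the enumeration, and the additional factor
  \<open>T k\<close> is commuted past the powers in front of it.\<close>

lemma mpow_inc [simp]:
  assumes T: "commuting T"
  shows "mpow T (inc k \<alpha>) x = T k (mpow T \<alpha> x)"
proof -
  have 1: "foldr (\<lambda>i. T i ^^ inc k \<alpha> i) xs x = foldr (\<lambda>i. T i ^^ \<alpha> i) xs x"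
    if "k \<notin> set xs" for xs
    using that by (induction xs) (auto simp: inc_def)
  have 2: "foldr (\<lambda>i. T i ^^ inc k \<alpha> i) xs x = T k (foldr (\<lambda>i. T i ^^ \<alpha> i) xs x)"
    if "k \<in> set xs" "distinct xs" for xs
    using that
  proof (induction xs)
    case (Cons i xs)
    show ?case
    proof (cases "i = k")
      case True
      then have "inc k \<alpha> i = Suc (\<alpha> i)" by (simp add: inc_def)
      with True show ?thesis using 1[of xs] Cons.prems by simp
    next
      case False
      then have "inc k \<alpha> i = \<alpha> i" by (simp add: inc_def)
      with False show ?thesis using Cons by (simp add: commuting_funpow[OF T])
    qed
  qed simp
  have "\<exists>xs :: 'a list. set xs = UNIV \<and> distinct xs" using finite_distinct_list[OF finite] by blast
  from someI_ex[OF this] show ?thesis unfolding mpow_def by (intro 2) auto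
qed

lemma mpow_commute:
  assumes "commuting T" shows "T k (mpow T \<alpha> x) = mpow T \<alpha> (T k x)"
  by (induction \<alpha> rule: mindex_induct) (simp_all add: assms commutingD[of T k])

lemma mpow_add:
  assumes "commuting T" shows "mpow T (\<lambda>i. \<alpha> i + \<beta> i) x = mpow T \<alpha> (mpow T \<beta> x)"
proof (induction \<alpha> rule: mindex_induct)
  case (inc k \<alpha>)
  have "(\<lambda>i. inc k \<alpha> i + \<beta> i) = inc k (\<lambda>i. \<alpha> i + \<beta> i)" by (auto simp: inc_def)
  then show ?case using inc assms by simp
qed simp

lemma clinear_mpow:
  assumes "commuting T" "\<And>k. clinear (T k)" shows "clinear (mpow T \<alpha>)"
proof (induction \<alpha> rule: mindex_induct)
  case zero
  show ?case by (rule clinearI) simp_all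
next
  case (inc k \<alpha>)
  have "mpow T (inc k \<alpha>) = (\<lambda>x. T k (mpow T \<alpha> x))" by (rule ext) (simp add: assms)
  then show ?case using clinear_compose[OF assms(2) inc] by simp
qed

lemma bounded_ops_mpow:
  assumes "commuting T" "\<And>k. T k \<in> bounded_ops UNIV" shows "mpow T \<alpha> \<in> bounded_ops UNIV"
proof (induction \<alpha> rule: mindex_induct)
  case zero
  have "mpow T (\<lambda>_. 0) = id" by (rule ext) simp
  then show ?case by (simp only: bounded_ops_id)
next
  case (inc k \<alpha>)
  have "mpow T (inc k \<alpha>) = T k \<circ> mpow T \<alpha>" by (rule ext) (simp add: assms)
  then show ?case using bounded_ops_compose[OF assms(2) inc] by (simp only:)
qed

lemma mpow_mem:
  assumes "commuting T" "\<And>k x. x \<in> M \<Longrightarrow> T k x \<in> M" "x \<in> M" shows "mpow T \<alpha> x \<in> M"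
  by (induction \<alpha> rule: mindex_induct) (simp_all add: assms)


section \<open>Shifts and monomials\<close>

lemma da_norm_le:
  fixes f :: "'a::finite drury_arveson"
  assumes "\<And>F. finite F \<Longrightarrow> (\<Sum>\<alpha>\<in>F. da_weight \<alpha> * (cmod (da_coeff f \<alpha>))\<^sup>2) \<le> c\<^sup>2" "0 \<le> c"
  shows "norm f \<le> c"
proof -
  have "(norm f)\<^sup>2 \<le> c\<^sup>2"
    unfolding da_norm_sq by (rule infsum_le_finite_sums[OF da_coeff_summable]) (use assms in auto)
  then show ?thesis using assms(2) by (rule power2_le_imp_le)
qed

text \<open>Multiplication by a coordinate, written on Taylor coefficients, where norms and
  commutation can be read off; \<open>mult_op_coord\<close> identifies it with the
  multiplier.\<close>

definition shift :: "'d \<Rightarrow> 'd::finite drury_arveson \<Rightarrow> 'd drury_arveson" where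
  "shift k f = Abs_drury_arveson (\<lambda>\<alpha>. if \<alpha> k = 0 then 0 else da_coeff f (\<alpha>(k := \<alpha> k - 1)))"

lemma shift_summable:
  fixes f :: "'d::finite drury_arveson"
  shows "(\<lambda>\<alpha>. da_weight \<alpha> * (cmod (if \<alpha> k = 0 then 0 else da_coeff f (\<alpha>(k := \<alpha> k - 1))))\<^sup>2) summable_on UNIV"
    (is "?g summable_on UNIV")
proof -
  have "(\<lambda>\<alpha>. da_weight (inc k \<alpha>) * (cmod (da_coeff f \<alpha>))\<^sup>2) summable_on UNIV"
    by (rule summable_on_comparison_test[OF da_coeff_summable[of f]])
      (simp_all add: mult_right_mono da_weight_inc_le less_imp_le[OF da_weight_pos])
  also have "(\<lambda>\<alpha>. da_weight (inc k \<alpha>) * (cmod (da_coeff f \<alpha>))\<^sup>2) = ?g \<circ> inc k"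
    by (rule ext) (simp add: inc_def)
  finally have "?g summable_on range (inc k)"
    by (subst summable_on_reindex[OF inj_inc])
  then show ?thesis
    by (rule summable_on_cong_neutral[THEN iffD1, rotated -1]) (auto simp: range_inc)
qed

lemma da_coeff_shift:
  "da_coeff (shift k f) \<alpha> = (if \<alpha> k = 0 then 0 else da_coeff f (\<alpha>(k := \<alpha> k - 1)))"
  unfolding shift_def by (simp add: da_coeff_Abs[OF shift_summable])

lemma da_coeff_shift_inc [simp]: "da_coeff (shift k f) (inc k \<alpha>) = da_coeff f \<alpha>"
  by (simp add: da_coeff_shift inc_def)

lemma norm_shift_le: "norm (shift k f) \<le> norm f"
proof (rule da_norm_le)
  fix F :: "('a \<Rightarrow> nat) set" assume F: "finite F"
  define G where "G = inc k -` F"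
  have G: "finite G" unfolding G_def by (rule finite_vimageI[OF F inj_inc])
  have "(\<Sum>\<alpha>\<in>F. da_weight \<alpha> * (cmod (da_coeff (shift k f) \<alpha>))\<^sup>2) =
      (\<Sum>\<alpha>\<in>inc k ` G. da_weight \<alpha> * (cmod (da_coeff (shift k f) \<alpha>))\<^sup>2)"
    using F by (intro sum.mono_neutral_right) (auto simp: G_def da_coeff_shift image_vimage_eq range_inc)
  also have "\<dots> = (\<Sum>\<alpha>\<in>G. da_weight (inc k \<alpha>) * (cmod (da_coeff f \<alpha>))\<^sup>2)"
    by (subst sum.reindex) (auto intro: inj_on_subset[OF inj_inc])
  also have "\<dots> \<le> (\<Sum>\<alpha>\<in>G. da_weight \<alpha> * (cmod (da_coeff f \<alpha>))\<^sup>2)"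
    by (intro sum_mono mult_right_mono da_weight_inc_le) simp
  also have "\<dots> \<le> (norm f)\<^sup>2" by (rule da_finite_sum_le[OF G])
  finally show "(\<Sum>\<alpha>\<in>F. da_weight \<alpha> * (cmod (da_coeff (shift k f) \<alpha>))\<^sup>2) \<le> (norm f)\<^sup>2" .
qed simp

lemma shift_bounded_ops: "shift k \<in> bounded_ops UNIV"
  unfolding bounded_ops_UNIV_iff
proof
  show "clinear (shift k)" by (rule clinearI; rule da_eqI; simp add: da_coeff_shift)
  show "\<exists>K. \<forall>f. norm (shift k f) \<le> K * norm f" using norm_shift_le by (intro exI[of _ 1]) auto
qed

lemma commuting_shift: "commuting shift"
  unfolding commuting_def
  by (intro allI ext, rule da_eqI) (auto simp: da_coeff_shift fun_upd_twist)

lemma da_eval_shift: "da_eval (shift k f) z = z $ k * da_eval f z"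
proof -
  have "da_eval (shift k f) z = (\<Sum>\<^sub>\<infinity>\<alpha>\<in>range (inc k). da_coeff (shift k f) \<alpha> * mon z \<alpha>)"
    unfolding da_eval_def mon_def[symmetric]
    by (rule infsum_cong_neutral) (auto simp: range_inc da_coeff_shift)
  also have "\<dots> = (\<Sum>\<^sub>\<infinity>\<alpha>. z $ k * (da_coeff f \<alpha> * mon z \<alpha>))"
    by (subst infsum_reindex[OF inj_inc]) (simp add: o_def mon_inc mult_ac)
  also have "\<dots> = z $ k * da_eval f z"
    unfolding da_eval_def mon_def[symmetric] by (rule infsum_cmult_right')
  finally show ?thesis .
qed

section \<open>Monomials, truncation and density of the polynomials\<close>

definition da_mon :: "('d::finite \<Rightarrow> nat) \<Rightarrow> 'd drury_arveson" where
  "da_mon \<alpha> = Abs_drury_arveson (\<lambda>\<beta>. if \<beta> = \<alpha> then 1 else 0)"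

abbreviation da_one :: "'d::finite drury_arveson" where
  "da_one \<equiv> da_mon (\<lambda>_. 0)"

lemma da_coeff_mon: "da_coeff (da_mon \<alpha>) \<beta> = (if \<beta> = \<alpha> then 1 else 0)"
proof -
  have "(\<lambda>\<beta>. da_weight \<beta> * (cmod (if \<beta> = \<alpha> then 1 else 0))\<^sup>2) summable_on UNIV"
    by (rule finite_nonzero_values_imp_summable_on, rule finite_subset[of _ "{\<alpha>}"]) auto
  then show ?thesis unfolding da_mon_def by (subst da_coeff_Abs) auto
qed

lemma da_coeff_sum [simp]: "da_coeff (\<Sum>i\<in>I. f i) \<alpha> = (\<Sum>i\<in>I. da_coeff (f i) \<alpha>)"
  by (induction I rule: infinite_finite_induct) simp_all

lemma shift_da_mon: "shift k (da_mon \<alpha>) = da_mon (inc k \<alpha>)"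
  by (rule da_eqI) (auto simp: da_coeff_shift da_coeff_mon inc_def fun_eq_iff)

lemma mpow_shift_one: "mpow shift \<alpha> da_one = da_mon \<alpha>"
  by (induction \<alpha> rule: mindex_induct) (simp_all add: commuting_shift shift_da_mon)

lemma cinner_da_mon: "cinner f (da_mon \<alpha>) = of_real (da_weight \<alpha>) * da_coeff f \<alpha>"
proof -
  have "cinner f (da_mon \<alpha>) = (\<Sum>\<^sub>\<infinity>\<beta>\<in>{\<alpha>}. of_real (da_weight \<beta>) * (da_coeff f \<beta> * cnj (da_coeff (da_mon \<alpha>) \<beta>)))"
    unfolding cinner_drury_arveson_def by (rule infsum_cong_neutral) (auto simp: da_coeff_mon)
  then show ?thesis by (simp add: da_coeff_mon)
qed

lemma da_eval_mon: "da_eval (da_mon \<alpha>) z = mon z \<alpha>"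
proof -
  have "da_eval (da_mon \<alpha>) z = (\<Sum>\<^sub>\<infinity>\<beta>\<in>{\<alpha>}. da_coeff (da_mon \<alpha>) \<beta> * mon z \<beta>)"
    unfolding da_eval_def mon_def[symmetric] by (rule infsum_cong_neutral) (auto simp: da_coeff_mon)
  then show ?thesis by (simp add: da_coeff_mon)
qed

text \<open>Since monomials are orthogonal, this is the orthogonal projection onto the polynomials
  of degree below \<open>n\<close>.\<close>

definition trunc :: "nat \<Rightarrow> 'd::finite drury_arveson \<Rightarrow> 'd drury_arveson" where
  "trunc n f = (\<Sum>\<alpha> | mdeg \<alpha> < n. da_coeff f \<alpha> *\<^sub>C da_mon \<alpha>)"

lemma da_coeff_trunc: "da_coeff (trunc n f) \<alpha> = (if mdeg \<alpha> < n then da_coeff f \<alpha> else 0)"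
  by (simp add: trunc_def da_coeff_mon finite_mdeg_less if_distrib cong: if_cong)

lemma norm_trunc_sq: "(norm (trunc n f))\<^sup>2 = (\<Sum>\<alpha> | mdeg \<alpha> < n. da_weight \<alpha> * (cmod (da_coeff f \<alpha>))\<^sup>2)"
proof -
  have "(norm (trunc n f))\<^sup>2 = (\<Sum>\<^sub>\<infinity>\<alpha>\<in>{\<alpha>. mdeg \<alpha> < n}. da_weight \<alpha> * (cmod (da_coeff (trunc n f) \<alpha>))\<^sup>2)"
    unfolding da_norm_sq by (rule infsum_cong_neutral) (auto simp: da_coeff_trunc)
  then show ?thesis by (simp add: finite_mdeg_less da_coeff_trunc)
qed

text \<open>By Pythagoras the squared distance to \<open>f\<close> is the tail of the series for the
  squared norm.\<close>

lemma trunc_tendsto: "(\<lambda>n. trunc n f) \<longlonglongrightarrow> f"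
proof -
  have s: "(\<lambda>n. (norm (trunc n f))\<^sup>2) \<longlonglongrightarrow> (norm f)\<^sup>2"
    unfolding norm_trunc_sq
    by (rule has_sum_imp_mdeg_limit) (simp add: da_norm_sq has_sum_infsum da_coeff_summable)
  have "(norm (f - trunc n f))\<^sup>2 + (norm (trunc n f))\<^sup>2 = (norm f)\<^sup>2" for n
    unfolding da_norm_sq
    by (subst infsum_add[symmetric, OF da_coeff_summable da_coeff_summable], rule infsum_cong)
      (simp add: da_coeff_trunc)
  then have "(norm (f - trunc n f))\<^sup>2 = (norm f)\<^sup>2 - (norm (trunc n f))\<^sup>2" for n
    by (simp add: algebra_simps)
  then have "(\<lambda>n. (norm (f - trunc n f))\<^sup>2) \<longlonglongrightarrow> 0"
    using tendsto_diff[OF tendsto_const[of "(norm f)\<^sup>2"] s] by simp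
  from tendsto_real_sqrt[OF this] have "(\<lambda>n. norm (trunc n f - f)) \<longlonglongrightarrow> 0"
    by (simp add: norm_minus_commute)
  then show ?thesis by (simp add: LIM_zero_iff tendsto_norm_zero_iff)
qed

lemma norm_trunc_le: "norm (trunc n f) \<le> norm f"
proof -
  have "(norm (trunc n f))\<^sup>2 \<le> (norm f)\<^sup>2"
    unfolding norm_trunc_sq by (rule da_finite_sum_le[OF finite_mdeg_less])
  then show ?thesis by (rule power2_le_imp_le) simp
qed

text \<open>Polynomials are dense. \<open>bounded_linear\<close> expresses real linearity only, so
  complex multiples of the monomials appear in the hypothesis.\<close>

lemma eq_of_eq_on_da_mon:
  fixes A B :: "'d::finite drury_arveson \<Rightarrow> 'a::real_normed_vector"
  assumes "bounded_linear A" "bounded_linear B"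
    and "\<And>a \<alpha>. A (a *\<^sub>C da_mon \<alpha>) = B (a *\<^sub>C da_mon \<alpha>)"
  shows "A f = B f"
proof -
  have "A (trunc n f) = B (trunc n f)" for n
    unfolding trunc_def linear_sum[OF bounded_linear.linear[OF assms(1)]]
      linear_sum[OF bounded_linear.linear[OF assms(2)]] assms(3) ..
  then show ?thesis
    using LIMSEQ_unique[OF bounded_linear.tendsto[OF assms(1) trunc_tendsto[of f]]]
      bounded_linear.tendsto[OF assms(2) trunc_tendsto[of f]] by simp
qed


section \<open>The multiplier algebra as the commutant of the shifts\<close>

definition shift_commutant :: "('d::finite drury_arveson \<Rightarrow> 'd drury_arveson) set" where
  "shift_commutant = {A \<in> bounded_ops UNIV. \<forall>k f. A (shift k f) = shift k (A f)}"

lemma shift_commutant_mpow: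
  assumes "A \<in> shift_commutant" shows "A (mpow shift \<alpha> f) = mpow shift \<alpha> (A f)"
  using assms by (induction \<alpha> rule: mindex_induct) (auto simp: commuting_shift shift_commutant_def)

lemma shift_commutant_mon:
  assumes "A \<in> shift_commutant" shows "A (da_mon \<alpha>) = mpow shift \<alpha> (A da_one)"
  using shift_commutant_mpow[OF assms, of \<alpha> da_one] by (simp add: mpow_shift_one)

lemma mult_op_eqI:
  assumes "\<And>z. z \<in> ball 0 1 \<Longrightarrow> da_eval g z = \<phi> z * da_eval f z"
  shows "mult_op \<phi> f = g"
  unfolding mult_op_def
proof (rule the_equality)
  show "\<forall>z\<in>ball 0 1. da_eval g z = \<phi> z * da_eval f z" using assms by blast
  fix g' assume "\<forall>z\<in>ball 0 1. da_eval g' z = \<phi> z * da_eval f z"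
  then show "g' = g" using assms by (intro da_eval_inject) simp
qed

lemma da_eval_mult_op:
  assumes "\<phi> \<in> multipliers" "z \<in> ball 0 1"
  shows "da_eval (mult_op \<phi> f) z = \<phi> z * da_eval f z"
proof -
  obtain g where "\<And>z. z \<in> ball 0 1 \<Longrightarrow> da_eval g z = \<phi> z * da_eval f z"
    using assms(1) unfolding multipliers_def by blast
  with mult_op_eqI[of g \<phi> f] assms(2) show ?thesis by simp
qed

lemma da_eval_mpow_shift: "da_eval (mpow shift \<alpha> f) z = mon z \<alpha> * da_eval f z"
  by (induction \<alpha> rule: mindex_induct) (simp_all add: commuting_shift da_eval_shift mon_inc)

text \<open>For the second inclusion: on monomials, \<open>A\<close> is multiplication by the
  function \<open>A da_one\<close>, and continuity of \<open>A\<close> and of point evaluations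
  carries this to all \<open>f\<close>. In the form of a commutant, closure under sums, scalars and
  composition is immediate.\<close>

lemma mult_algebra_eq: "mult_algebra = (shift_commutant :: ('d::finite drury_arveson \<Rightarrow> _) set)"
proof
  show "mult_algebra \<subseteq> (shift_commutant :: ('d drury_arveson \<Rightarrow> _) set)"
  proof
    fix A :: "'d drury_arveson \<Rightarrow> 'd drury_arveson" assume "A \<in> mult_algebra"
    then obtain \<phi> where \<phi>: "\<phi> \<in> multipliers" "A = mult_op \<phi>" by blast
    have "A (shift k f) = shift k (A f)" for k f
      unfolding \<phi>(2) by (rule mult_op_eqI) (simp add: da_eval_shift da_eval_mult_op[OF \<phi>(1)])
    then show "A \<in> shift_commutant"
      using \<phi> by (auto simp: shift_commutant_def multipliers_def)
  qed
  show "(shift_commutant :: ('d drury_arveson \<Rightarrow> _) set) \<subseteq> mult_algebra"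
  proof
    fix A :: "'d drury_arveson \<Rightarrow> 'd drury_arveson" assume A: "A \<in> shift_commutant"
    then have Ab: "A \<in> bounded_ops UNIV" by (simp add: shift_commutant_def)
    \<comment> \<open>Off the ball \<open>multipliers\<close> prescribes the value 0.\<close>
    define \<phi> where "\<phi> z = (if z \<in> ball 0 1 then da_eval (A da_one) z else 0)" for z
    have eval: "da_eval (A f) z = \<phi> z * da_eval f z" if z: "z \<in> ball 0 1" for f z
    proof (rule eq_of_eq_on_da_mon[where f = f])
      show "bounded_linear (\<lambda>f. da_eval (A f) z)"
        by (rule bounded_linear_compose[OF bounded_linear_da_eval[OF z] bounded_ops_bounded_linear[OF Ab]])
      show "bounded_linear (\<lambda>f. \<phi> z * da_eval f z)"
        by (rule bounded_linear_compose[OF bounded_linear_mult_right bounded_linear_da_eval[OF z]])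
      show "da_eval (A (a *\<^sub>C da_mon \<alpha>)) z = \<phi> z * da_eval (a *\<^sub>C da_mon \<alpha>) z" for a \<alpha>
        unfolding module_hom.scale[OF bounded_ops_clinear[OF Ab]] da_eval_scaleC[OF z]
        by (subst shift_commutant_mon[OF A]) (use z in \<open>simp add: da_eval_mpow_shift da_eval_mon \<phi>_def\<close>)
    qed
    then have "mult_op \<phi> = A" by (intro ext mult_op_eqI) simp
    moreover have "\<phi> \<in> multipliers"
      unfolding multipliers_def mem_Collect_eq \<open>mult_op \<phi> = A\<close>
    proof (intro conjI allI impI Ab)
      show "\<exists>g. \<forall>z\<in>ball 0 1. da_eval g z = \<phi> z * da_eval f z" for f using eval by blast
    qed (simp add: \<phi>_def)
    ultimately show "A \<in> mult_algebra" by blast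
  qed
qed

lemma mult_op_coord: "mult_op (coord k) = shift k"
  by (intro ext mult_op_eqI) (simp add: coord_def da_eval_shift)

lemma shift_commutant_bounded_ops: "A \<in> shift_commutant \<Longrightarrow> A \<in> bounded_ops UNIV"
  by (simp add: shift_commutant_def)

lemma shift_in_commutant: "shift k \<in> shift_commutant"
  unfolding shift_commutant_def using commutingD[OF commuting_shift] shift_bounded_ops by blast

lemma shift_commutant_id: "id \<in> shift_commutant"
  by (simp add: shift_commutant_def bounded_ops_id)

lemma shift_commutant_add:
  "A \<in> shift_commutant \<Longrightarrow> B \<in> shift_commutant \<Longrightarrow> (\<lambda>f. A f + B f) \<in> shift_commutant"
  by (simp add: shift_commutant_def bounded_ops_add module_hom.add[OF bounded_ops_clinear[OF shift_bounded_ops]])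

lemma shift_commutant_scaleC: "A \<in> shift_commutant \<Longrightarrow> (\<lambda>f. a *\<^sub>C A f) \<in> shift_commutant"
  by (simp add: shift_commutant_def bounded_ops_scaleC module_hom.scale[OF bounded_ops_clinear[OF shift_bounded_ops]])

lemma shift_commutant_compose:
  "A \<in> shift_commutant \<Longrightarrow> B \<in> shift_commutant \<Longrightarrow> A \<circ> B \<in> shift_commutant"
  by (simp add: shift_commutant_def bounded_ops_compose)

lemma shift_commutant_zero: "(\<lambda>_. 0) \<in> shift_commutant"
  by (simp add: shift_commutant_def bounded_ops_zero module_hom.zero[OF bounded_ops_clinear[OF shift_bounded_ops]])

lemma shift_commutant_sum:
  "(\<And>i. i \<in> I \<Longrightarrow> A i \<in> shift_commutant) \<Longrightarrow> (\<lambda>f. \<Sum>i\<in>I. A i f) \<in> shift_commutant"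
  by (induction I rule: infinite_finite_induct) (simp_all add: shift_commutant_zero shift_commutant_add)

lemma mpow_shift_in_commutant: "mpow shift \<alpha> \<in> shift_commutant"
  unfolding shift_commutant_def
  by (simp add: bounded_ops_mpow commuting_shift shift_bounded_ops mpow_commute)


section \<open>Fejer means\<close>

lemma bounded_bilinear_cinner: "bounded_bilinear (cinner :: 'a::chilbert_space \<Rightarrow> 'a \<Rightarrow> complex)"
proof
  fix r :: real and x y :: 'a
  show "cinner (r *\<^sub>R x) y = r *\<^sub>R cinner x y"
    by (simp add: scaleC_of_real[symmetric] cinner_scaleC_left scaleR_conv_of_real)
  show "cinner x (r *\<^sub>R y) = r *\<^sub>R cinner x y"
    by (simp add: scaleC_of_real[symmetric] cinner_scaleC_right scaleR_conv_of_real)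
  show "\<exists>K. \<forall>x y :: 'a. norm (cinner x y) \<le> norm x * norm y * K"
    using cinner_Cauchy_Schwarz by (intro exI[of _ 1]) auto
qed (rule cinner_add_left cinner_add_right)+

lemma da_coeff_mpow_shift:
  "da_coeff (mpow shift \<alpha> f) \<gamma> =
    (if \<forall>i. \<alpha> i \<le> \<gamma> i then da_coeff f (\<lambda>i. \<gamma> i - \<alpha> i) else 0)"
proof (induction \<alpha> arbitrary: \<gamma> rule: mindex_induct)
  case zero
  then show ?case by simp
next
  case (inc k \<alpha>)
  show ?case
  proof (cases "\<gamma> \<in> range (inc k)")
    case True
    then obtain \<delta> where \<delta>: "\<gamma> = inc k \<delta>" by blast
    have "(\<forall>i. inc k \<alpha> i \<le> inc k \<delta> i) = (\<forall>i. \<alpha> i \<le> \<delta> i)"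
      "(\<lambda>i. inc k \<delta> i - inc k \<alpha> i) = (\<lambda>i. \<delta> i - \<alpha> i)"
      unfolding inc_def fun_eq_iff by auto
    then show ?thesis by (simp add: \<delta> commuting_shift inc.IH)
  next
    case False
    then have k: "\<gamma> k = 0" by (simp add: range_inc)
    then have "\<not> (\<forall>i. inc k \<alpha> i \<le> \<gamma> i)" by (auto simp: inc_def intro!: exI[of _ k])
    then show ?thesis
      unfolding mpow_inc[OF commuting_shift] da_coeff_shift if_P[OF k] by (simp only: if_False)
  qed
qed

text \<open>The matrix of a multiplier in the monomials depends only on the difference of the two
  indices, and it is triangular for the pointwise order. Weights depending on the difference of
  degrees therefore act on it entry by entry.\<close>

lemma da_coeff_commutant_mon:
  assumes "A \<in> shift_commutant"
  shows "da_coeff (A (da_mon \<beta>)) \<gamma> =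
    (if \<forall>i. \<beta> i \<le> \<gamma> i then da_coeff (A da_one) (\<lambda>i. \<gamma> i - \<beta> i) else 0)"
  by (subst shift_commutant_mon[OF assms]) (rule da_coeff_mpow_shift)

text \<open>The weights fall linearly from 1 in degree 0 to 0 in degree \<open>n\<close>; at
  \<open>n = 0\<close> the sum is empty. As a polynomial in the shifts it has a prescribed image
  under every calculus.\<close>

definition fejer :: "nat \<Rightarrow> ('d::finite drury_arveson \<Rightarrow> 'd drury_arveson) \<Rightarrow> 'd drury_arveson \<Rightarrow> 'd drury_arveson" where
  "fejer n A f = (\<Sum>\<alpha> | mdeg \<alpha> < n.
     (of_real (real (n - mdeg \<alpha>) / real n) * da_coeff (A da_one) \<alpha>) *\<^sub>C mpow shift \<alpha> f)"

lemma fejer_in_commutant: "fejer n A \<in> shift_commutant"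
  unfolding fejer_def by (intro shift_commutant_sum shift_commutant_scaleC mpow_shift_in_commutant)

text \<open>No case distinction on the degree: subtraction of naturals makes the weight 0 from
  degree \<open>n\<close> on.\<close>

lemma da_coeff_fejer_one:
  "da_coeff (fejer n A da_one) \<alpha> = of_real (real (n - mdeg \<alpha>) / real n) * da_coeff (A da_one) \<alpha>"
  by (simp add: fejer_def mpow_shift_one da_coeff_mon finite_mdeg_less if_distrib cong: if_cong)

lemma da_coeff_fejer_mon:
  assumes "A \<in> shift_commutant"
  shows "da_coeff (fejer n A (da_mon \<beta>)) \<gamma> =
    of_real (real (n - (mdeg \<gamma> - mdeg \<beta>)) / real n) * da_coeff (A (da_mon \<beta>)) \<gamma>"
proof (cases "\<forall>i. \<beta> i \<le> \<gamma> i")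
  case True
  then have "mdeg (\<lambda>i. \<gamma> i - \<beta> i) = mdeg \<gamma> - mdeg \<beta>"
    unfolding mdeg_def by (simp add: sum_subtractf_nat)
  then show ?thesis
    unfolding da_coeff_commutant_mon[OF fejer_in_commutant, of n A \<beta> \<gamma>]
      da_coeff_commutant_mon[OF assms, of \<beta> \<gamma>]
      if_P[OF True] da_coeff_fejer_one by (simp only:)
next
  case False
  then show ?thesis
    unfolding da_coeff_commutant_mon[OF fejer_in_commutant, of n A \<beta> \<gamma>]
      da_coeff_commutant_mon[OF assms, of \<beta> \<gamma>]
    by (simp only: if_not_P mult_zero_right if_False)
qed

section \<open>The uniform bound for the Fejer means and their weak convergence\<close>

lemma cinner_op_mon_sums:
  assumes "clinear A"
  shows "cinner (A (\<Sum>\<beta>\<in>F. b \<beta> *\<^sub>C da_mon \<beta>)) (\<Sum>\<gamma>\<in>G. c \<gamma> *\<^sub>C da_mon \<gamma>) =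
    (\<Sum>\<beta>\<in>F. \<Sum>\<gamma>\<in>G. b \<beta> * cnj (c \<gamma>) * (of_real (da_weight \<gamma>) * da_coeff (A (da_mon \<beta>)) \<gamma>))"
  by (simp add: module_hom.sum[OF assms] module_hom.scale[OF assms] cinner_sum_left cinner_sum_right
      cinner_scaleC_left cinner_scaleC_right cinner_da_mon sum_distrib_left)
    (subst sum.swap, simp add: mult_ac)

lemma norm_sum_mon_sq:
  assumes "finite G"
  shows "(norm (\<Sum>\<beta>\<in>G. c \<beta> *\<^sub>C da_mon \<beta>))\<^sup>2 = (\<Sum>\<beta>\<in>G. da_weight \<beta> * (cmod (c \<beta>))\<^sup>2)"
proof -
  have "(norm (\<Sum>\<beta>\<in>G. c \<beta> *\<^sub>C da_mon \<beta>))\<^sup>2 =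
      (\<Sum>\<^sub>\<infinity>\<alpha>\<in>G. da_weight \<alpha> * (cmod (da_coeff (\<Sum>\<beta>\<in>G. c \<beta> *\<^sub>C da_mon \<beta>) \<alpha>))\<^sup>2)"
    unfolding da_norm_sq
    by (rule infsum_cong_neutral) (auto simp: da_coeff_mon if_distrib assms cong: if_cong)
  also have "\<dots> = (\<Sum>\<beta>\<in>G. da_weight \<beta> * (cmod (c \<beta>))\<^sup>2)"
    by (simp add: assms da_coeff_mon if_distrib cong: if_cong)
  finally show ?thesis .
qed

text \<open>The Fejer mean is the average \<open>(1/n) \<Sum>\<^sub>m Q\<^sub>m A Q\<^sub>m\<close>, where \<open>Q\<^sub>m\<close> projects onto the
  degrees \<open>k\<close> with \<open>k \<le> m < k + n\<close>: the degrees \<open>j \<le> k\<close> share \<open>n - (k - j)\<close> of these windows, and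
  every degree lies in \<open>n\<close> of them.\<close>

lemma fejer_bound_trunc:
  fixes A :: "'d::finite drury_arveson \<Rightarrow> 'd drury_arveson"
  assumes A: "A \<in> shift_commutant" and K: "0 \<le> K" "\<And>f. norm (A f) \<le> K * norm f"
  shows "cmod (cinner (fejer n A (trunc D f)) (trunc D g)) \<le> K * norm f * norm g"
proof (cases "n = 0")
  case True
  then show ?thesis by (simp add: fejer_def K)
next
  case n: False
  define F where "F = {\<beta> :: 'd \<Rightarrow> nat. mdeg \<beta> < D}"
  have F: "finite F" unfolding F_def by (rule finite_mdeg_less)
  define W where "W m = {\<beta> \<in> F. mdeg \<beta> \<le> m \<and> m < mdeg \<beta> + n}" for m
  define q where "q m f = (\<Sum>\<beta>\<in>W m. da_coeff f \<beta> *\<^sub>C da_mon \<beta>)" for m and f :: "'d drury_arveson"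
  have W: "finite (W m)" for m unfolding W_def using F by simp
  have lin: "clinear A" "clinear (fejer n A)"
    using A fejer_in_commutant[of n A] by (auto dest: shift_commutant_bounded_ops bounded_ops_clinear)
  define e where "e \<beta> \<gamma> = da_coeff f \<beta> * cnj (da_coeff g \<gamma>) * (of_real (da_weight \<gamma>) * da_coeff (A (da_mon \<beta>)) \<gamma>)"
    for \<beta> \<gamma>
  \<comment> \<open>The restriction \<open>m < D + n\<close> cuts off no window, since the degrees
    in \<open>F\<close> are below \<open>D\<close>.\<close>
  have cardW: "card {m. m < D + n \<and> \<beta> \<in> W m \<and> \<gamma> \<in> W m} = n - (mdeg \<gamma> - mdeg \<beta>)"
    if "\<beta> \<in> F" "\<gamma> \<in> F" "mdeg \<beta> \<le> mdeg \<gamma>" for \<beta> \<gamma>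
  proof -
    have "{m. m < D + n \<and> \<beta> \<in> W m \<and> \<gamma> \<in> W m} = {mdeg \<gamma>..<mdeg \<beta> + n}"
      using that by (auto simp: W_def F_def)
    then show ?thesis using that(3) by simp
  qed
  \<comment> \<open>In this range the truncated difference in \<open>cardW\<close> would give a
    wrong count, but a multiplier lowers no degree, so the entry itself is 0.\<close>
  have e_zero: "e \<beta> \<gamma> = 0" if "\<not> mdeg \<beta> \<le> mdeg \<gamma>" for \<beta> \<gamma>
  proof -
    have "\<not> (\<forall>i. \<beta> i \<le> \<gamma> i)" using that sum_mono[of UNIV \<beta> \<gamma>] by (auto simp: mdeg_def)
    then have "da_coeff (A (da_mon \<beta>)) \<gamma> = 0"
      using da_coeff_commutant_mon[OF A, of \<beta> \<gamma>] by (simp only: if_False)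
    then show ?thesis by (simp add: e_def)
  qed
  have "(\<Sum>m<D + n. cinner (A (q m f)) (q m g)) = (\<Sum>m<D + n. \<Sum>\<beta>\<in>F. \<Sum>\<gamma>\<in>F. if \<beta> \<in> W m \<and> \<gamma> \<in> W m then e \<beta> \<gamma> else 0)"
  proof (rule sum.cong[OF refl])
    fix m
    have "cinner (A (q m f)) (q m g) = (\<Sum>\<beta>\<in>W m. \<Sum>\<gamma>\<in>W m. e \<beta> \<gamma>)"
      unfolding q_def cinner_op_mon_sums[OF lin(1)] e_def ..
    also have "\<dots> = (\<Sum>\<beta>\<in>W m. \<Sum>\<gamma>\<in>F. if \<gamma> \<in> W m then e \<beta> \<gamma> else 0)"
      by (intro sum.cong refl sum.mono_neutral_cong_left F) (auto simp: W_def)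
    also have "\<dots> = (\<Sum>\<beta>\<in>F. \<Sum>\<gamma>\<in>F. if \<beta> \<in> W m \<and> \<gamma> \<in> W m then e \<beta> \<gamma> else 0)"
    proof (rule sum.mono_neutral_cong_left[OF F])
      show "\<forall>\<beta>\<in>F - W m. (\<Sum>\<gamma>\<in>F. if \<beta> \<in> W m \<and> \<gamma> \<in> W m then e \<beta> \<gamma> else 0) = 0" by simp
    qed (auto simp: W_def)
    finally show "cinner (A (q m f)) (q m g) = (\<Sum>\<beta>\<in>F. \<Sum>\<gamma>\<in>F. if \<beta> \<in> W m \<and> \<gamma> \<in> W m then e \<beta> \<gamma> else 0)" .
  qed
  also have "\<dots> = (\<Sum>\<beta>\<in>F. \<Sum>\<gamma>\<in>F. \<Sum>m<D + n. if \<beta> \<in> W m \<and> \<gamma> \<in> W m then e \<beta> \<gamma> else 0)"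
    by (subst sum.swap, rule sum.cong[OF refl], rule sum.swap)
  also have "\<dots> = (\<Sum>\<beta>\<in>F. \<Sum>\<gamma>\<in>F. of_nat (n - (mdeg \<gamma> - mdeg \<beta>)) * e \<beta> \<gamma>)"
  proof (intro sum.cong refl)
    fix \<beta> \<gamma> assume F: "\<beta> \<in> F" "\<gamma> \<in> F"
    have "(\<Sum>m<D + n. if \<beta> \<in> W m \<and> \<gamma> \<in> W m then e \<beta> \<gamma> else 0) =
        of_nat (card {m. m < D + n \<and> \<beta> \<in> W m \<and> \<gamma> \<in> W m}) * e \<beta> \<gamma>"
      by (subst sum.inter_filter[symmetric]) (simp_all add: lessThan_def)
    then show "(\<Sum>m<D + n. if \<beta> \<in> W m \<and> \<gamma> \<in> W m then e \<beta> \<gamma> else 0) = of_nat (n - (mdeg \<gamma> - mdeg \<beta>)) * e \<beta> \<gamma>"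
      using cardW[OF F] e_zero[of \<beta> \<gamma>] by (cases "mdeg \<beta> \<le> mdeg \<gamma>") auto
  qed
  also have "\<dots> = of_nat n * cinner (fejer n A (trunc D f)) (trunc D g)"
    unfolding trunc_def cinner_op_mon_sums[OF lin(2)] F_def[symmetric] da_coeff_fejer_mon[OF A]
      e_def sum_distrib_left
    using n by (intro sum.cong refl) simp
  finally have avg: "of_nat n * cinner (fejer n A (trunc D f)) (trunc D g) = (\<Sum>m<D + n. cinner (A (q m f)) (q m g))"
    by simp
  have q_sum: "(\<Sum>m<D + n. (norm (q m h))\<^sup>2) \<le> real n * (norm h)\<^sup>2" for h
  proof -
    have "(\<Sum>m<D + n. (norm (q m h))\<^sup>2) = (\<Sum>m<D + n. \<Sum>\<beta>\<in>F. if \<beta> \<in> W m then da_weight \<beta> * (cmod (da_coeff h \<beta>))\<^sup>2 else 0)"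
      unfolding q_def norm_sum_mon_sq[OF W]
      by (intro sum.cong refl sum.mono_neutral_cong_left F) (auto simp: W_def)
    also have "\<dots> = (\<Sum>\<beta>\<in>F. \<Sum>m<D + n. if \<beta> \<in> W m then da_weight \<beta> * (cmod (da_coeff h \<beta>))\<^sup>2 else 0)"
      by (rule sum.swap)
    also have "\<dots> = (\<Sum>\<beta>\<in>F. real n * (da_weight \<beta> * (cmod (da_coeff h \<beta>))\<^sup>2))"
    proof (intro sum.cong refl)
      fix \<beta> assume \<beta>: "\<beta> \<in> F"
      have "(\<Sum>m<D + n. if \<beta> \<in> W m then da_weight \<beta> * (cmod (da_coeff h \<beta>))\<^sup>2 else 0) =
          of_nat (card {m. m < D + n \<and> \<beta> \<in> W m}) * (da_weight \<beta> * (cmod (da_coeff h \<beta>))\<^sup>2)"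
        by (subst sum.inter_filter[symmetric]) (simp_all add: lessThan_def)
      then show "(\<Sum>m<D + n. if \<beta> \<in> W m then da_weight \<beta> * (cmod (da_coeff h \<beta>))\<^sup>2 else 0) =
          real n * (da_weight \<beta> * (cmod (da_coeff h \<beta>))\<^sup>2)"
        using cardW[OF \<beta> \<beta>] by simp
    qed
    also have "\<dots> = real n * (\<Sum>\<beta>\<in>F. da_weight \<beta> * (cmod (da_coeff h \<beta>))\<^sup>2)"
      by (simp add: sum_distrib_left)
    also have "\<dots> \<le> real n * (norm h)\<^sup>2"
      by (intro mult_left_mono da_finite_sum_le F) simp
    finally show ?thesis .
  qed
  \<comment> \<open>Each of the two families contributes \<open>sqrt n\<close> to Cauchy--Schwarz
    over the windows; together these cancel the averaging factor and leave the bound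
    \<open>K\<close>.\<close>
  have L2: "L2_set (\<lambda>m. norm (q m h)) {..<D + n} \<le> sqrt (real n) * norm h" for h
    unfolding L2_set_def using real_sqrt_le_mono[OF q_sum[of h]] by (simp add: real_sqrt_mult)
  have "real n * cmod (cinner (fejer n A (trunc D f)) (trunc D g)) \<le> (\<Sum>m<D + n. cmod (cinner (A (q m f)) (q m g)))"
    using norm_sum[of "\<lambda>m. cinner (A (q m f)) (q m g)" "{..<D + n}"] unfolding avg[symmetric] by (simp add: norm_mult)
  also have "\<dots> \<le> (\<Sum>m<D + n. K * (norm (q m f) * norm (q m g)))"
  proof (rule sum_mono)
    fix m
    have "cmod (cinner (A (q m f)) (q m g)) \<le> norm (A (q m f)) * norm (q m g)" by (rule cinner_Cauchy_Schwarz)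
    also have "\<dots> \<le> (K * norm (q m f)) * norm (q m g)" by (intro mult_right_mono K) simp
    finally show "cmod (cinner (A (q m f)) (q m g)) \<le> K * (norm (q m f) * norm (q m g))" by (simp add: mult.assoc)
  qed
  also have "\<dots> \<le> K * (L2_set (\<lambda>m. norm (q m f)) {..<D + n} * L2_set (\<lambda>m. norm (q m g)) {..<D + n})"
    unfolding sum_distrib_left[symmetric]
    using L2_set_mult_ineq[of "\<lambda>m. norm (q m f)" "\<lambda>m. norm (q m g)" "{..<D + n}"]
    by (intro mult_left_mono K) simp
  also have "\<dots> \<le> K * ((sqrt (real n) * norm f) * (sqrt (real n) * norm g))"
    by (intro mult_left_mono mult_mono L2 K) (simp_all add: L2_set_nonneg)
  also have "\<dots> = real n * (K * norm f * norm g)"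
    by simp
  finally show ?thesis using n by simp
qed

lemma fejer_bound:
  assumes "A \<in> shift_commutant" "0 \<le> K" "\<And>f. norm (A f) \<le> K * norm f"
  shows "cmod (cinner (fejer n A f) g) \<le> K * norm f * norm g"
proof -
  have "(\<lambda>D. cinner (fejer n A (trunc D f)) (trunc D g)) \<longlonglongrightarrow> cinner (fejer n A f) g"
    by (rule bounded_bilinear.tendsto[OF bounded_bilinear_cinner bounded_linear.tendsto[OF
          bounded_ops_bounded_linear[OF shift_commutant_bounded_ops[OF fejer_in_commutant]] trunc_tendsto]
          trunc_tendsto])
  then have "(\<lambda>D. cmod (cinner (fejer n A (trunc D f)) (trunc D g))) \<longlonglongrightarrow> cmod (cinner (fejer n A f) g)"
    by (rule tendsto_norm)
  then show ?thesis
    by (rule LIMSEQ_le_const2) (use fejer_bound_trunc[OF assms] in blast)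
qed

lemma fejer_coeff_tendsto: "(\<lambda>n. complex_of_real (real (n - k) / real n)) \<longlonglongrightarrow> 1"
proof -
  have "(\<lambda>n. 1 - real k * inverse (real n)) \<longlonglongrightarrow> 1 - real k * 0"
    by (intro tendsto_intros lim_inverse_n)
  moreover have "\<forall>\<^sub>F n in sequentially. 1 - real k * inverse (real n) = real (n - k) / real n"
    using eventually_ge_at_top[of "Suc k"]
    by eventually_elim (simp add: of_nat_diff field_simps)
  ultimately have "(\<lambda>n. real (n - k) / real n) \<longlonglongrightarrow> 1"
    by (simp add: tendsto_cong)
  from tendsto_of_real[OF this, where 'a = complex] show ?thesis by simp
qed

text \<open>For truncated arguments this is convergence of finitely many matrix entries. By
  \<open>fejer_bound\<close> the error made by truncating \<open>f\<close> and \<open>g\<close> is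
  small independently of \<open>n\<close>.\<close>

lemma fejer_weak_tendsto:
  fixes A :: "'d::finite drury_arveson \<Rightarrow> 'd drury_arveson"
  assumes A: "A \<in> shift_commutant"
  shows "(\<lambda>n. cinner (fejer n A f) g) \<longlonglongrightarrow> cinner (A f) g"
proof -
  obtain K where K: "0 \<le> K" "\<And>f. norm (A f) \<le> K * norm f"
    using bounded_ops_UNIV_bound[OF shift_commutant_bounded_ops[OF A]] by blast
  define b where "b n f g = cinner (fejer n A f) g - cinner (A f) g" for n f g
  have linA: "clinear A" using A by (simp add: shift_commutant_bounded_ops bounded_ops_clinear)
  have linF: "clinear (fejer n A)" for n
    using fejer_in_commutant by (intro bounded_ops_clinear shift_commutant_bounded_ops)
  have b_bound: "cmod (b n f g) \<le> 2 * K * norm f * norm g" for n f g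
  proof -
    have "cmod (cinner (A f) g) \<le> (K * norm f) * norm g"
      by (rule order_trans[OF cinner_Cauchy_Schwarz]) (intro mult_right_mono K norm_ge_zero)
    then show ?thesis
      using norm_triangle_ineq4[of "cinner (fejer n A f) g" "cinner (A f) g"] fejer_bound[OF A K, of n f g]
      unfolding b_def by linarith
  qed
  have b_trunc: "(\<lambda>n. b n (trunc D f) (trunc D g)) \<longlonglongrightarrow> 0" for D
  proof -
    have "(\<lambda>n. cinner (fejer n A (trunc D f)) (trunc D g)) \<longlonglongrightarrow>
        (\<Sum>\<beta> | mdeg \<beta> < D. \<Sum>\<gamma> | mdeg \<gamma> < D. da_coeff f \<beta> * cnj (da_coeff g \<gamma>) *
          (of_real (da_weight \<gamma>) * (1 * da_coeff (A (da_mon \<beta>)) \<gamma>)))"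
      unfolding trunc_def cinner_op_mon_sums[OF linF] da_coeff_fejer_mon[OF A]
      by (intro tendsto_sum tendsto_mult tendsto_const fejer_coeff_tendsto)
    then have "(\<lambda>n. cinner (fejer n A (trunc D f)) (trunc D g)) \<longlonglongrightarrow> cinner (A (trunc D f)) (trunc D g)"
      by (simp only: trunc_def[of D f] trunc_def[of D g] cinner_op_mon_sums[OF linA] mult_1_left)
    then show ?thesis unfolding b_def by (simp add: LIM_zero_iff)
  qed
  have "(\<lambda>n. b n f g) \<longlonglongrightarrow> 0"
  proof (rule LIMSEQ_I)
    fix r :: real assume r: "0 < r"
    have "(\<lambda>D. 2 * K * norm (f - trunc D f) * norm g + 2 * K * norm f * norm (g - trunc D g)) \<longlonglongrightarrow>
        2 * K * norm (f - f) * norm g + 2 * K * norm f * norm (g - g)"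
      by (intro tendsto_intros trunc_tendsto)
    then have "(\<lambda>D. 2 * K * norm (f - trunc D f) * norm g + 2 * K * norm f * norm (g - trunc D g)) \<longlonglongrightarrow> 0"
      by simp
    from LIMSEQ_D[OF this, of "r / 2"] r obtain D where
      D: "norm (2 * K * norm (f - trunc D f) * norm g + 2 * K * norm f * norm (g - trunc D g) - 0) < r / 2"
      using order_refl half_gt_zero by blast
    from LIMSEQ_D[OF b_trunc[of D], of "r / 2"] r obtain N where
      N: "\<And>n. n \<ge> N \<Longrightarrow> cmod (b n (trunc D f) (trunc D g)) < r / 2" by auto
    show "\<exists>no. \<forall>n\<ge>no. norm (b n f g - 0) < r"
    proof (intro exI allI impI)
      fix n assume n: "N \<le> n"
      have "b n f g = b n (f - trunc D f) g + b n (trunc D f) (g - trunc D g) + b n (trunc D f) (trunc D g)"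
        unfolding b_def module_hom.diff[OF linA] module_hom.diff[OF linF]
        by (simp add: cinner_diff_left cinner_diff_right)
      from arg_cong[OF this, of cmod]
      have "cmod (b n f g) \<le> cmod (b n (f - trunc D f) g) + cmod (b n (trunc D f) (g - trunc D g))
          + cmod (b n (trunc D f) (trunc D g))"
        using norm_triangle_ineq[of "b n (f - trunc D f) g + b n (trunc D f) (g - trunc D g)" "b n (trunc D f) (trunc D g)"]
          norm_triangle_ineq[of "b n (f - trunc D f) g" "b n (trunc D f) (g - trunc D g)"] by linarith
      also have "\<dots> \<le> 2 * K * norm (f - trunc D f) * norm g + 2 * K * norm f * norm (g - trunc D g)
          + cmod (b n (trunc D f) (trunc D g))"
      proof -
        have "2 * K * norm (trunc D f) * norm (g - trunc D g) \<le> 2 * K * norm f * norm (g - trunc D g)"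
          using K(1) by (intro mult_right_mono mult_left_mono norm_trunc_le) auto
        then show ?thesis
          using b_bound[of n "f - trunc D f" g] b_bound[of n "trunc D f" "g - trunc D g"] by linarith
      qed
      also have "\<dots> < r" using D N[OF n] unfolding real_norm_def diff_0_right by linarith
      finally show "norm (b n f g - 0) < r" by simp
    qed
  qed
  then show ?thesis unfolding b_def by (simp add: LIM_zero_iff)
qed

section \<open>Weak-* convergence of the Fejer means\<close>

lemma limitin_topology_generated_by:
  assumes "\<And>U. U \<in> S \<Longrightarrow> l \<in> U \<Longrightarrow> eventually (\<lambda>x. f x \<in> U) F" "l \<in> \<Union> S"
  shows "limitin (topology_generated_by S) f l F"
proof -
  \<comment> \<open>Eventual membership passes from generators to finite intersections and arbitrary
    unions, by induction on the generated open sets.\<close>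
  have "l \<in> U \<longrightarrow> eventually (\<lambda>x. f x \<in> U) F" if "generate_topology_on S U" for U
    using that
  proof induction
    case (Int a b)
    then show ?case by (auto elim: eventually_elim2)
  next
    case (UN K)
    show ?case
    proof
      assume "l \<in> \<Union> K"
      then obtain k where "k \<in> K" "l \<in> k" by blast
      with UN have "eventually (\<lambda>x. f x \<in> k) F" by blast
      then show "eventually (\<lambda>x. f x \<in> \<Union> K) F" by eventually_elim (use \<open>k \<in> K\<close> in blast)
    qed
  qed (use assms(1) in auto)
  then show ?thesis
    using assms(2) by (simp add: limitin_def openin_topology_generated_by_iff)
qed

text \<open>Each term of the series converges by the weak limit; exchanging limit and series takes a
  summable majorant independent of \<open>n\<close>, which \<open>fejer_bound\<close> supplies
  through the norm bound \<open>K\<close> of \<open>A\<close>.\<close>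

lemma fejer_predual_tendsto:
  assumes A: "A \<in> shift_commutant" and "\<omega> \<in> predual UNIV"
  shows "(\<lambda>n. \<omega> (fejer n A)) \<longlonglongrightarrow> \<omega> A"
proof -
  obtain \<xi> \<eta> :: "nat \<Rightarrow> _" where \<omega>: "\<omega> = (\<lambda>A. \<Sum>n. cinner (A (\<xi> n)) (\<eta> n))"
    and s: "summable (\<lambda>n. (norm (\<xi> n))\<^sup>2)" "summable (\<lambda>n. (norm (\<eta> n))\<^sup>2)"
    using assms(2) unfolding predual_def by blast
  obtain K where K: "0 \<le> K" "\<And>f. norm (A f) \<le> K * norm f"
    using bounded_ops_UNIV_bound[OF shift_commutant_bounded_ops[OF A]] by blast
  define M where "M k = K * ((norm (\<xi> k))\<^sup>2 + (norm (\<eta> k))\<^sup>2)" for k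
  have bound: "cmod (cinner (fejer n A (\<xi> k)) (\<eta> k)) \<le> M k" for n k
  proof -
    have "norm (\<xi> k) * norm (\<eta> k) \<le> (norm (\<xi> k))\<^sup>2 + (norm (\<eta> k))\<^sup>2"
      using sum_squares_bound[of "norm (\<xi> k)" "norm (\<eta> k)"]
        mult_nonneg_nonneg[OF norm_ge_zero[of "\<xi> k"] norm_ge_zero[of "\<eta> k"]] by linarith
    then have "K * (norm (\<xi> k) * norm (\<eta> k)) \<le> M k" unfolding M_def by (intro mult_left_mono K)
    then show ?thesis using fejer_bound[OF A K, of n "\<xi> k" "\<eta> k"] by (simp add: mult.assoc)
  qed
  have "summable M" unfolding M_def by (intro summable_mult summable_add s)
  from tannerys_theorem[OF fejer_weak_tendsto[OF A, of "\<xi> _" "\<eta> _"] _ this] bound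
  show ?thesis unfolding \<omega> by (simp add: case_prod_unfold)
qed

text \<open>The two vectors are padded with zeros to sequences. These functionals make every matrix
  coefficient weak-* continuous, so that limits can be read off from matrix coefficients.\<close>

lemma predual_rank_one:
  fixes x y :: "'h::chilbert_space"
  assumes "x \<in> M" "y \<in> M" "0 \<in> M"
  shows "(\<lambda>A. cinner (A x) y) \<in> predual M"
proof -
  define \<xi> \<eta> where "\<xi> n = (if n = 0 then x else 0)" and "\<eta> n = (if n = 0 then y else 0)" for n :: nat
  have "(\<Sum>n. cinner (A (\<xi> n)) (\<eta> n)) = cinner (A x) y" for A
    by (subst suminf_finite[of "{0}"]) (auto simp: \<xi>_def \<eta>_def)
  moreover have "summable (\<lambda>n. (norm (\<xi> n))\<^sup>2)" "summable (\<lambda>n. (norm (\<eta> n))\<^sup>2)"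
    by (rule summable_finite[of "{0}"]; simp add: \<xi>_def \<eta>_def)+
  moreover have "range \<xi> \<subseteq> M" "range \<eta> \<subseteq> M" using assms by (auto simp: \<xi>_def \<eta>_def)
  ultimately show ?thesis
    unfolding predual_def mem_Collect_eq by (intro exI[of _ \<xi>] exI[of _ \<eta>]) (simp add: fun_eq_iff)
qed

lemma topspace_weak_star:
  assumes "csubspace M"
  shows "topspace (weak_star M) = bounded_ops M"
proof -
  \<comment> \<open>The zero functional with \<open>U = UNIV\<close> gives a generator that is
    already all of \<open>bounded_ops M\<close>.\<close>
  have "{A \<in> bounded_ops M. cinner (A 0) 0 \<in> UNIV} \<in> {{A \<in> bounded_ops M. \<omega> A \<in> U} |\<omega> U. \<omega> \<in> predual M \<and> open U}"
    using predual_rank_one[of 0 M 0] cvs.subspace_0[OF assms] by blast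
  then show ?thesis
    unfolding weak_star_def topology_generated_by_topspace by auto
qed

lemma fejer_weak_star_limit:
  assumes "A \<in> shift_commutant"
  shows "limitin (subtopology (weak_star UNIV) shift_commutant) (\<lambda>n. fejer n A) A sequentially"
  unfolding limitin_subtopology
proof (intro conjI assms always_eventually allI fejer_in_commutant)
  show "limitin (weak_star UNIV) (\<lambda>n. fejer n A) A sequentially"
    unfolding weak_star_def
  proof (rule limitin_topology_generated_by)
    fix V assume "V \<in> {{A \<in> bounded_ops UNIV. \<omega> A \<in> U} |\<omega> U. \<omega> \<in> predual UNIV \<and> open U}" "A \<in> V"
    then obtain \<omega> U where V: "V = {A \<in> bounded_ops UNIV. \<omega> A \<in> U}" "\<omega> \<in> predual UNIV" "open U" "\<omega> A \<in> U"
      by blast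
    from topological_tendstoD[OF fejer_predual_tendsto[OF assms V(2)] V(3,4)]
    show "eventually (\<lambda>n. fejer n A \<in> V) sequentially"
      by eventually_elim (simp add: V(1) shift_commutant_bounded_ops[OF fejer_in_commutant])
  next
    have "A \<in> topspace (weak_star UNIV)"
      by (simp only: topspace_weak_star[OF cvs.subspace_UNIV] shift_commutant_bounded_ops[OF assms])
    then show "A \<in> \<Union> {{A \<in> bounded_ops UNIV. \<omega> A \<in> U} |\<omega> U. \<omega> \<in> predual UNIV \<and> open U}"
      unfolding weak_star_def topology_generated_by_topspace .
  qed
qed


section \<open>The calculus of a nilpotent commuting tuple\<close>

lemma clinear_restrict_bounded:
  assumes "A \<in> bounded_ops UNIV" "csubspace M" "\<And>x. x \<in> M \<Longrightarrow> A x \<in> M"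
  shows "restrict A M \<in> bounded_ops M"
proof -
  have lin: "clinear A" by (rule bounded_ops_clinear[OF assms(1)])
  obtain K where "\<And>x. norm (A x) \<le> K * norm x" using assms(1) by (auto simp: bounded_ops_UNIV_iff)
  then show ?thesis
    unfolding bounded_ops_def
    using assms(2,3) cvs.subspace_add[OF assms(2)] cvs.subspace_scale[OF assms(2)]
    by (auto simp: module_hom.add[OF lin] module_hom.scale[OF lin])
qed

text \<open>\<open>calc n T f x\<close> is \<open>f(T) x\<close>, if the monomials in \<open>T\<close> of degree at least \<open>n\<close> vanish.\<close>

definition calc :: "nat \<Rightarrow> ('d::finite \<Rightarrow> 'h::chilbert_space \<Rightarrow> 'h) \<Rightarrow> 'd drury_arveson \<Rightarrow> 'h \<Rightarrow> 'h" where
  "calc n T f x = (\<Sum>\<alpha> | mdeg \<alpha> < n. da_coeff f \<alpha> *\<^sub>C mpow T \<alpha> x)"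

text \<open>The algebraic layer: \<open>n\<close> bounds the total degree of the nonzero monomials
  in \<open>T\<close>. Contractivity enters in the locale that extends this one.\<close>

locale nilpotent_commuting =
  fixes T :: "'d::finite \<Rightarrow> 'h::chilbert_space \<Rightarrow> 'h" and n :: nat
  assumes T_bounded: "\<And>k. T k \<in> bounded_ops UNIV"
    and T_commuting: "commuting T"
    and T_nilpotent: "\<And>\<alpha> x. n \<le> mdeg \<alpha> \<Longrightarrow> mpow T \<alpha> x = 0"
begin

lemma T_clinear: "clinear (T k)"
  by (rule bounded_ops_clinear[OF T_bounded])

lemma mpow_clinear: "clinear (mpow T \<alpha>)"
  by (rule clinear_mpow[OF T_commuting T_clinear])

lemma calc_bounded_ops: "calc n T f \<in> bounded_ops UNIV"
proof -
  have "(\<lambda>x. \<Sum>\<alpha> | mdeg \<alpha> < n. da_coeff f \<alpha> *\<^sub>C mpow T \<alpha> x) \<in> bounded_ops UNIV"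
    by (intro bounded_ops_sum bounded_ops_scaleC bounded_ops_mpow T_commuting T_bounded)
  then show ?thesis by (simp add: calc_def[abs_def])
qed

lemma calc_clinear: "clinear (calc n T f)"
  by (rule bounded_ops_clinear[OF calc_bounded_ops])

lemma calc_add: "calc n T (f + g) x = calc n T f x + calc n T g x"
  by (simp add: calc_def scaleC_add_left sum.distrib)

lemma calc_scaleC: "calc n T (a *\<^sub>C f) x = a *\<^sub>C calc n T f x"
  unfolding calc_def da_coeff_scaleC scaleC_scaleC[symmetric] cvs.scale_sum_right ..

lemma calc_clinear_left: "clinear (\<lambda>f. calc n T f x)"
  by (rule clinearI) (simp_all add: calc_add calc_scaleC)

lemma calc_bounded_left: "bounded_linear (\<lambda>f. calc n T f x)"
proof -
  define K where "K = (\<Sum>\<alpha> | mdeg \<alpha> < n. norm (mpow T \<alpha> x) / sqrt (da_weight (\<alpha> :: 'd \<Rightarrow> nat)))"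
  have "norm (calc n T f x) \<le> K * norm f" for f :: "'d drury_arveson"
  proof -
    have "norm (calc n T f x) \<le> (\<Sum>\<alpha> | mdeg \<alpha> < n. norm (da_coeff f \<alpha> *\<^sub>C mpow T \<alpha> x))"
      unfolding calc_def by (rule norm_sum)
    also have "\<dots> \<le> (\<Sum>\<alpha> | mdeg \<alpha> < n. norm f / sqrt (da_weight \<alpha>) * norm (mpow T \<alpha> x))"
      unfolding norm_scaleC by (intro sum_mono mult_right_mono da_coeff_le) simp
    also have "\<dots> = K * norm f"
      unfolding K_def sum_distrib_right by (intro sum.cong refl) simp
    finally show ?thesis .
  qed
  then show ?thesis
    by (intro bounded_linear_intro[of _ K])
      (simp_all add: calc_add clinear_scaleR[OF calc_clinear_left] mult.commute)
qed

lemma calc_mon: "calc n T (da_mon \<alpha>) x = mpow T \<alpha> x"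
proof (cases "mdeg \<alpha> < n")
  case True
  have "calc n T (da_mon \<alpha>) x = (\<Sum>\<beta> | mdeg \<beta> < n. if \<beta> = \<alpha> then mpow T \<beta> x else 0)"
    unfolding calc_def da_coeff_mon by (intro sum.cong refl) simp
  then show ?thesis using True by (simp add: finite_mdeg_less)
next
  case False
  then have "calc n T (da_mon \<alpha>) x = 0"
    unfolding calc_def da_coeff_mon by (intro sum.neutral ballI) auto
  then show ?thesis using False by (simp add: T_nilpotent)
qed

lemma calc_one: "calc n T da_one x = x"
  by (simp add: calc_mon)

lemma calc_shift: "calc n T (shift k f) x = T k (calc n T f x)"
proof (rule eq_of_eq_on_da_mon[where f = f])
  show "bounded_linear (\<lambda>f. calc n T (shift k f) x)"
    by (rule bounded_linear_compose[OF calc_bounded_left bounded_ops_bounded_linear[OF shift_bounded_ops]])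
  show "bounded_linear (\<lambda>f. T k (calc n T f x))"
    by (rule bounded_linear_compose[OF bounded_ops_bounded_linear[OF T_bounded] calc_bounded_left])
qed (simp add: shift_da_mon calc_mon T_commuting calc_scaleC module_hom.scale[OF T_clinear]
    module_hom.scale[OF bounded_ops_clinear[OF shift_bounded_ops]])

lemma calc_mpow_shift: "calc n T (mpow shift \<alpha> f) x = mpow T \<alpha> (calc n T f x)"
  by (induction \<alpha> rule: mindex_induct) (simp_all add: commuting_shift T_commuting calc_shift)

lemma mpow_mpow_commute: "mpow T \<alpha> (mpow T \<beta> x) = mpow T \<beta> (mpow T \<alpha> x)"
  using mpow_add[OF T_commuting, of \<alpha> \<beta> x] mpow_add[OF T_commuting, of \<beta> \<alpha> x] by (simp add: add.commute)

lemma calc_mpow: "calc n T f (mpow T \<alpha> x) = mpow T \<alpha> (calc n T f x)"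
  unfolding calc_def
  by (simp add: module_hom.sum[OF mpow_clinear] module_hom.scale[OF mpow_clinear] mpow_mpow_commute[of _ \<alpha>])

text \<open>With \<open>f = B da_one\<close> this is multiplicativity of the calculus. On a
  monomial, \<open>A\<close> is multiplication by \<open>A da_one\<close>, so both sides apply the
  same monomial in \<open>T\<close> to the same vector; density of polynomials does the
  rest.\<close>

lemma calc_op:
  assumes A: "A \<in> shift_commutant"
  shows "calc n T (A f) x = calc n T (A da_one) (calc n T f x)"
proof (rule eq_of_eq_on_da_mon[where f = f])
  have Ab: "A \<in> bounded_ops UNIV" by (rule shift_commutant_bounded_ops[OF A])
  show "bounded_linear (\<lambda>f. calc n T (A f) x)"
    by (rule bounded_linear_compose[OF calc_bounded_left bounded_ops_bounded_linear[OF Ab]])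
  show "bounded_linear (\<lambda>f. calc n T (A da_one) (calc n T f x))"
    by (rule bounded_linear_compose[OF bounded_ops_bounded_linear[OF calc_bounded_ops] calc_bounded_left])
  fix a \<alpha>
  have "calc n T (A (da_mon \<alpha>)) x = calc n T (A da_one) (calc n T (da_mon \<alpha>) x)"
    unfolding calc_mon calc_mpow by (subst shift_commutant_mon[OF A]) (rule calc_mpow_shift)
  then show "calc n T (A (a *\<^sub>C da_mon \<alpha>)) x = calc n T (A da_one) (calc n T (a *\<^sub>C da_mon \<alpha>) x)"
    by (simp only: module_hom.scale[OF bounded_ops_clinear[OF Ab]] calc_scaleC module_hom.scale[OF calc_clinear])
qed

lemma calc_mem:
  assumes "csubspace M" "\<And>k x. x \<in> M \<Longrightarrow> T k x \<in> M" "x \<in> M"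
  shows "calc n T f x \<in> M"
  unfolding calc_def
  by (intro cvs.subspace_sum cvs.subspace_scale mpow_mem assms T_commuting)

end


section \<open>Positive forms of finite rank\<close>

text \<open>The Cholesky decomposition: each step splits off a rank one form and annihilates one more
  element of the generating set \<open>B\<close>.\<close>

lemma positive_form_decomposition:
  fixes D :: "'h::chilbert_space \<Rightarrow> 'h"
  assumes "finite C" "clinear D"
    and "\<And>x. x \<in> cspan B \<Longrightarrow> D x \<in> cspan B"
    and "\<And>x y. x \<in> cspan B \<Longrightarrow> y \<in> cspan B \<Longrightarrow> cinner (D x) y = cinner x (D y)"
    and "\<And>x. x \<in> cspan B \<Longrightarrow> 0 \<le> Re (cinner (D x) x)"
    and "\<And>b. b \<in> B - C \<Longrightarrow> D b = 0"
  shows "\<exists>(m::nat) d. (\<forall>r<m. d r \<in> cspan B) \<and> (\<forall>x\<in>cspan B. D x = (\<Sum>r<m. cinner x (d r) *\<^sub>C d r))"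
  using assms
proof (induction C arbitrary: D)
  case empty
  then have "D x = 0" if "x \<in> cspan B" for x
    using module_hom.eq_0_on_span[OF empty(1), of B] that by simp
  then show ?case by (intro exI[of _ 0]) simp
next
  case (insert c C)
  note lin = insert.prems(1) and herm = insert.prems(3) and pos = insert.prems(4)
  show ?case
  proof (cases "c \<in> B \<and> D c \<noteq> 0")
    case False
    then have "D b = 0" if "b \<in> B - C" for b using insert.prems(5)[of b] that by (cases "b = c") auto
    then show ?thesis using insert.IH[of D] insert.prems by blast
  next
    case True
    define u where "u = D c"
    have c: "c \<in> cspan B" using True by (simp add: cvs.span_base)
    then have u: "u \<in> cspan B" unfolding u_def by (rule insert.prems(2))
    define a where "a = Re (cinner u c)"
    have "cinner u c = cnj (cinner u c)" using herm[OF c c] cinner_commute[of c u] by (simp add: u_def)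
    then have uc: "cinner u c = of_real a" unfolding a_def by (simp add: complex_eq_iff)
    have cu: "cinner c u = of_real a" using herm[OF c c] uc by (simp add: u_def)
    \<comment> \<open>A zero pivot would force \<open>D c = 0\<close>: positivity of the form at
      \<open>c + t u\<close> for all real \<open>t\<close> kills the linear term
      \<open>2 * t * (norm u)\<^sup>2\<close>.\<close>
    have "a \<noteq> 0"
    proof
      assume "a = 0"
      have "(norm u)\<^sup>2 = 0"
      proof (rule nonneg_quadratic_linear_coeff_zero)
        fix t :: real
        have "c + of_real t *\<^sub>C u \<in> cspan B" using c u by (intro cvs.span_add cvs.span_scale)
        then have "0 \<le> Re (cinner (D (c + of_real t *\<^sub>C u)) (c + of_real t *\<^sub>C u))" by (rule pos)
        also have "cinner (D (c + of_real t *\<^sub>C u)) (c + of_real t *\<^sub>C u) =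
            2 * of_real t * cinner u u + of_real (t\<^sup>2) * cinner (D u) u"
          using herm[OF u c] uc \<open>a = 0\<close>
          by (simp add: module_hom.add[OF lin] module_hom.scale[OF lin] u_def[symmetric]
              cinner_add_left cinner_add_right cinner_scaleC_left cinner_scaleC_right
              algebra_simps power2_eq_square)
        finally show "0 \<le> 2 * t * (norm u)\<^sup>2 + t\<^sup>2 * Re (cinner (D u) u)"
          by (simp add: cinner_self)
      qed (rule pos[OF u])
      then show False using True by (simp add: u_def)
    qed
    moreover have "0 \<le> a" unfolding a_def u_def by (rule pos[OF c])
    ultimately have a: "0 < a" by simp
    define D' where "D' x = D x - (cinner x u / of_real a) *\<^sub>C u" for x
    \<comment> \<open>The Schur complement: the reduced form at \<open>x\<close> is the old form at
      \<open>x\<close> minus a multiple of \<open>c\<close>, so positivity survives.\<close>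
    have D'_pos: "cinner (D' x) x = cinner (D (x - (cinner x u / of_real a) *\<^sub>C c)) (x - (cinner x u / of_real a) *\<^sub>C c)"
      if x: "x \<in> cspan B" for x
    proof -
      define k where "k = cinner x u / of_real a"
      have "cinner (D x) c = k * of_real a" using herm[OF x c] a by (simp add: k_def u_def)
      moreover have "cinner u x = cnj k * of_real a" using a cinner_commute[of u x] by (simp add: k_def)
      ultimately show ?thesis
        unfolding D'_def k_def[symmetric]
        by (simp add: module_hom.diff[OF lin] module_hom.scale[OF lin] u_def[symmetric] uc
            cinner_diff_left cinner_diff_right cinner_scaleC_left cinner_scaleC_right algebra_simps)
    qed
    have "\<exists>(m::nat) d. (\<forall>r<m. d r \<in> cspan B) \<and> (\<forall>x\<in>cspan B. D' x = (\<Sum>r<m. cinner x (d r) *\<^sub>C d r))"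
    proof (rule insert.IH)
      show "clinear D'"
        unfolding D'_def
        by (rule clinearI) (simp_all add: module_hom.add[OF lin] module_hom.scale[OF lin] cinner_add_left
            cinner_scaleC_left add_divide_distrib cvs.scale_left_distrib cvs.scale_right_diff_distrib)
      show "D' x \<in> cspan B" if "x \<in> cspan B" for x
        unfolding D'_def using that u by (intro cvs.span_diff cvs.span_scale insert.prems(2))
      show "cinner (D' x) y = cinner x (D' y)" if "x \<in> cspan B" "y \<in> cspan B" for x y
        using herm[OF that] cinner_commute[of u y]
        by (simp add: D'_def cinner_diff_left cinner_diff_right cinner_scaleC_left cinner_scaleC_right)
      show "0 \<le> Re (cinner (D' x) x)" if "x \<in> cspan B" for x
        unfolding D'_pos[OF that] using that c by (intro pos cvs.span_diff cvs.span_scale)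
      show "D' b = 0" if b: "b \<in> B - C" for b
      proof (cases "b = c")
        case True
        then show ?thesis using a by (simp add: D'_def cu u_def[symmetric])
      next
        case False
        then have "D b = 0" using insert.prems(5) b by blast
        \<comment> \<open>\<open>D b = 0\<close> makes \<open>b\<close> orthogonal to
          \<open>u\<close>, so the rank one term preserves the zeros already obtained.\<close>
        moreover have "cinner b u = cinner (D b) c"
          unfolding u_def using herm[of b c] b c by (simp add: cvs.span_base)
        ultimately show ?thesis by (simp add: D'_def)
      qed
    qed
    then obtain m :: nat and d where d: "\<And>r. r < m \<Longrightarrow> d r \<in> cspan B"
      and D': "\<And>x. x \<in> cspan B \<Longrightarrow> D' x = (\<Sum>r<m. cinner x (d r) *\<^sub>C d r)" by blast
    define e where "e = d(m := (1 / of_real (sqrt a)) *\<^sub>C u)"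
    have sq: "complex_of_real (sqrt a) * complex_of_real (sqrt a) = complex_of_real a"
      using a by (simp only: of_real_mult[symmetric]) simp
    have "D x = (\<Sum>r<Suc m. cinner x (e r) *\<^sub>C e r)" if x: "x \<in> cspan B" for x
    proof -
      have "(\<Sum>r<m. cinner x (e r) *\<^sub>C e r) = D' x"
        unfolding D'[OF x] by (intro sum.cong refl) (simp add: e_def)
      moreover have "cinner x (e m) *\<^sub>C e m = (cinner x u / of_real a) *\<^sub>C u"
        by (simp add: e_def cinner_scaleC_right scaleC_scaleC sq mult.commute)
      ultimately show ?thesis by (simp add: D'_def)
    qed
    moreover have "e r \<in> cspan B" if "r < Suc m" for r
      using that d[of r] u by (auto simp: e_def less_Suc_eq intro: cvs.span_scale)
    ultimately show ?thesis by blast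
  qed
qed


section \<open>Complete contractivity\<close>

text \<open>\<open>Sup\<close> gives an upper bound only for sets that are bounded above, which the
  operator bounds of the entries ensure. Homogeneity carries the estimate from the unit ball to all
  \<open>v\<close>.\<close>

lemma matrix_opnorm_bound:
  fixes A :: "nat \<Rightarrow> nat \<Rightarrow> 'h::chilbert_space \<Rightarrow> 'h"
  assumes A: "\<And>i j. i < N \<Longrightarrow> j < N \<Longrightarrow> A i j \<in> bounded_ops UNIV"
  shows "0 \<le> matrix_opnorm UNIV N A"
    and "(\<Sum>i<N. (norm (\<Sum>j<N. A i j (v j)))\<^sup>2) \<le> (matrix_opnorm UNIV N A)\<^sup>2 * (\<Sum>j<N. (norm (v j))\<^sup>2)"
proof -
  define R where "R v = sqrt (\<Sum>i<N. (norm (\<Sum>j<N. A i j (v j)))\<^sup>2)" for v :: "nat \<Rightarrow> 'h"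
  have lin: "clinear (A i j)" if "i < N" "j < N" for i j
    using A[OF that] by (rule bounded_ops_clinear)
  have "\<exists>K. 0 \<le> K \<and> (\<forall>x. norm (A i j x) \<le> K * norm x)" if "i < N" "j < N" for i j
    using bounded_ops_UNIV_bound[OF A[OF that]] by metis
  then obtain K where K: "\<And>i j. i < N \<Longrightarrow> j < N \<Longrightarrow> 0 \<le> K i j"
    "\<And>i j x. i < N \<Longrightarrow> j < N \<Longrightarrow> norm (A i j x) \<le> K i j * norm x" by metis
  have bdd: "R v \<le> sqrt (\<Sum>i<N. (\<Sum>j<N. K i j)\<^sup>2)" if v: "(\<Sum>j<N. (norm (v j))\<^sup>2) \<le> 1" for v :: "nat \<Rightarrow> 'h"
    unfolding R_def
  proof (intro real_sqrt_le_mono sum_mono power_mono norm_ge_zero)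
    fix i assume i: "i \<in> {..<N}"
    show "norm (\<Sum>j<N. A i j (v j)) \<le> (\<Sum>j<N. K i j)"
    proof (intro order_trans[OF norm_sum] sum_mono)
      fix j assume j: "j \<in> {..<N}"
      have "(norm (v j))\<^sup>2 \<le> (\<Sum>j<N. (norm (v j))\<^sup>2)" using j by (intro member_le_sum) auto
      with v have "(norm (v j))\<^sup>2 \<le> 1\<^sup>2" by simp
      then have "norm (v j) \<le> 1" by (rule power2_le_imp_le) simp
      then have "K i j * norm (v j) \<le> K i j * 1" using K(1) i j by (intro mult_left_mono) auto
      then show "norm (A i j (v j)) \<le> K i j" using K(2)[of i j "v j"] i j by simp
    qed
  qed
  have le: "R v \<le> matrix_opnorm UNIV N A" if "(\<Sum>j<N. (norm (v j))\<^sup>2) \<le> 1" for v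
    unfolding matrix_opnorm_def
  proof (rule cSup_upper)
    show "R v \<in> {sqrt (\<Sum>i<N. (norm (\<Sum>j<N. A i j (v j)))\<^sup>2) |v :: nat \<Rightarrow> 'h.
        (\<forall>j<N. v j \<in> UNIV) \<and> (\<Sum>j<N. (norm (v j))\<^sup>2) \<le> 1}"
      using that unfolding R_def by blast
  qed (use bdd in \<open>auto simp: R_def intro!: bdd_aboveI[of _ "sqrt (\<Sum>i<N. (\<Sum>j<N. K i j)\<^sup>2)"]\<close>)
  have "0 \<le> R (\<lambda>_. 0)" unfolding R_def by (intro real_sqrt_ge_zero sum_nonneg) simp
  also have "\<dots> \<le> matrix_opnorm UNIV N A" by (rule le) simp
  finally show nonneg: "0 \<le> matrix_opnorm UNIV N A" .
  define s where "s = sqrt (\<Sum>j<N. (norm (v j))\<^sup>2)"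
  have s2: "s\<^sup>2 = (\<Sum>j<N. (norm (v j))\<^sup>2)" unfolding s_def by (simp add: sum_nonneg)
  show "(\<Sum>i<N. (norm (\<Sum>j<N. A i j (v j)))\<^sup>2) \<le> (matrix_opnorm UNIV N A)\<^sup>2 * (\<Sum>j<N. (norm (v j))\<^sup>2)"
  proof (cases "s = 0")
    case True
    then have "(\<Sum>j<N. (norm (v j))\<^sup>2) = 0" using s2 by simp
    then have "v j = 0" if "j < N" for j using that by (simp add: sum_nonneg_eq_0_iff)
    then have "(\<Sum>j<N. A i j (v j)) = 0" if "i < N" for i
      using that by (intro sum.neutral) (simp add: module_hom.zero[OF lin])
    then show ?thesis using True s2 by simp
  next
    case False
    then have s: "0 < s" unfolding s_def using sum_nonneg[of "{..<N}" "\<lambda>j. (norm (v j))\<^sup>2"] by simp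
    define u where "u j = inverse s *\<^sub>R v j" for j
    have "(\<Sum>j<N. (norm (u j))\<^sup>2) = (inverse s)\<^sup>2 * s\<^sup>2"
      unfolding u_def s2 using s by (simp add: power_mult_distrib sum_distrib_left)
    then have "R u \<le> matrix_opnorm UNIV N A" using s by (intro le) (simp add: power_inverse)
    moreover have "R u = inverse s * R v"
    proof -
      have "(\<Sum>j<N. A i j (u j)) = inverse s *\<^sub>R (\<Sum>j<N. A i j (v j))" if "i < N" for i
        unfolding scaleR_sum_right u_def using that lin by (intro sum.cong refl clinear_scaleR) auto
      then have "(\<Sum>i<N. (norm (\<Sum>j<N. A i j (u j)))\<^sup>2) = (inverse s)\<^sup>2 * (\<Sum>i<N. (norm (\<Sum>j<N. A i j (v j)))\<^sup>2)"
        using s by (simp add: sum_distrib_left power_mult_distrib)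
      then show ?thesis unfolding R_def using s by (simp add: real_sqrt_mult)
    qed
    ultimately have "R v \<le> matrix_opnorm UNIV N A * s" using s by (simp add: field_simps)
    then have "(R v)\<^sup>2 \<le> (matrix_opnorm UNIV N A * s)\<^sup>2"
      by (rule power_mono) (simp add: R_def sum_nonneg)
    then show ?thesis unfolding R_def power_mult_distrib s2 by (simp add: sum_nonneg)
  qed
qed

text \<open>The row inequality is that of the whole space, whereas the calculus is built on
  \<open>M\<close>. The finite set \<open>B\<close> makes projections onto \<open>M\<close> and the
  decomposition of positive forms available.\<close>

locale nilpotent_row_contraction = nilpotent_commuting T n
  for T :: "'d::finite \<Rightarrow> 'h::chilbert_space \<Rightarrow> 'h" and n +
  fixes M B :: "'h set"
  assumes T_row: "row_contraction T"
    and finite_B: "finite B"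
    and M_eq: "M = cspan B"
    and M_invariant: "\<And>k x. x \<in> M \<Longrightarrow> T k x \<in> M"
begin

section \<open>The restricted tuple and its adjoint\<close>

lemma csubspace_M: "csubspace M"
  unfolding M_eq by simp

lemma mpow_M: "x \<in> M \<Longrightarrow> mpow T \<alpha> x \<in> M"
  by (rule mpow_mem[OF T_commuting M_invariant])

lemma calc_M: "x \<in> M \<Longrightarrow> calc n T f x \<in> M"
  by (rule calc_mem[OF csubspace_M M_invariant])

lemma eq_by_cinner_M:
  assumes "u \<in> M" "v \<in> M" "\<And>x. x \<in> M \<Longrightarrow> cinner x u = cinner x v"
  shows "u = v"
proof -
  have "u - v \<in> M" using assms csubspace_M by (simp add: cvs.subspace_diff)
  then have "cinner (u - v) (u - v) = 0" using assms(3) by (simp add: cinner_diff_right)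
  then show ?thesis by (simp add: cinner_self)
qed

text \<open>The adjoint of the restriction of \<open>T k\<close> to \<open>M\<close>, precomposed with the projection onto \<open>M\<close>.\<close>

definition S :: "'d \<Rightarrow> 'h \<Rightarrow> 'h" where
  "S k y = (SOME s. s \<in> M \<and> (\<forall>x\<in>M. cinner (T k x) y = cinner x s))"

lemma S_M: "S k y \<in> M"
  and cinner_S: "x \<in> M \<Longrightarrow> cinner (T k x) y = cinner x (S k y)"
proof -
  \<comment> \<open>The vector sought is the projection of \<open>cadjoint (T k) y\<close> onto
    \<open>M\<close>.\<close>
  obtain p where p: "p \<in> M" "\<And>x. x \<in> M \<Longrightarrow> cinner (cadjoint (T k) y - p) x = 0"
    using ex_projection_cspan[OF finite_B] unfolding M_eq by blast
  have "cinner (T k x) y = cinner x p" if "x \<in> M" for x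
  proof -
    have "cinner x (cadjoint (T k) y - p) = 0" using p(2)[OF that] by (metis cinner_commute complex_cnj_zero)
    then show ?thesis by (simp add: cinner_cadjoint[OF T_bounded] cinner_diff_right)
  qed
  then have "\<exists>s. s \<in> M \<and> (\<forall>x\<in>M. cinner (T k x) y = cinner x s)" using p(1) by blast
  from someI_ex[OF this, folded S_def]
  show "S k y \<in> M" "x \<in> M \<Longrightarrow> cinner (T k x) y = cinner x (S k y)" by auto
qed

lemma S_clinear: "clinear (S k)"
proof (rule clinearI)
  fix y z a
  show "S k (y + z) = S k y + S k z"
    by (rule eq_by_cinner_M)
      (simp_all add: S_M csubspace_M cvs.subspace_add cinner_add_right cinner_S[symmetric])
  show "S k (a *\<^sub>C y) = a *\<^sub>C S k y"
    by (rule eq_by_cinner_M)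
      (simp_all add: S_M csubspace_M cvs.subspace_scale cinner_scaleC_right cinner_S[symmetric])
qed

lemma S_commuting: "commuting S"
  unfolding commuting_def
proof (intro allI ext)
  fix j k y
  show "(S j \<circ> S k) y = (S k \<circ> S j) y"
    by (rule eq_by_cinner_M)
      (simp_all add: S_M M_invariant cinner_S[symmetric] commutingD[OF T_commuting, of j k])
qed

lemma cinner_mpow_S: "x \<in> M \<Longrightarrow> cinner (mpow T \<alpha> x) y = cinner x (mpow S \<alpha> y)"
proof (induction \<alpha> arbitrary: y rule: mindex_induct)
  case (inc k \<alpha>)
  then show ?case
    by (simp add: T_commuting S_commuting cinner_S mpow_M mpow_commute[OF S_commuting])
qed simp

lemma mpow_S_M: "y \<in> M \<Longrightarrow> mpow S \<alpha> y \<in> M"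
  by (rule mpow_mem[OF S_commuting S_M])

text \<open>\<open>S k y\<close> is the projection of \<open>cadjoint (T k) y\<close> onto
  \<open>M\<close>, hence no longer than it. In this way the restriction to \<open>M\<close>
  inherits the row inequality.\<close>

lemma S_contractive: "(\<Sum>k\<in>UNIV. (norm (S k y))\<^sup>2) \<le> (norm y)\<^sup>2"
proof -
  have 1: "norm (S k y) \<le> norm (cadjoint (T k) y)" for k
  proof -
    have "of_real ((norm (S k y))\<^sup>2) = cinner (S k y) (cadjoint (T k) y)"
      unfolding cinner_self[symmetric]
      by (simp add: cinner_S[symmetric] S_M cinner_cadjoint[OF T_bounded])
    then have "(norm (S k y))\<^sup>2 = cmod (cinner (S k y) (cadjoint (T k) y))"
      by (metis abs_of_nonneg norm_of_real zero_le_power2)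
    also have "\<dots> \<le> norm (S k y) * norm (cadjoint (T k) y)" by (rule cinner_Cauchy_Schwarz)
    finally show ?thesis by (cases "S k y = 0") (simp_all add: power2_eq_square)
  qed
  have "cinner (T k (cadjoint (T k) y)) y = of_real ((norm (cadjoint (T k) y))\<^sup>2)" for k
    by (simp only: cinner_cadjoint[OF T_bounded] cinner_self)
  then have "cinner (y - (\<Sum>k\<in>UNIV. T k (cadjoint (T k) y))) y =
      of_real ((norm y)\<^sup>2 - (\<Sum>k\<in>UNIV. (norm (cadjoint (T k) y))\<^sup>2))"
    by (simp only: cinner_diff_left cinner_sum_left cinner_self of_real_diff of_real_sum)
  moreover have "0 \<le> Re (cinner (y - (\<Sum>k\<in>UNIV. T k (cadjoint (T k) y))) y)"
    using T_row unfolding row_contraction_def complex_nonneg_Reals_iff by blast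
  ultimately have "(\<Sum>k\<in>UNIV. (norm (cadjoint (T k) y))\<^sup>2) \<le> (norm y)\<^sup>2"
    by (simp only: Re_complex_of_real)
  moreover have "(\<Sum>k\<in>UNIV. (norm (S k y))\<^sup>2) \<le> (\<Sum>k\<in>UNIV. (norm (cadjoint (T k) y))\<^sup>2)"
    by (intro sum_mono power_mono 1) simp
  ultimately show ?thesis by simp
qed

section \<open>The defect and the dilation of finite rank\<close>

definition defect :: "'h \<Rightarrow> 'h" where
  "defect y = y - (\<Sum>k\<in>UNIV. T k (S k y))"

lemma defect_decomposition:
  obtains m :: nat and d where "\<And>r. r < m \<Longrightarrow> d r \<in> M"
    and "\<And>x. x \<in> M \<Longrightarrow> defect x = (\<Sum>r<m. cinner x (d r) *\<^sub>C d r)"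
proof -
  have TS: "clinear (\<lambda>y. T k (S k y))" for k by (rule clinear_compose[OF T_clinear S_clinear])
  have "\<exists>(m::nat) d. (\<forall>r<m. d r \<in> cspan B) \<and> (\<forall>x\<in>cspan B. defect x = (\<Sum>r<m. cinner x (d r) *\<^sub>C d r))"
  proof (rule positive_form_decomposition[OF finite_B]; (unfold M_eq[symmetric])?)
    show "clinear defect"
      unfolding defect_def
      by (rule clinearI) (simp_all add: module_hom.add[OF TS] module_hom.scale[OF TS] sum.distrib
          cvs.scale_right_diff_distrib cvs.scale_sum_right)
    show "defect x \<in> M" if "x \<in> M" for x
      unfolding defect_def using that
      by (intro cvs.subspace_diff cvs.subspace_sum csubspace_M M_invariant S_M)
    show "cinner (defect x) y = cinner x (defect y)" if "x \<in> M" "y \<in> M" for x y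
    proof -
      have "cinner (T k (S k x)) y = cinner x (T k (S k y))" for k
        using cinner_S[OF S_M, of k k x y] cinner_S[OF S_M, of k k y x] that
        by (metis cinner_commute)
      then show ?thesis
        by (simp add: defect_def cinner_diff_left cinner_diff_right cinner_sum_left cinner_sum_right)
    qed
    show "0 \<le> Re (cinner (defect x) x)" if "x \<in> M" for x
    proof -
      have "cinner (defect x) x = of_real ((norm x)\<^sup>2 - (\<Sum>k\<in>UNIV. (norm (S k x))\<^sup>2))"
        by (simp only: defect_def cinner_diff_left cinner_sum_left cinner_self of_real_diff of_real_sum
            cinner_S[OF S_M])
      then show ?thesis using S_contractive[of x] by simp
    qed
  qed simp
  then show thesis using that unfolding M_eq by blast
qed

text \<open>By \<open>sum_mdeg_Suc\<close> the sum telescopes, and \<open>T\<^sup>\<alpha> = 0\<close> in degree \<open>n\<close>.\<close>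

lemma defect_resolution:
  assumes h: "h \<in> M"
  shows "(\<Sum>\<alpha> | mdeg \<alpha> < n. (1 / da_weight \<alpha>) *\<^sub>R mpow T \<alpha> (defect (mpow S \<alpha> h))) = h"
proof -
  define f where "f \<alpha> = mpow T \<alpha> (mpow S \<alpha> h)" for \<alpha>
  define s where "s m = (\<Sum>\<alpha> | mdeg \<alpha> = m. (1 / da_weight \<alpha>) *\<^sub>R f \<alpha>)" for m
  \<comment> \<open>Commutativity absorbs \<open>T k\<close> and \<open>S k\<close> into the two
    monomials, so the subtracted terms are values of \<open>f\<close> one degree higher.\<close>
  have "mpow T \<alpha> (defect (mpow S \<alpha> h)) = f \<alpha> - (\<Sum>k\<in>UNIV. f (inc k \<alpha>))" for \<alpha>
    by (simp add: defect_def f_def module_hom.diff[OF mpow_clinear] module_hom.sum[OF mpow_clinear]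
        T_commuting S_commuting mpow_commute[OF T_commuting])
  then have "(\<Sum>\<alpha> | mdeg \<alpha> < n. (1 / da_weight \<alpha>) *\<^sub>R mpow T \<alpha> (defect (mpow S \<alpha> h))) =
      (\<Sum>m<n. s m - s (Suc m))"
    unfolding sum_mdeg_less s_def sum_mdeg_Suc by (simp add: scaleR_diff_right sum_subtractf)
  also have "\<dots> = s 0 - s n" by (rule sum_lessThan_telescope')
  also have "s n = 0" unfolding s_def f_def by (intro sum.neutral) (simp add: T_nilpotent)
  also have "s 0 = h"
  proof -
    have "{\<alpha> :: 'd \<Rightarrow> nat. mdeg \<alpha> = 0} = {\<lambda>_. 0}" by (auto simp: mdeg_def fun_eq_iff)
    then show ?thesis by (simp add: s_def f_def)
  qed
  finally show ?thesis by simp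
qed

text \<open>The operators \<open>W\<^sub>r f = f(T) d\<^sub>r\<close> intertwine the multipliers with their images under the
  calculus, and by \<open>defect_resolution\<close> they form a coisometric row; \<open>V\<^sub>r\<close> is the adjoint of \<open>W\<^sub>r\<close>.\<close>

lemma dilation:
  obtains m :: nat and d :: "nat \<Rightarrow> 'h" and V :: "nat \<Rightarrow> 'h \<Rightarrow> 'd drury_arveson"
  where "\<And>r. r < m \<Longrightarrow> d r \<in> M"
    and "\<And>r f h. r < m \<Longrightarrow> cinner (calc n T f (d r)) h = cinner f (V r h)"
    and "\<And>h. h \<in> M \<Longrightarrow> (\<Sum>r<m. calc n T (V r h) (d r)) = h"
proof -
  obtain m :: nat and d where d: "\<And>r. r < m \<Longrightarrow> d r \<in> M"
    and D: "\<And>x. x \<in> M \<Longrightarrow> defect x = (\<Sum>r<m. cinner x (d r) *\<^sub>C d r)"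
    using defect_decomposition by blast
  \<comment> \<open>Division by \<open>da_weight\<close> offsets the squared norm of the monomial in
    \<open>cinner_da_mon\<close>. Only degrees below \<open>n\<close> occur, so \<open>V r h\<close>
    is a polynomial.\<close>
  define V :: "nat \<Rightarrow> 'h \<Rightarrow> 'd drury_arveson" where
    "V r h = (\<Sum>\<alpha> | mdeg \<alpha> < n. (cinner (mpow S \<alpha> h) (d r) / of_real (da_weight \<alpha>)) *\<^sub>C da_mon \<alpha>)" for r h
  show thesis
  proof (rule that[OF d])
    fix r h and f :: "'d drury_arveson" assume r: "r < m"
    have "cinner (calc n T f (d r)) h = (\<Sum>\<alpha> | mdeg \<alpha> < n. da_coeff f \<alpha> * cinner (d r) (mpow S \<alpha> h))"
      by (simp add: calc_def cinner_sum_left cinner_scaleC_left cinner_mpow_S d r)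
    also have "\<dots> = cinner f (V r h)"
      unfolding V_def cinner_sum_right cinner_scaleC_right cinner_da_mon
    proof (intro sum.cong refl)
      fix \<alpha>
      have "cnj (cinner (mpow S \<alpha> h) (d r)) = cinner (d r) (mpow S \<alpha> h)" by (metis cinner_commute)
      then show "da_coeff f \<alpha> * cinner (d r) (mpow S \<alpha> h) =
          cnj (cinner (mpow S \<alpha> h) (d r) / of_real (da_weight \<alpha>)) * (of_real (da_weight \<alpha>) * da_coeff f \<alpha>)"
        using da_weight_pos[of \<alpha>] by simp
    qed
    finally show "cinner (calc n T f (d r)) h = cinner f (V r h)" .
  next
    fix h assume h: "h \<in> M"
    have V: "calc n T (V r h) x = (\<Sum>\<alpha> | mdeg \<alpha> < n. (1 / da_weight \<alpha>) *\<^sub>R mpow T \<alpha> (cinner (mpow S \<alpha> h) (d r) *\<^sub>C x))" for r x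
      unfolding V_def module_hom.sum[OF calc_clinear_left] module_hom.scale[OF calc_clinear_left] calc_mon
      by (intro sum.cong refl) (simp add: module_hom.scale[OF mpow_clinear] scaleC_of_real[symmetric] scaleC_scaleC)
    have "(\<Sum>r<m. calc n T (V r h) (d r)) =
        (\<Sum>\<alpha> | mdeg \<alpha> < n. (1 / da_weight \<alpha>) *\<^sub>R mpow T \<alpha> (defect (mpow S \<alpha> h)))"
      unfolding V D[OF mpow_S_M[OF h]] module_hom.sum[OF mpow_clinear] scaleR_sum_right
      by (rule sum.swap)
    then show "(\<Sum>r<m. calc n T (V r h) (d r)) = h" using defect_resolution[OF h] by simp
  qed
qed

text \<open>Since the row W is a left inverse of V on \<open>M\<close>, \<open>calc_op\<close>
  writes A(T) on \<open>M\<close> as the sum over r of \<open>W\<^sub>r A V\<^sub>r\<close>, and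
  likewise for each matrix entry. V is isometric on \<open>M\<close>, its adjoint W is contractive,
  and in between the matrix acts separately for each r.\<close>

lemma calc_matrix_contractive:
  fixes A :: "nat \<Rightarrow> nat \<Rightarrow> 'd drury_arveson \<Rightarrow> 'd drury_arveson"
  assumes A: "\<And>i j. i < N \<Longrightarrow> j < N \<Longrightarrow> A i j \<in> shift_commutant"
    and v: "\<And>j. j < N \<Longrightarrow> v j \<in> M"
  shows "(\<Sum>i<N. (norm (\<Sum>j<N. calc n T (A i j da_one) (v j)))\<^sup>2) \<le>
    (matrix_opnorm UNIV N A)\<^sup>2 * (\<Sum>j<N. (norm (v j))\<^sup>2)"
proof (rule dilation)
  fix m :: nat and d V
  assume d: "\<And>r. r < m \<Longrightarrow> d r \<in> M"
    and adj: "\<And>r f h. r < m \<Longrightarrow> cinner (calc n T f (d r)) h = cinner f (V r h)"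
    and res: "\<And>h. h \<in> M \<Longrightarrow> (\<Sum>r<m. calc n T (V r h) (d r)) = h"
  have V_norm: "(\<Sum>r<m. (norm (V r h))\<^sup>2) = (norm h)\<^sup>2" if h: "h \<in> M" for h
  proof -
    have "complex_of_real (\<Sum>r<m. (norm (V r h))\<^sup>2) = (\<Sum>r<m. cinner (calc n T (V r h) (d r)) h)"
      unfolding of_real_sum by (intro sum.cong refl) (simp add: adj cinner_self)
    also have "\<dots> = of_real ((norm h)\<^sup>2)"
      by (simp only: cinner_sum_left[symmetric] res[OF h] cinner_self)
    finally show ?thesis by (simp only: of_real_eq_iff)
  qed
  \<comment> \<open>Contractivity by duality: \<open>(norm h)\<^sup>2\<close> is a pairing of the
    \<open>f r\<close> with the \<open>V r h\<close>, whose total norm is \<open>norm h\<close> by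
    \<open>V_norm\<close>.\<close>
  have W_norm: "(norm (\<Sum>r<m. calc n T (f r) (d r)))\<^sup>2 \<le> (\<Sum>r<m. (norm (f r))\<^sup>2)" for f
  proof -
    define h where "h = (\<Sum>r<m. calc n T (f r) (d r))"
    have h: "h \<in> M" unfolding h_def using d by (intro cvs.subspace_sum csubspace_M calc_M) auto
    have "of_real ((norm h)\<^sup>2) = (\<Sum>r<m. cinner (f r) (V r h))"
    proof -
      have "cinner h h = (\<Sum>r<m. cinner (calc n T (f r) (d r)) h)"
        by (subst (1) h_def) (rule cinner_sum_left)
      also have "\<dots> = (\<Sum>r<m. cinner (f r) (V r h))" by (intro sum.cong refl adj) simp
      finally show ?thesis by (simp only: cinner_self)
    qed
    then have "(norm h)\<^sup>2 = cmod (\<Sum>r<m. cinner (f r) (V r h))"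
      by (metis abs_of_nonneg norm_of_real zero_le_power2)
    also have "\<dots> \<le> (\<Sum>r<m. norm (f r) * norm (V r h))"
      by (intro order_trans[OF norm_sum] sum_mono cinner_Cauchy_Schwarz)
    also have "\<dots> \<le> L2_set (\<lambda>r. norm (f r)) {..<m} * L2_set (\<lambda>r. norm (V r h)) {..<m}"
      using L2_set_mult_ineq[of "\<lambda>r. norm (f r)" "\<lambda>r. norm (V r h)" "{..<m}"] by simp
    also have "L2_set (\<lambda>r. norm (V r h)) {..<m} = norm h"
      unfolding L2_set_def V_norm[OF h] by simp
    finally have "norm h \<le> L2_set (\<lambda>r. norm (f r)) {..<m}"
      by (cases "h = 0") (simp_all add: power2_eq_square L2_set_nonneg)
    then have "(norm h)\<^sup>2 \<le> (L2_set (\<lambda>r. norm (f r)) {..<m})\<^sup>2" by (rule power_mono) simp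
    then show ?thesis unfolding h_def L2_set_def by (simp add: sum_nonneg)
  qed
  define c where "c = matrix_opnorm UNIV N A"
  have c: "(\<Sum>i<N. (norm (\<Sum>j<N. A i j (f j)))\<^sup>2) \<le> c\<^sup>2 * (\<Sum>j<N. (norm (f j))\<^sup>2)" for f
    unfolding c_def using A by (intro matrix_opnorm_bound(2) shift_commutant_bounded_ops) auto
  have eq: "(\<Sum>j<N. calc n T (A i j da_one) (v j)) = (\<Sum>r<m. calc n T (\<Sum>j<N. A i j (V r (v j))) (d r))"
    if i: "i < N" for i
  proof -
    have "calc n T (A i j da_one) (v j) = (\<Sum>r<m. calc n T (A i j (V r (v j))) (d r))" if j: "j < N" for j
    proof -
      have "calc n T (A i j da_one) (v j) = calc n T (A i j da_one) (\<Sum>r<m. calc n T (V r (v j)) (d r))"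
        by (simp only: res[OF v[OF j]])
      also have "\<dots> = (\<Sum>r<m. calc n T (A i j (V r (v j))) (d r))"
        unfolding module_hom.sum[OF calc_clinear] calc_op[OF A[OF i j], symmetric] ..
      finally show ?thesis .
    qed
    then have "(\<Sum>j<N. calc n T (A i j da_one) (v j)) = (\<Sum>j<N. \<Sum>r<m. calc n T (A i j (V r (v j))) (d r))"
      by (intro sum.cong refl) simp
    also have "\<dots> = (\<Sum>r<m. calc n T (\<Sum>j<N. A i j (V r (v j))) (d r))"
      unfolding module_hom.sum[OF calc_clinear_left] by (rule sum.swap)
    finally show ?thesis .
  qed
  have "(\<Sum>i<N. (norm (\<Sum>j<N. calc n T (A i j da_one) (v j)))\<^sup>2) =
      (\<Sum>i<N. (norm (\<Sum>r<m. calc n T (\<Sum>j<N. A i j (V r (v j))) (d r)))\<^sup>2)"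
    by (intro sum.cong refl) (simp add: eq)
  also have "\<dots> \<le> (\<Sum>i<N. \<Sum>r<m. (norm (\<Sum>j<N. A i j (V r (v j))))\<^sup>2)"
    by (intro sum_mono W_norm)
  also have "\<dots> = (\<Sum>r<m. \<Sum>i<N. (norm (\<Sum>j<N. A i j (V r (v j))))\<^sup>2)"
    by (rule sum.swap)
  \<comment> \<open>For each \<open>r\<close> the scalar-level matrix estimate is used at the vector
    with entries \<open>V r (v j)\<close>.\<close>
  also have "\<dots> \<le> (\<Sum>r<m. c\<^sup>2 * (\<Sum>j<N. (norm (V r (v j)))\<^sup>2))"
    by (intro sum_mono c)
  also have "\<dots> = c\<^sup>2 * (\<Sum>j<N. \<Sum>r<m. (norm (V r (v j)))\<^sup>2)"
    unfolding sum_distrib_left[symmetric] by (subst sum.swap) simp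
  also have "(\<Sum>j<N. \<Sum>r<m. (norm (V r (v j)))\<^sup>2) = (\<Sum>j<N. (norm (v j))\<^sup>2)"
    by (intro sum.cong refl V_norm v) simp
  finally show "(\<Sum>i<N. (norm (\<Sum>j<N. calc n T (A i j da_one) (v j)))\<^sup>2) \<le>
      (matrix_opnorm UNIV N A)\<^sup>2 * (\<Sum>j<N. (norm (v j))\<^sup>2)"
    unfolding c_def .
qed

end


section \<open>Existence and uniqueness of the functional calculus\<close>

context nilpotent_row_contraction
begin

text \<open>Both restrictions make the map extensional, as \<open>is_calculus\<close> requires;
  uniqueness can then be an equality of functions.\<close>

definition calculus :: "('d drury_arveson \<Rightarrow> 'd drury_arveson) \<Rightarrow> 'h \<Rightarrow> 'h" where
  "calculus = (\<lambda>A\<in>shift_commutant. restrict (calc n T (A da_one)) M)"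

lemma calculus_apply: "A \<in> shift_commutant \<Longrightarrow> x \<in> M \<Longrightarrow> calculus A x = calc n T (A da_one) x"
  by (simp add: calculus_def)

lemma calculus_bounded: "A \<in> shift_commutant \<Longrightarrow> calculus A \<in> bounded_ops M"
  by (simp add: calculus_def clinear_restrict_bounded calc_bounded_ops csubspace_M calc_M)

lemma calculus_contractive:
  assumes A: "\<And>i j. i < N \<Longrightarrow> j < N \<Longrightarrow> A i j \<in> shift_commutant"
  shows "matrix_opnorm M N (\<lambda>i j. calculus (A i j)) \<le> matrix_opnorm UNIV N A"
  unfolding matrix_opnorm_def[of M]
proof (rule cSup_least)
  have "(\<forall>j<N. (0::'h) \<in> M) \<and> (\<Sum>j<N. (norm (0::'h))\<^sup>2) \<le> 1"
    using cvs.subspace_0[OF csubspace_M] by simp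
  then show "{sqrt (\<Sum>i<N. (norm (\<Sum>j<N. calculus (A i j) (v j)))\<^sup>2) |v.
      (\<forall>j<N. v j \<in> M) \<and> (\<Sum>j<N. (norm (v j))\<^sup>2) \<le> 1} \<noteq> {}"
    by (auto intro!: exI[of _ "\<lambda>_. 0"])
next
  fix r assume "r \<in> {sqrt (\<Sum>i<N. (norm (\<Sum>j<N. calculus (A i j) (v j)))\<^sup>2) |v.
      (\<forall>j<N. v j \<in> M) \<and> (\<Sum>j<N. (norm (v j))\<^sup>2) \<le> 1}"
  then obtain v where r: "r = sqrt (\<Sum>i<N. (norm (\<Sum>j<N. calculus (A i j) (v j)))\<^sup>2)"
    and v: "\<And>j. j < N \<Longrightarrow> v j \<in> M" "(\<Sum>j<N. (norm (v j))\<^sup>2) \<le> 1" by blast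
  define c where "c = matrix_opnorm UNIV N A"
  have c: "0 \<le> c" unfolding c_def using A by (intro matrix_opnorm_bound(1) shift_commutant_bounded_ops)
  have "(\<Sum>i<N. (norm (\<Sum>j<N. calculus (A i j) (v j)))\<^sup>2) =
      (\<Sum>i<N. (norm (\<Sum>j<N. calc n T (A i j da_one) (v j)))\<^sup>2)"
    by (intro sum.cong refl arg_cong[where f = "\<lambda>x. (norm x)\<^sup>2"]) (simp add: calculus_apply A v)
  also have "\<dots> \<le> c\<^sup>2 * (\<Sum>j<N. (norm (v j))\<^sup>2)"
    unfolding c_def by (rule calc_matrix_contractive[OF A v(1)])
  also have "\<dots> \<le> c\<^sup>2 * 1" by (intro mult_left_mono v) simp
  finally have "r \<le> sqrt (c\<^sup>2)" unfolding r by (intro real_sqrt_le_mono) simp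
  then show "r \<le> matrix_opnorm UNIV N A" using c by (simp add: c_def)
qed

text \<open>The calculus sees only the coefficients of \<open>A da_one\<close> of degree below
  \<open>n\<close>. Every functional therefore pulls back to one of rank one, however long the two
  sequences are.\<close>

lemma calculus_predual:
  assumes "\<omega> \<in> predual M"
  obtains g where "\<And>A. A \<in> shift_commutant \<Longrightarrow> \<omega> (calculus A) = cinner (A da_one) g"
proof -
  obtain \<xi> \<eta> :: "nat \<Rightarrow> 'h" where \<omega>: "\<omega> = (\<lambda>A. \<Sum>i. cinner (A (\<xi> i)) (\<eta> i))"
    and \<xi>: "range \<xi> \<subseteq> M"
    and s: "summable (\<lambda>i. (norm (\<xi> i))\<^sup>2)" "summable (\<lambda>i. (norm (\<eta> i))\<^sup>2)"
    using assms unfolding predual_def by blast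
  define t where "t \<alpha> = (\<Sum>i. cinner (mpow T \<alpha> (\<xi> i)) (\<eta> i))" for \<alpha>
  have summ: "summable (\<lambda>i. cinner (mpow T \<alpha> (\<xi> i)) (\<eta> i))" for \<alpha>
  proof -
    obtain K where K: "0 \<le> K" "\<And>x. norm (mpow T \<alpha> x) \<le> K * norm x"
      using bounded_ops_UNIV_bound[OF bounded_ops_mpow[OF T_commuting T_bounded]] by blast
    show ?thesis
    proof (rule summable_comparison_test'[where N = 0])
      show "summable (\<lambda>i. K * ((norm (\<xi> i))\<^sup>2 + (norm (\<eta> i))\<^sup>2))"
        by (intro summable_mult summable_add s)
      fix i :: nat
      have "norm (\<xi> i) * norm (\<eta> i) \<le> (norm (\<xi> i))\<^sup>2 + (norm (\<eta> i))\<^sup>2"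
        using sum_squares_bound[of "norm (\<xi> i)" "norm (\<eta> i)"]
          mult_nonneg_nonneg[OF norm_ge_zero[of "\<xi> i"] norm_ge_zero[of "\<eta> i"]] by linarith
      then have "K * (norm (\<xi> i) * norm (\<eta> i)) \<le> K * ((norm (\<xi> i))\<^sup>2 + (norm (\<eta> i))\<^sup>2)"
        by (intro mult_left_mono K)
      moreover have "cmod (cinner (mpow T \<alpha> (\<xi> i)) (\<eta> i)) \<le> (K * norm (\<xi> i)) * norm (\<eta> i)"
        by (rule order_trans[OF cinner_Cauchy_Schwarz]) (intro mult_right_mono K norm_ge_zero)
      ultimately show "cmod (cinner (mpow T \<alpha> (\<xi> i)) (\<eta> i)) \<le> K * ((norm (\<xi> i))\<^sup>2 + (norm (\<eta> i))\<^sup>2)"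
        by (simp add: mult.assoc)
    qed
  qed
  \<comment> \<open>\<open>t \<alpha>\<close> is the value of the functional at a monomial in
    \<open>T\<close>; the conjugate and the weight undo those produced by the inner product with
    \<open>da_mon \<alpha>\<close>.\<close>
  define g :: "'d drury_arveson" where
    "g = (\<Sum>\<alpha> | mdeg \<alpha> < n. (cnj (t \<alpha>) / of_real (da_weight \<alpha>)) *\<^sub>C da_mon \<alpha>)"
  show thesis
  proof (rule that[of g])
    fix A :: "'d drury_arveson \<Rightarrow> 'd drury_arveson" assume A: "A \<in> shift_commutant"
    have "\<omega> (calculus A) = (\<Sum>i. \<Sum>\<alpha> | mdeg \<alpha> < n. da_coeff (A da_one) \<alpha> * cinner (mpow T \<alpha> (\<xi> i)) (\<eta> i))"
      unfolding \<omega> using \<xi>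
      by (intro suminf_cong) (simp add: calculus_apply A range_subsetD calc_def cinner_sum_left cinner_scaleC_left)
    also have "\<dots> = (\<Sum>\<alpha> | mdeg \<alpha> < n. \<Sum>i. da_coeff (A da_one) \<alpha> * cinner (mpow T \<alpha> (\<xi> i)) (\<eta> i))"
      by (intro suminf_sum summable_mult summ)
    also have "\<dots> = (\<Sum>\<alpha> | mdeg \<alpha> < n. da_coeff (A da_one) \<alpha> * t \<alpha>)"
      unfolding t_def by (intro sum.cong refl suminf_mult summ)
    also have "\<dots> = cinner (A da_one) g"
      unfolding g_def cinner_sum_right cinner_scaleC_right cinner_da_mon
      by (intro sum.cong refl) (simp add: da_weight_pos[THEN less_imp_neq, symmetric])
    finally show "\<omega> (calculus A) = cinner (A da_one) g" .
  qed
qed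

text \<open>By \<open>calculus_predual\<close> the preimage of a generating open set is again a
  generating open set, cut down to the algebra.\<close>

lemma calculus_continuous:
  "continuous_map (subtopology (weak_star UNIV) shift_commutant) (weak_star M) calculus"
  unfolding weak_star_def[of M]
proof (rule continuous_on_generated_topo)
  have sub: "(shift_commutant :: ('d drury_arveson \<Rightarrow> _) set) \<subseteq> bounded_ops UNIV"
    using shift_commutant_bounded_ops by blast
  have top: "topspace (subtopology (weak_star UNIV) shift_commutant) = (shift_commutant :: ('d drury_arveson \<Rightarrow> _) set)"
    using sub by (auto simp: topspace_weak_star)
  show "calculus ` topspace (subtopology (weak_star UNIV) shift_commutant) \<subseteq>
      \<Union> {{A \<in> bounded_ops M. \<omega> A \<in> U} |\<omega> U. \<omega> \<in> predual M \<and> open U}"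
  proof -
    have "\<Union> {{A \<in> bounded_ops M. \<omega> A \<in> U} |\<omega> U. \<omega> \<in> predual M \<and> open U} = bounded_ops M"
      using topspace_weak_star[OF csubspace_M] unfolding weak_star_def topology_generated_by_topspace .
    then show ?thesis unfolding top using calculus_bounded by auto
  qed
  fix V assume "V \<in> {{A \<in> bounded_ops M. \<omega> A \<in> U} |\<omega> U. \<omega> \<in> predual M \<and> open U}"
  then obtain \<omega> U where V: "V = {A \<in> bounded_ops M. \<omega> A \<in> U}" "\<omega> \<in> predual M" "open U" by blast
  obtain g where g: "\<And>A. A \<in> shift_commutant \<Longrightarrow> \<omega> (calculus A) = cinner (A da_one) g"
    using calculus_predual[OF V(2)] by blast
  have "calculus -` V \<inter> shift_commutant = {A \<in> bounded_ops UNIV. cinner (A da_one) g \<in> U} \<inter> shift_commutant"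
    using sub calculus_bounded g by (auto simp: V(1))
  moreover have "openin (weak_star UNIV) {A \<in> bounded_ops UNIV. cinner (A da_one) g \<in> U}"
    unfolding weak_star_def
    by (rule topology_generated_by_Basis)
      (use predual_rank_one[of da_one UNIV g] V(3) in \<open>auto intro!: exI[of _ "\<lambda>A. cinner (A da_one) g"] exI[of _ U]\<close>)
  ultimately show "openin (subtopology (weak_star UNIV) shift_commutant)
      (calculus -` V \<inter> topspace (subtopology (weak_star UNIV) shift_commutant))"
    unfolding top openin_subtopology by blast
qed

lemma is_calculus_calculus: "is_calculus M (restrict_tuple T M) calculus"
  unfolding is_calculus_def mult_algebra_eq
proof (intro conjI ballI allI impI)
  show "calculus \<in> shift_commutant \<rightarrow>\<^sub>E bounded_ops M"
    using calculus_bounded by (auto simp: calculus_def)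
  show "calculus id x = x" if "x \<in> M" for x
    using that by (simp add: calculus_apply shift_commutant_id calc_one)
  fix A B :: "'d drury_arveson \<Rightarrow> 'd drury_arveson" and x
  assume A: "A \<in> shift_commutant" and B: "B \<in> shift_commutant" and x: "x \<in> M"
  show "calculus (\<lambda>f. A f + B f) x = calculus A x + calculus B x"
    using A B x by (simp add: calculus_apply shift_commutant_add calc_add)
  show "calculus (A \<circ> B) x = calculus A (calculus B x)"
    using A B x by (simp add: calculus_apply shift_commutant_compose calc_M calc_op[OF A, of "B da_one"])
next
  fix a and A :: "'d drury_arveson \<Rightarrow> 'd drury_arveson" and x
  assume "A \<in> shift_commutant" "x \<in> M"
  then show "calculus (\<lambda>f. a *\<^sub>C A f) x = a *\<^sub>C calculus A x"
    by (simp add: calculus_apply shift_commutant_scaleC calc_scaleC)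
next
  fix N and A :: "nat \<Rightarrow> nat \<Rightarrow> 'd drury_arveson \<Rightarrow> 'd drury_arveson"
  assume "\<forall>i<N. \<forall>j<N. A i j \<in> shift_commutant"
  then show "matrix_opnorm M N (\<lambda>i j. calculus (A i j)) \<le> matrix_opnorm UNIV N A"
    by (intro calculus_contractive) blast
next
  show "continuous_map (subtopology (weak_star UNIV) shift_commutant) (weak_star M) calculus"
    by (rule calculus_continuous)
next
  fix k
  have "calc n T (shift k da_one) = T k" by (rule ext) (simp add: calc_shift calc_one)
  then show "calculus (mult_op (coord k)) = restrict_tuple T M k"
    by (simp add: mult_op_coord calculus_def shift_in_commutant restrict_tuple_def)
qed

section \<open>Uniqueness of the calculus\<close>

lemma calc_fejer_tendsto: "(\<lambda>N. calc n T (fejer N A da_one) x) \<longlonglongrightarrow> calc n T (A da_one) x"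
proof -
  have "(\<lambda>N. of_real (real (N - k) / real N) *\<^sub>C y) \<longlonglongrightarrow> y" for k :: nat and y :: 'h
  proof -
    have "(\<lambda>N. (real (N - k) / real N) *\<^sub>R y) \<longlonglongrightarrow> 1 *\<^sub>R y"
      using tendsto_Re[OF fejer_coeff_tendsto[of k]] by (intro tendsto_scaleR tendsto_const) simp
    then show ?thesis by (simp only: scaleC_of_real scaleR_one)
  qed
  then show ?thesis
    unfolding calc_def da_coeff_fejer_one scaleC_scaleC[symmetric] by (intro tendsto_sum)
qed

lemma is_calculusD:
  assumes \<Psi>: "is_calculus M (restrict_tuple T M) \<Psi>"
  shows "x \<in> M \<Longrightarrow> \<Psi> id x = x"
    and "A \<in> shift_commutant \<Longrightarrow> C \<in> shift_commutant \<Longrightarrow> x \<in> M \<Longrightarrow>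
      \<Psi> (\<lambda>f. A f + C f) x = \<Psi> A x + \<Psi> C x"
    and "A \<in> shift_commutant \<Longrightarrow> x \<in> M \<Longrightarrow> \<Psi> (\<lambda>f. a *\<^sub>C A f) x = a *\<^sub>C \<Psi> A x"
    and "A \<in> shift_commutant \<Longrightarrow> C \<in> shift_commutant \<Longrightarrow> x \<in> M \<Longrightarrow> \<Psi> (A \<circ> C) x = \<Psi> A (\<Psi> C x)"
    and "\<Psi> (shift k) = restrict (T k) M"
proof -
  note C = \<Psi>[unfolded is_calculus_def mult_algebra_eq mult_op_coord restrict_tuple_def]
  from C have 1: "\<forall>x\<in>M. \<Psi> id x = x" by (elim conjE)
  from C have 2: "\<forall>A\<in>shift_commutant. \<forall>C\<in>shift_commutant. \<forall>x\<in>M. \<Psi> (\<lambda>f. A f + C f) x = \<Psi> A x + \<Psi> C x"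
    by (elim conjE)
  from C have 3: "\<forall>a. \<forall>A\<in>shift_commutant. \<forall>x\<in>M. \<Psi> (\<lambda>f. a *\<^sub>C A f) x = a *\<^sub>C \<Psi> A x" by (elim conjE)
  from C have 4: "\<forall>A\<in>shift_commutant. \<forall>C\<in>shift_commutant. \<forall>x\<in>M. \<Psi> (A \<circ> C) x = \<Psi> A (\<Psi> C x)"
    by (elim conjE)
  from C have 5: "\<forall>k. \<Psi> (shift k) = restrict (T k) M" by (elim conjE)
  show "x \<in> M \<Longrightarrow> \<Psi> id x = x" by (rule bspec[OF 1])
  show "\<Psi> (\<lambda>f. A f + C f) x = \<Psi> A x + \<Psi> C x"
    if "A \<in> shift_commutant" "C \<in> shift_commutant" "x \<in> M"
    by (rule 2[THEN bspec, OF that(1), THEN bspec, OF that(2), THEN bspec, OF that(3)])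
  show "\<Psi> (\<lambda>f. a *\<^sub>C A f) x = a *\<^sub>C \<Psi> A x" if "A \<in> shift_commutant" "x \<in> M"
    by (rule 3[THEN spec, THEN bspec, OF that(1), THEN bspec, OF that(2)])
  show "\<Psi> (A \<circ> C) x = \<Psi> A (\<Psi> C x)"
    if "A \<in> shift_commutant" "C \<in> shift_commutant" "x \<in> M"
    by (rule 4[THEN bspec, OF that(1), THEN bspec, OF that(2), THEN bspec, OF that(3)])
  show "\<Psi> (shift k) = restrict (T k) M" by (rule spec[OF 5])
qed

lemma is_calculus_mpow_shift:
  assumes \<Psi>: "is_calculus M (restrict_tuple T M) \<Psi>" and x: "x \<in> M"
  shows "\<Psi> (mpow shift \<alpha>) x = mpow T \<alpha> x"
  using x
proof (induction \<alpha> rule: mindex_induct)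
  case zero
  have "mpow shift (\<lambda>_. 0) = (id :: 'd drury_arveson \<Rightarrow> _)" by (rule ext) simp
  then show ?case using is_calculusD(1)[OF \<Psi> zero] by (simp only: mpow_zero)
next
  case (inc k \<alpha>)
  have comp: "mpow shift (inc k \<alpha>) = shift k \<circ> mpow shift \<alpha>" by (rule ext) (simp add: commuting_shift)
  have "\<Psi> (mpow shift (inc k \<alpha>)) x = \<Psi> (shift k) (\<Psi> (mpow shift \<alpha>) x)"
    unfolding comp by (rule is_calculusD(4)[OF \<Psi> shift_in_commutant mpow_shift_in_commutant inc.prems])
  also have "\<dots> = \<Psi> (shift k) (mpow T \<alpha> x)" using inc by simp
  also have "\<Psi> (shift k) = restrict (T k) M" by (rule is_calculusD(5)[OF \<Psi>])
  finally show ?case using inc.prems by (simp add: mpow_M T_commuting)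
qed

lemma is_calculus_sum:
  assumes \<Psi>: "is_calculus M (restrict_tuple T M) \<Psi>" and x: "x \<in> M" and "finite I"
    and "\<And>i. i \<in> I \<Longrightarrow> A i \<in> shift_commutant"
  shows "\<Psi> (\<lambda>f. \<Sum>i\<in>I. a i *\<^sub>C A i f) x = (\<Sum>i\<in>I. a i *\<^sub>C \<Psi> (A i) x)"
  using assms(3,4)
proof (induction I rule: finite_induct)
  case empty
  \<comment> \<open>The empty sum is written as a multiple of \<open>id\<close>, so that homogeneity
    of \<open>\<Psi>\<close> gives its value.\<close>
  have "\<Psi> (\<lambda>f. 0 *\<^sub>C id f) x = 0 *\<^sub>C \<Psi> id x"
    by (rule is_calculusD(3)[OF \<Psi> shift_commutant_id x])
  then show ?case by simp
next
  case (insert i I)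
  have A: "(\<lambda>f. a i *\<^sub>C A i f) \<in> shift_commutant" "(\<lambda>f. \<Sum>i\<in>I. a i *\<^sub>C A i f) \<in> shift_commutant"
    using insert.prems by (auto intro!: shift_commutant_scaleC shift_commutant_sum)
  have "\<Psi> (\<lambda>f. a i *\<^sub>C A i f + (\<Sum>i\<in>I. a i *\<^sub>C A i f)) x =
      \<Psi> (\<lambda>f. a i *\<^sub>C A i f) x + \<Psi> (\<lambda>f. \<Sum>i\<in>I. a i *\<^sub>C A i f) x"
    by (rule is_calculusD(2)[OF \<Psi> A x])
  also have "\<Psi> (\<lambda>f. a i *\<^sub>C A i f) x = a i *\<^sub>C \<Psi> (A i) x"
    using insert.prems by (intro is_calculusD(3)[OF \<Psi> _ x]) simp
  also have "\<Psi> (\<lambda>f. \<Sum>i\<in>I. a i *\<^sub>C A i f) x = (\<Sum>i\<in>I. a i *\<^sub>C \<Psi> (A i) x)"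
    using insert.prems by (intro insert.IH) auto
  finally show ?case using insert.hyps by simp
qed

lemma is_calculus_fejer:
  assumes \<Psi>: "is_calculus M (restrict_tuple T M) \<Psi>" and x: "x \<in> M"
  shows "\<Psi> (fejer N A) x = calc n T (fejer N A da_one) x"
proof -
  define c where "c \<alpha> = of_real (real (N - mdeg \<alpha>) / real N) * da_coeff (A da_one) \<alpha>" for \<alpha> :: "'d \<Rightarrow> nat"
  have "fejer N A = (\<lambda>f. \<Sum>\<alpha> | mdeg \<alpha> < N. c \<alpha> *\<^sub>C mpow shift \<alpha> f)"
    unfolding c_def by (rule ext) (rule fejer_def)
  then have "\<Psi> (fejer N A) x = (\<Sum>\<alpha> | mdeg \<alpha> < N. c \<alpha> *\<^sub>C \<Psi> (mpow shift \<alpha>) x)"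
    using is_calculus_sum[OF \<Psi> x finite_mdeg_less mpow_shift_in_commutant] by simp
  also have "\<dots> = (\<Sum>\<alpha> | mdeg \<alpha> < N. c \<alpha> *\<^sub>C mpow T \<alpha> x)"
    by (simp add: is_calculus_mpow_shift[OF \<Psi> x])
  \<comment> \<open>The two cut-offs are compared through the union: \<open>c \<alpha>\<close> is 0
    from degree \<open>N\<close> on, and the monomial in \<open>T\<close> is 0 from degree
    \<open>n\<close> on.\<close>
  also have "\<dots> = (\<Sum>\<alpha>\<in>{\<alpha>. mdeg \<alpha> < N} \<union> {\<alpha>. mdeg \<alpha> < n}. c \<alpha> *\<^sub>C mpow T \<alpha> x)"
    by (rule sum.mono_neutral_left) (auto simp: finite_mdeg_less c_def)
  also have "\<dots> = (\<Sum>\<alpha> | mdeg \<alpha> < n. c \<alpha> *\<^sub>C mpow T \<alpha> x)"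
    by (rule sum.mono_neutral_right) (auto simp: finite_mdeg_less T_nilpotent)
  also have "\<dots> = calc n T (fejer N A da_one) x"
    unfolding calc_def da_coeff_fejer_one c_def ..
  finally show ?thesis .
qed

text \<open>On the algebra, the limit of the images of the Fejer means is identified through the
  functionals \<open>cinner (_ x) y\<close> with \<open>x\<close> and \<open>y\<close> in
  \<open>M\<close>, which separate operators on \<open>M\<close>. Off the algebra both maps are
  \<open>undefined\<close>.\<close>

lemma is_calculus_unique:
  assumes \<Psi>: "is_calculus M (restrict_tuple T M) \<Psi>"
  shows "\<Psi> = calculus"
proof
  fix A :: "'d drury_arveson \<Rightarrow> 'd drury_arveson"
  have ext: "\<Psi> \<in> shift_commutant \<rightarrow>\<^sub>E bounded_ops M"
    using \<Psi> unfolding is_calculus_def mult_algebra_eq by blast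
  show "\<Psi> A = calculus A"
  proof (cases "A \<in> shift_commutant")
    case False
    then show ?thesis using ext by (auto simp: calculus_def)
  next
    case A: True
    have "\<Psi> A \<in> bounded_ops M" using ext A by auto
    then have \<Psi>A: "\<Psi> A \<in> M \<rightarrow>\<^sub>E M" by (simp add: bounded_ops_def)
    have "continuous_map (subtopology (weak_star UNIV) shift_commutant) (weak_star M) \<Psi>"
      using \<Psi> unfolding is_calculus_def mult_algebra_eq by blast
    from continuous_map_limit[OF this fejer_weak_star_limit[OF A]]
    have lim: "limitin (weak_star M) (\<Psi> \<circ> (\<lambda>N. fejer N A)) (\<Psi> A) sequentially" .
    have "\<Psi> A x = calc n T (A da_one) x" if x: "x \<in> M" for x
    proof (rule eq_by_cinner_M)
      show "\<Psi> A x \<in> M" using \<Psi>A x by auto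
      show "calc n T (A da_one) x \<in> M" using x by (rule calc_M)
      fix y assume y: "y \<in> M"
      have "(\<lambda>N. cinner (\<Psi> (fejer N A) x) y) \<longlonglongrightarrow> cinner (\<Psi> A x) y"
      proof (rule topological_tendstoI)
        fix U assume U: "open U" "cinner (\<Psi> A x) y \<in> U"
        have "openin (weak_star M) {B \<in> bounded_ops M. cinner (B x) y \<in> U}"
          unfolding weak_star_def
          by (rule topology_generated_by_Basis)
            (use predual_rank_one[OF x y cvs.subspace_0[OF csubspace_M]] U(1) in
              \<open>auto intro!: exI[of _ "\<lambda>A. cinner (A x) y"] exI[of _ U]\<close>)
        from limitinD[OF lim this] U(2) \<open>\<Psi> A \<in> bounded_ops M\<close>
        have "\<forall>\<^sub>F N in sequentially. (\<Psi> \<circ> (\<lambda>N. fejer N A)) N \<in> {B \<in> bounded_ops M. cinner (B x) y \<in> U}"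
          by blast
        then show "\<forall>\<^sub>F N in sequentially. cinner (\<Psi> (fejer N A) x) y \<in> U"
          by eventually_elim simp
      qed
      moreover have "(\<lambda>N. cinner (\<Psi> (fejer N A) x) y) \<longlonglongrightarrow> cinner (calc n T (A da_one) x) y"
        unfolding is_calculus_fejer[OF \<Psi> x]
        by (rule bounded_linear.tendsto[OF bounded_linear_cinner_left calc_fejer_tendsto])
      ultimately have "cinner (\<Psi> A x) y = cinner (calc n T (A da_one) x) y"
        by (rule LIMSEQ_unique)
      then show "cinner y (\<Psi> A x) = cinner y (calc n T (A da_one) x)"
        by (metis cinner_commute)
    qed
    then have "restrict (\<Psi> A) M = restrict (calc n T (A da_one)) M" by (rule restrict_ext)
    moreover have "restrict (\<Psi> A) M = \<Psi> A" using \<Psi>A by (metis PiE_restrict)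
    ultimately show ?thesis using A by (simp add: calculus_def)
  qed
qed

lemma fun_calc_eq: "fun_calc M (restrict_tuple T M) \<phi> = calculus (mult_op \<phi>)"
proof -
  have "(THE \<Phi>. is_calculus M (restrict_tuple T M) \<Phi>) = calculus"
  proof (rule the_equality)
    show "is_calculus M (restrict_tuple T M) calculus" by (rule is_calculus_calculus)
  qed (rule is_calculus_unique)
  then show ?thesis by (simp add: fun_calc_def)
qed

text \<open>Turns the annihilator into a condition on the coefficients of
  \<open>mult_op \<phi> da_one\<close> of degree below \<open>n\<close>; what remains after this is
  linear algebra.\<close>

lemma Ann_c_eq:
  "Ann_c M (restrict_tuple T M) =
    {\<phi> \<in> multipliers. \<forall>x\<in>M. calc n T (mult_op \<phi> da_one) x = 0}"
proof -
  have "mult_op \<phi> \<in> shift_commutant" if "\<phi> \<in> multipliers" for \<phi> :: "complex ^ 'd \<Rightarrow> complex"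
    using that mult_algebra_eq by blast
  then show ?thesis unfolding Ann_c_def fun_calc_eq by (auto simp: calculus_apply)
qed

end


section \<open>Invariant subspaces\<close>

lemma mpow_factor_funpow:
  assumes "commuting T" "m \<le> \<alpha> k"
  shows "\<exists>y. mpow T \<alpha> x = (T k ^^ m) y"
  using assms(2)
proof (induction m arbitrary: \<alpha>)
  case 0
  then show ?case by simp
next
  case (Suc m)
  then have "\<alpha> \<in> range (inc k)" by (simp add: range_inc)
  then obtain \<beta> where \<beta>: "\<alpha> = inc k \<beta>" by blast
  with Suc.prems have "m \<le> \<beta> k" by (simp add: inc_def)
  then obtain y where "mpow T \<beta> x = (T k ^^ m) y" using Suc.IH[of \<beta>] by blast
  then show ?case using assms(1) by (auto simp: \<beta>)
qed

text \<open>Pigeonhole: if the degree exceeds the sum of the orders \<open>m k\<close>, some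
  exponent reaches its order. The successor also makes \<open>n\<close> positive, so that the index
  0 has degree below \<open>n\<close>.\<close>

lemma nilpotent_tuple_mpow_zero:
  fixes T :: "'d::finite \<Rightarrow> 'h::chilbert_space \<Rightarrow> 'h"
  assumes "commuting T" "nilpotent_tuple T"
  obtains n where "0 < n" "\<And>\<alpha> x. n \<le> mdeg \<alpha> \<Longrightarrow> mpow T \<alpha> x = 0"
proof -
  obtain m where m: "\<And>k. T k ^^ m k = (\<lambda>_. 0)"
    using assms(2) unfolding nilpotent_tuple_def by metis
  have "mpow T \<alpha> x = 0" if "Suc (mdeg m) \<le> mdeg \<alpha>" for \<alpha> x
  proof -
    have "\<exists>k. m k \<le> \<alpha> k"
    proof (rule ccontr)
      assume "\<nexists>k. m k \<le> \<alpha> k"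
      then have "mdeg \<alpha> \<le> mdeg m" unfolding mdeg_def by (intro sum_mono) (auto simp: not_le less_imp_le)
      with that show False by simp
    qed
    then obtain k where "m k \<le> \<alpha> k" by blast
    then obtain y where "mpow T \<alpha> x = (T k ^^ m k) y"
      using mpow_factor_funpow[OF assms(1), of "m k" \<alpha> k x] by blast
    then show ?thesis by (simp add: m)
  qed
  then show thesis using that[of "Suc (mdeg m)"] by blast
qed

text \<open>\<open>g\<close> may take the same value at several indices, hence coefficients indexed
  by \<open>F\<close> rather than by the image.\<close>

lemma cspan_image_finite:
  assumes "finite F" "y \<in> cspan (g ` F)"
  shows "\<exists>a. y = (\<Sum>\<alpha>\<in>F. a \<alpha> *\<^sub>C g \<alpha>)"
  using assms(2)
proof (induction rule: cvs.span_induct_alt)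
  case base
  show ?case by (rule exI[of _ "\<lambda>_. 0"]) simp
next
  case (step c x y)
  then obtain a \<beta> where a: "y = (\<Sum>\<alpha>\<in>F. a \<alpha> *\<^sub>C g \<alpha>)" and \<beta>: "\<beta> \<in> F" "x = g \<beta>" by blast
  have "(\<Sum>\<alpha>\<in>F. (a \<alpha> + (if \<alpha> = \<beta> then c else 0)) *\<^sub>C g \<alpha>) =
      (\<Sum>\<alpha>\<in>F. a \<alpha> *\<^sub>C g \<alpha>) + (\<Sum>\<alpha>\<in>F. if \<alpha> = \<beta> then c *\<^sub>C g \<alpha> else 0)"
    unfolding sum.distrib[symmetric] by (intro sum.cong refl) (simp add: scaleC_add_left)
  then have "c *\<^sub>C x + y = (\<Sum>\<alpha>\<in>F. (a \<alpha> + (if \<alpha> = \<beta> then c else 0)) *\<^sub>C g \<alpha>)"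
    using assms(1) by (simp add: a \<beta> add.commute)
  then show ?case by (rule exI[of _ "\<lambda>\<alpha>. a \<alpha> + (if \<alpha> = \<beta> then c else 0)"])
qed

text \<open>By commutativity words collapse to monomials, and those of degree at least
  \<open>n\<close> vanish. The orbit has a finite-dimensional span, which is closed, so the closure
  in \<open>cyclic_tuple\<close> disappears.\<close>

lemma cyclic_nilpotent_span:
  fixes T :: "'d::finite \<Rightarrow> 'h::chilbert_space \<Rightarrow> 'h"
  assumes "commuting T" "cyclic_tuple T" "\<And>\<alpha> x. n \<le> mdeg \<alpha> \<Longrightarrow> mpow T \<alpha> x = 0"
  obtains \<xi> where "cspan ((\<lambda>\<alpha>. mpow T \<alpha> \<xi>) ` {\<alpha>. mdeg \<alpha> < n}) = UNIV"
proof -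
  obtain \<xi> where \<xi>: "closure (cspan (range (\<lambda>w. word_op T w \<xi>))) = UNIV"
    using assms(2) unfolding cyclic_tuple_def by blast
  define G where "G = (\<lambda>\<alpha>. mpow T \<alpha> \<xi>) ` {\<alpha>. mdeg \<alpha> < n}"
  have "\<exists>\<alpha>. word_op T w \<xi> = mpow T \<alpha> \<xi>" for w
  proof (induction w)
    case Nil
    have "word_op T [] \<xi> = mpow T (\<lambda>_. 0) \<xi>" by (simp add: word_op_def)
    then show ?case by blast
  next
    case (Cons k w)
    then obtain \<alpha> where "word_op T w \<xi> = mpow T \<alpha> \<xi>" by blast
    then have "word_op T (k # w) \<xi> = mpow T (inc k \<alpha>) \<xi>"
      using assms(1) by (simp add: word_op_def)
    then show ?case by blast
  qed
  moreover have "mpow T \<alpha> \<xi> \<in> cspan G" for \<alpha>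
  proof (cases "mdeg \<alpha> < n")
    case True
    then show ?thesis unfolding G_def by (intro cvs.span_base) blast
  next
    case False
    then show ?thesis using assms(3)[of \<alpha> \<xi>] by (simp add: cvs.span_zero)
  qed
  ultimately have "range (\<lambda>w. word_op T w \<xi>) \<subseteq> cspan G" by (metis image_subsetI)
  then have "cspan (range (\<lambda>w. word_op T w \<xi>)) \<subseteq> cspan G"
    by (rule cvs.span_minimal) simp
  then have "closure (cspan (range (\<lambda>w. word_op T w \<xi>))) \<subseteq> cspan G"
    using closure_mono closed_cspan_finite[of G] by (metis G_def finite_imageI finite_mdeg_less)
  then have "cspan G = UNIV" unfolding \<xi> by blast
  then show thesis unfolding G_def by (rule that)
qed

section \<open>Adjoint monomials and the two annihilator arguments\<close>

lemma cinner_mpow_cadjoint: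
  assumes "\<And>k. T k \<in> bounded_ops UNIV" "commuting T"
  shows "commuting (\<lambda>k. cadjoint (T k))"
    and "cinner (mpow T \<alpha> x) y = cinner x (mpow (\<lambda>k. cadjoint (T k)) \<alpha> y)"
proof -
  show com: "commuting (\<lambda>k. cadjoint (T k))"
    unfolding commuting_def
  proof (intro allI ext)
    fix j k y
    have "cinner z (cadjoint (T j) (cadjoint (T k) y)) = cinner z (cadjoint (T k) (cadjoint (T j) y))" for z
      using commutingD[OF assms(2), of j k z] by (simp add: cinner_cadjoint[OF assms(1), symmetric])
    then have "cnj (cinner z (cadjoint (T j) (cadjoint (T k) y))) = cnj (cinner z (cadjoint (T k) (cadjoint (T j) y)))" for z
      by simp
    then have "cadjoint (T j) (cadjoint (T k) y) = cadjoint (T k) (cadjoint (T j) y)"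
      unfolding cinner_commute[symmetric] by (rule cinner_eqI)
    then show "(cadjoint (T j) \<circ> cadjoint (T k)) y = (cadjoint (T k) \<circ> cadjoint (T j)) y" by simp
  qed
  show "cinner (mpow T \<alpha> x) y = cinner x (mpow (\<lambda>k. cadjoint (T k)) \<alpha> y)"
  proof (induction \<alpha> arbitrary: y rule: mindex_induct)
    case (inc k \<alpha>)
    then show ?case
      using mpow_commute[OF com, of k \<alpha> y]
      by (simp add: assms(2) com cinner_cadjoint[OF assms(1)])
  qed simp
qed

lemma commutant_multiplier:
  assumes "A \<in> shift_commutant" obtains \<phi> where "\<phi> \<in> multipliers" "mult_op \<phi> = A"
proof -
  have "A \<in> mult_algebra" using assms by (simp only: mult_algebra_eq)
  then show thesis
  proof (rule imageE)
    fix \<phi> assume "A = mult_op \<phi>" "\<phi> \<in> multipliers"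
    then show thesis by (intro that[of \<phi>]) simp_all
  qed
qed

text \<open>The component \<open>y\<close> of \<open>x\<close> orthogonal to \<open>N\<close> is the
  adjoint of a polynomial in \<open>T\<close> applied to \<xi>. That polynomial annihilates
  \<open>N\<close>, hence also \<open>M\<close>, and so \<open>x\<close> is orthogonal to
  \<open>y\<close>, which forces \<open>y = 0\<close>. Exchanging the subspaces gives
  equality.\<close>

lemma Ann_c_eq_imp_subset:
  fixes T :: "'d::finite \<Rightarrow> 'h::chilbert_space \<Rightarrow> 'h"
  assumes "nilpotent_row_contraction T n M B" "nilpotent_row_contraction T n N C"
    and Ann: "Ann_c M (restrict_tuple T M) = Ann_c N (restrict_tuple T N)"
    and span: "cspan ((\<lambda>\<alpha>. mpow (\<lambda>k. cadjoint (T k)) \<alpha> \<xi>) ` {\<alpha>. mdeg \<alpha> < n}) = UNIV"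
  shows "M \<subseteq> N"
proof
  interpret M: nilpotent_row_contraction T n M B by fact
  interpret N: nilpotent_row_contraction T n N C by fact
  define R where "R k = cadjoint (T k)" for k
  have adj: "cinner (mpow T \<alpha> x) y = cinner x (mpow R \<alpha> y)" for \<alpha> x y
    unfolding R_def by (rule cinner_mpow_cadjoint(2)[OF M.T_bounded M.T_commuting])
  fix x assume x: "x \<in> M"
  obtain p where p: "p \<in> N" "\<And>z. z \<in> N \<Longrightarrow> cinner (x - p) z = 0"
    using ex_projection_cspan[OF N.finite_B] unfolding N.M_eq by blast
  define y where "y = x - p"
  have y: "cinner z y = 0" if "z \<in> N" for z
    using p(2)[OF that] by (metis cinner_commute complex_cnj_zero y_def)
  have span_R: "cspan ((\<lambda>\<alpha>. mpow R \<alpha> \<xi>) ` {\<alpha>. mdeg \<alpha> < n}) = UNIV"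
    using span by (simp only: R_def[abs_def])
  then have "y \<in> cspan ((\<lambda>\<alpha>. mpow R \<alpha> \<xi>) ` {\<alpha>. mdeg \<alpha> < n})" by (simp only: UNIV_I)
  from cspan_image_finite[OF finite_mdeg_less this]
  obtain a where a: "y = (\<Sum>\<alpha> | mdeg \<alpha> < n. a \<alpha> *\<^sub>C mpow R \<alpha> \<xi>)" by blast
  \<comment> \<open>The coefficients are conjugated because \<open>cinner\<close> is
    conjugate-linear in its second argument; pairing with \<open>y\<close> then becomes pairing with
    \<xi>.\<close>
  define A :: "'d drury_arveson \<Rightarrow> 'd drury_arveson" where
    "A f = (\<Sum>\<alpha> | mdeg \<alpha> < n. cnj (a \<alpha>) *\<^sub>C mpow shift \<alpha> f)" for f
  have A: "A \<in> shift_commutant"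
    unfolding A_def[abs_def] by (intro shift_commutant_sum shift_commutant_scaleC mpow_shift_in_commutant)
  have calcA: "calc n T (A da_one) z = (\<Sum>\<alpha> | mdeg \<alpha> < n. cnj (a \<alpha>) *\<^sub>C mpow T \<alpha> z)" for z
    unfolding A_def module_hom.sum[OF M.calc_clinear_left] module_hom.scale[OF M.calc_clinear_left]
    by (simp add: mpow_shift_one M.calc_mon)
  have Ay: "cinner (calc n T (A da_one) z) \<xi> = cinner z y" for z
    by (simp add: calcA a cinner_sum_left cinner_sum_right cinner_scaleC_left cinner_scaleC_right adj)
  have "calc n T (A da_one) z = 0" if z: "z \<in> N" for z
  proof -
    define w where "w = calc n T (A da_one) z"
    \<comment> \<open>Moved to the left, the adjoint monomial becomes a monomial in
      \<open>T\<close>, which commutes with the calculus and maps \<open>z\<close> into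
      \<open>N\<close>, where pairing with \<open>y\<close> gives 0.\<close>
    have "cinner w b = 0" if b: "b \<in> (\<lambda>\<alpha>. mpow R \<alpha> \<xi>) ` {\<alpha>. mdeg \<alpha> < n}" for b
    proof -
      obtain \<beta> where "b = mpow R \<beta> \<xi>" using b by blast
      then have "cinner w b = cinner (mpow T \<beta> w) \<xi>" by (simp add: adj)
      also have "\<dots> = cinner (mpow T \<beta> z) y" unfolding w_def M.calc_mpow[symmetric] by (rule Ay)
      finally show ?thesis using y[OF N.mpow_M[OF z]] by simp
    qed
    moreover have "w \<in> cspan ((\<lambda>\<alpha>. mpow R \<alpha> \<xi>) ` {\<alpha>. mdeg \<alpha> < n})"
      unfolding span_R by (rule UNIV_I)
    ultimately have "cinner w w = 0" by (rule cinner_zero_on_cspan)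
    then show ?thesis by (simp add: cinner_self w_def)
  qed
  moreover obtain \<phi> where "\<phi> \<in> multipliers" "mult_op \<phi> = A" using commutant_multiplier[OF A] .
  ultimately have "calc n T (A da_one) x = 0"
    using Ann x unfolding M.Ann_c_eq N.Ann_c_eq by blast
  then have "cinner x y = 0" using Ay[of x] by simp
  then have "cinner y y = 0" using y[OF p(1)] by (simp add: y_def cinner_diff_left)
  then show "x \<in> N" using p(1) by (simp add: cinner_self y_def)
qed

lemma Ann_c_eq_imp_UNIV:
  fixes T :: "'d::finite \<Rightarrow> 'h::chilbert_space \<Rightarrow> 'h"
  assumes "nilpotent_row_contraction T n M B" "nilpotent_row_contraction T n UNIV C"
    and Ann: "Ann_c M (restrict_tuple T M) = Ann_c UNIV (restrict_tuple T UNIV)"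
    and "0 < n" and span: "cspan ((\<lambda>\<alpha>. mpow T \<alpha> \<xi>) ` {\<alpha>. mdeg \<alpha> < n}) = UNIV"
  shows "M = UNIV"
proof -
  interpret M: nilpotent_row_contraction T n M B by fact
  interpret H: nilpotent_row_contraction T n UNIV C by fact
  have subM: "csubspace M" by (rule M.csubspace_M)
  define F where "F = {\<alpha> :: 'd \<Rightarrow> nat. mdeg \<alpha> < n}"
  have F: "finite F" "(\<lambda>_. 0) \<in> F" unfolding F_def using \<open>0 < n\<close> by (simp_all add: finite_mdeg_less)
  have expand: "mpow T \<alpha> (\<Sum>\<beta>\<in>F. a \<beta> *\<^sub>C mpow T \<beta> \<xi>) =
      a (\<lambda>_. 0) *\<^sub>C mpow T \<alpha> \<xi> + (\<Sum>\<beta>\<in>F - {\<lambda>_. 0}. a \<beta> *\<^sub>C mpow T (\<lambda>i. \<alpha> i + \<beta> i) \<xi>)" for \<alpha> a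
    using F by (simp add: sum.remove[of F "\<lambda>_. 0"] module_hom.add[OF M.mpow_clinear]
        module_hom.sum[OF M.mpow_clinear] module_hom.scale[OF M.mpow_clinear] mpow_add[OF M.T_commuting])
  have deg: "mdeg \<alpha> < mdeg (\<lambda>i. \<alpha> i + \<beta> i)" if \<beta>: "\<beta> \<noteq> (\<lambda>_. 0)" for \<alpha> \<beta> :: "'d \<Rightarrow> nat"
  proof -
    obtain i where "\<beta> i \<noteq> 0" using \<beta> by (auto simp: fun_eq_iff)
    then have "mdeg \<beta> \<noteq> 0" using le_mdeg[of \<beta> i] by simp
    moreover have "mdeg (\<lambda>i. \<alpha> i + \<beta> i) = mdeg \<alpha> + mdeg \<beta>" by (simp add: mdeg_def sum.distrib)
    ultimately show ?thesis by simp
  qed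
  have "\<xi> \<in> M"
  proof (rule ccontr)
    assume "\<xi> \<notin> M"
    then have "\<xi> \<noteq> 0" using cvs.subspace_0[OF subM] by blast
    \<comment> \<open>With a nonzero constant coefficient, induction on \<open>j\<close> descends
      from the top degree: all terms of \<open>expand\<close> but the first have larger degree and
      lie in \<open>M\<close>, so the first does too. At \<open>j = n\<close> this reaches \<xi>
      itself.\<close>
    have zero: "a (\<lambda>_. 0) = 0" if aM: "(\<Sum>\<beta>\<in>F. a \<beta> *\<^sub>C mpow T \<beta> \<xi>) \<in> M" for a
    proof (rule ccontr)
      assume a0: "a (\<lambda>_. 0) \<noteq> 0"
      have "mpow T \<alpha> \<xi> \<in> M" if "n - j \<le> mdeg \<alpha>" for j \<alpha>
        using that
      proof (induction j arbitrary: \<alpha>)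
        case 0
        then show ?case using M.T_nilpotent cvs.subspace_0[OF subM] by simp
      next
        case (Suc j)
        have "(\<Sum>\<beta>\<in>F - {\<lambda>_. 0}. a \<beta> *\<^sub>C mpow T (\<lambda>i. \<alpha> i + \<beta> i) \<xi>) \<in> M"
        proof (intro cvs.subspace_sum[OF subM] cvs.subspace_scale[OF subM] Suc.IH)
          fix \<beta> assume "\<beta> \<in> F - {\<lambda>_. 0}"
          then show "n - j \<le> mdeg (\<lambda>i. \<alpha> i + \<beta> i)" using deg[of \<beta> \<alpha>] Suc.prems by simp
        qed
        from cvs.subspace_diff[OF subM M.mpow_M[OF aM, of \<alpha>] this]
        have "a (\<lambda>_. 0) *\<^sub>C mpow T \<alpha> \<xi> \<in> M" unfolding expand by simp
        from cvs.subspace_scale[OF subM this, of "inverse (a (\<lambda>_. 0))"]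
        show ?case using a0 by (simp add: scaleC_scaleC)
      qed
      from this[of n "\<lambda>_. 0"] show False using \<open>\<xi> \<notin> M\<close> by simp
    qed
    \<comment> \<open>The exponents not killing \<xi>; \<open>E\<close> contains the zero index and
      is finite, so it has an element of maximal degree.\<close>
    define E where "E = {\<alpha>. mpow T \<alpha> \<xi> \<noteq> 0}"
    have "E \<subseteq> F" unfolding E_def F_def using M.T_nilpotent by (force simp: not_less[symmetric])
    then have E: "finite E" using F(1) by (rule finite_subset)
    have "(\<lambda>_. 0) \<in> E" using \<open>\<xi> \<noteq> 0\<close> by (simp add: E_def)
    then have "Max (mdeg ` E) \<in> mdeg ` E" using E by (intro Max_in) auto
    then obtain \<alpha> where \<alpha>: "\<alpha> \<in> E" "mdeg \<alpha> = Max (mdeg ` E)" by auto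
    have top: "mpow T \<beta> \<xi> = 0" if "mdeg \<alpha> < mdeg \<beta>" for \<beta>
    proof (rule ccontr)
      assume "mpow T \<beta> \<xi> \<noteq> 0"
      then have "mdeg \<beta> \<le> Max (mdeg ` E)" using E by (intro Max_ge) (auto simp: E_def)
      with that \<alpha>(2) show False by simp
    qed
    have calc: "calc n T (mpow shift \<alpha> da_one) x = mpow T \<alpha> x" for x
      by (simp add: mpow_shift_one M.calc_mon)
    have "mpow T \<alpha> x = 0" if x: "x \<in> M" for x
    proof -
      have "x \<in> cspan ((\<lambda>\<alpha>. mpow T \<alpha> \<xi>) ` F)" using span by (simp add: F_def)
      from cspan_image_finite[OF F(1) this]
      obtain a where a: "x = (\<Sum>\<beta>\<in>F. a \<beta> *\<^sub>C mpow T \<beta> \<xi>)" by blast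
      then have "a (\<lambda>_. 0) = 0" using zero x by blast
      \<comment> \<open>The constant coefficient is 0, and every other term has degree above that of
        \<open>\<alpha>\<close>.\<close>
      then show ?thesis unfolding a expand using top deg by simp
    qed
    moreover obtain \<phi> where \<phi>: "\<phi> \<in> multipliers" "mult_op \<phi> = mpow shift \<alpha>"
      using commutant_multiplier[OF mpow_shift_in_commutant] .
    ultimately have "\<phi> \<in> Ann_c M (restrict_tuple T M)"
      unfolding M.Ann_c_eq by (simp add: calc)
    then have "\<phi> \<in> Ann_c UNIV (restrict_tuple T UNIV)" by (simp only: Ann)
    then have "mpow T \<alpha> \<xi> = 0" unfolding H.Ann_c_eq by (simp add: \<phi> calc)
    then show False using \<alpha>(1) by (simp add: E_def)
  qed
  then have "(\<lambda>\<alpha>. mpow T \<alpha> \<xi>) ` {\<alpha>. mdeg \<alpha> < n} \<subseteq> M" using M.mpow_M by blast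
  then have "cspan ((\<lambda>\<alpha>. mpow T \<alpha> \<xi>) ` {\<alpha>. mdeg \<alpha> < n}) \<subseteq> M" using subM by (rule cvs.span_minimal)
  then show ?thesis using span by blast
qed

theorem theorem1p2:
  fixes T :: "'d::finite \<Rightarrow> 'h::chilbert_space \<Rightarrow> 'h"
  assumes "\<forall>k. T k \<in> bounded_ops UNIV"
    and "commuting T"
    and "row_contraction T"
    and "nilpotent_tuple T"
  shows "(cyclic_tuple (\<lambda>k. cadjoint (T k)) \<longrightarrow>
            (\<forall>M N. invariant_subspace T M \<and> invariant_subspace T N \<and>
                   Ann_c M (restrict_tuple T M) = Ann_c N (restrict_tuple T N) \<longrightarrow> M = N)) \<and>
         (cyclic_tuple T \<longrightarrow>
            (\<forall>M. invariant_subspace T M \<and>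
                 Ann_c M (restrict_tuple T M) = Ann_c UNIV T \<longrightarrow> M = UNIV))"
proof -
  have bounded: "T k \<in> bounded_ops UNIV" for k using assms(1) by blast
  obtain n where n: "0 < n" "\<And>\<alpha> x. n \<le> mdeg \<alpha> \<Longrightarrow> mpow T \<alpha> x = 0"
    using nilpotent_tuple_mpow_zero[OF assms(2,4)] by blast
  \<comment> \<open>A finite spanning set of the whole space, which each cyclicity assumption
    provides, puts every invariant subspace into the locale.\<close>
  have ex_basis: "\<exists>B. nilpotent_row_contraction T n M B"
    if inv: "invariant_subspace T M" and G: "finite G" "cspan G = UNIV" for M G :: "'h set"
  proof -
    have "csubspace M" "M \<subseteq> cspan G" using inv G by (simp_all add: invariant_subspace_def)
    then obtain B where B: "finite B" "B \<subseteq> M" "M = cspan B"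
      by (rule csubspace_finite_basis[OF _ G(1)])
    have "nilpotent_row_contraction T n M B"
    proof
      show "T k x \<in> M" if "x \<in> M" for k x
        using inv that unfolding invariant_subspace_def by blast
    qed (rule bounded assms n B | assumption)+
    then show ?thesis by blast
  qed
  show ?thesis
  proof (intro conjI impI allI; elim conjE)
    fix M N
    assume "cyclic_tuple (\<lambda>k. cadjoint (T k))"
    let ?G = "\<lambda>\<xi>. (\<lambda>\<alpha>. mpow (\<lambda>k. cadjoint (T k)) \<alpha> \<xi>) ` {\<alpha>. mdeg \<alpha> < n}"
    \<comment> \<open>The adjoint tuple is nilpotent with the same \<open>n\<close>: pairing the
      vector with itself brings out a vanishing monomial in \<open>T\<close>.\<close>
    have "mpow (\<lambda>k. cadjoint (T k)) \<alpha> y = 0" if "n \<le> mdeg \<alpha>" for \<alpha> y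
    proof -
      have "cinner z z = 0" if "z = mpow (\<lambda>k. cadjoint (T k)) \<alpha> y" for z
        using cinner_mpow_cadjoint(2)[OF bounded assms(2), where x = z and y = y and \<alpha> = \<alpha>]
          n(2)[OF \<open>n \<le> mdeg \<alpha>\<close>] that by simp
      then show ?thesis by (simp add: cinner_self)
    qed
    then obtain \<xi> where \<xi>: "cspan (?G \<xi>) = UNIV"
      using cyclic_nilpotent_span[OF cinner_mpow_cadjoint(1)[OF bounded assms(2)] \<open>cyclic_tuple _\<close>] by blast
    assume inv: "invariant_subspace T M" "invariant_subspace T N"
      and Ann: "Ann_c M (restrict_tuple T M) = Ann_c N (restrict_tuple T N)"
    have "finite (?G \<xi>)" by (simp add: finite_mdeg_less)
    then obtain B C where "nilpotent_row_contraction T n M B" "nilpotent_row_contraction T n N C"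
      using ex_basis inv \<xi> by meson
    then show "M = N" using Ann_c_eq_imp_subset[OF _ _ _ \<xi>] Ann by (intro equalityI) metis+
  next
    fix M
    assume "cyclic_tuple T" and inv: "invariant_subspace T M"
      and Ann: "Ann_c M (restrict_tuple T M) = Ann_c UNIV T"
    let ?G = "\<lambda>\<xi>. (\<lambda>\<alpha>. mpow T \<alpha> \<xi>) ` {\<alpha>. mdeg \<alpha> < n}"
    obtain \<xi> where \<xi>: "cspan (?G \<xi>) = UNIV"
      using cyclic_nilpotent_span[OF assms(2) \<open>cyclic_tuple T\<close> n(2)] by blast
    have "finite (?G \<xi>)" by (simp add: finite_mdeg_less)
    moreover have "invariant_subspace T UNIV" by (simp add: invariant_subspace_def)
    ultimately obtain B C where "nilpotent_row_contraction T n M B" "nilpotent_row_contraction T n UNIV C"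
      using ex_basis inv \<xi> by meson
    \<comment> \<open>Matches \<open>Ann_c UNIV T\<close> in the claim with the restricted form that
      the locale uses.\<close>
    moreover have "restrict_tuple T UNIV = T" by (intro ext) (simp add: restrict_tuple_def)
    ultimately show "M = UNIV" using Ann_c_eq_imp_UNIV[OF _ _ _ n(1) \<xi>] Ann by metis
  qed
qed

end
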